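(* Let $(\mathcal{A},\mathcal{B})$ be an abstract boundary control system and $f_1\in\mathcal{C}^1(\mathbb{K}^n\times\mathcal{H}\times\mathbb{K}^{m_v};\mathbb{K}^n)$, $f_2\in\mathcal{C}^1(\mathbb{K}^n\times\mathcal{H}\times\mathbb{K}^{m_v};\mathcal{H})$ be vector fields such that Assumptions (A1), (A2), (A3), (A4) of the context hold, and let $D,t_0,\varphi,K,P,\beta,\gamma_1,\gamma_2$ and the resulting constants $C_4,C_6,\kappa_0$ be fixed as in the context. Assume that the small gain condition $$(D_1\tilde{C}_1+D_2)\,C_4\sqrt{\frac{C_6}{2\kappa_0}}<1$$ is satisfied. Then there exist constants $\delta_\epsilon\in(0,\kappa_0)$ and $G_i,H_i\in\mathbb{R}_+$, $0\leq i\leq3$, such that, for any $(x_0,X_0)\in\mathbb{K}^n\times D(\mathcal{A}_0)$ and any $v\in\mathcal{C}^1(\mathbb{R}_+;\mathbb{K}^{m_v})$, the classical solution $(x,X)$ of the interconnected closed-loop system (IC) of the context associated with the initial condition $(x_0,X_0)$ and the disturbance $v$ satisfies, for all $t\geq D+t_0$, $$\begin{aligned}\Vert x(t)\Vert+\Vert X(t)\Vert_{\mathcal{H}}\leq{}& G_0e^{-\delta_\epsilon t}(\Vert x_0\Vert+\Vert X_0\Vert_{\mathcal{H}})+G_1e^{-\delta_\epsilon t}\sup_{\tau\in[0,D+t_0]}\Vert x(\tau)\Vert\\&+G_2e^{-\delta_\epsilon t}\sup_{\tau\in[0,D+t_0]}\Vert X(\tau)\Vert_{\mathcal{H}}+G_3\sup_{\tau\in[0,t]}e^{-\delta_\epsilon(t-\tau)}\Vert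 v(\tau)\Vert,\end{aligned}$$ and the control law satisfies, for all $t\geq D+t_0$, $$\begin{aligned}\Vert u(t)\Vert\leq{}& H_0e^{-\delta_\epsilon t}(\Vert x_0\Vert+\Vert X_0\Vert_{\mathcal{H}})+H_1e^{-\delta_\epsilon t}\sup_{\tau\in[0,D+t_0]}\Vert x(\tau)\Vert\\&+H_2e^{-\delta_\epsilon t}\sup_{\tau\in[0,D+t_0]}\Vert X(\tau)\Vert_{\mathcal{H}}+H_3\sup_{\tau\in[0,t]}e^{-\delta_\epsilon(t-\tau)}\Vert v(\tau)\Vert.\end{aligned}$$
   Context: Notation. $\mathbb{K}$ is $\mathbb{R}$ or $\mathbb{C}$; $(\mathcal{H},\langle\cdot,\cdot\rangle_{\mathcal{H}})$ is a separable Hilbert space over $\mathbb{K}$, with inner product linear in the first argument. $\mathbb{R}_+=[0,\infty)$, $\mathbb{R}_+^*=(0,\infty)$, $\mathbb{N}^*=\{1,2,\dots\}$. $\mathbb{K}^p$ carries the Euclidean norm, matrices and bounded operators the induced norm. Boundary control system. $\mathcal{A}:D(\mathcal{A})\subset\mathcal{H}\to\mathcal{H}$ and $\mathcal{B}:D(\mathcal{B})\subset\mathcal{H}\to\mathbb{K}^m$ are linear with $D(\mathcal{A})\subset D(\mathcal{B})$. $(\mathcal{A},\mathcal{B})$ is an abstract boundary control system if (1) $\mathcal{A}_0:=\mathcal{A}|_{D(\mathcal{A}_0)}$, $D(\mathcal{A}_0):=D(\mathcal{A})\cap\ker\mathcal{B}$, generates a $C_0$-semigroup $S$ on $\mathcal{H}$;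 (2) there is a bounded operator $B\in\mathcal{L}(\mathbb{K}^m,\mathcal{H})$ (a lifting operator) with $\mathrm{R}(B)\subset D(\mathcal{A})$, $\mathcal{A}B\in\mathcal{L}(\mathbb{K}^m,\mathcal{H})$ and $\mathcal{B}B=I_{\mathbb{K}^m}$. One such $B$ is fixed. Assumption (A1). $\mathcal{A}_0$ is a Riesz spectral operator: linear, closed, with simple eigenvalues $\lambda_n\in\mathbb{K}$ and corresponding eigenvectors $\phi_n\in D(\mathcal{A}_0)$, $n\in\mathbb{N}^*$, such that (i) $\{\phi_n\}$ is a Riesz basis: its span is dense in $\mathcal{H}$ and there are constants $m_R,M_R>0$ with $m_R\sum_{n=1}^N|\alpha_n|^2\leq\Vert\sum_{n=1}^N\alpha_n\phi_n\Vert_{\mathcal{H}}^2\leq M_R\sum_{n=1}^N|\alpha_n|^2$ for all $N\in\mathbb{N}^*$ and $\alpha_1,\dots,\alpha_N\in\mathbb{K}$; (ii) the closure of $\{\lambda_n\}$ is totally disconnected, i.e. for distinct $a,b$ in this closure, the segment $[a,b]$ is not contained in it. $\{\psi_n\}$ denotes the biorthogonal sequence: $\langle\phi_k,\psi_l\rangle_{\mathcal{H}}=\delta_{k,l}$. Assumption (A2). $N_0\in\mathbb{N}^*$ and $\alpha>0$ are such that $\operatorname{Re}\lambda_n\leq-\alpha$ for all $n\geq N_0+1$. Let $(e_1,\dots,e_m)$ be the canonical basis of $\mathbb{K}^m$, $b_{n,k}:=-\lambda_n\langle Be_k,\psi_n\rangle_{\mathcal{H}}+\langle\mathcal{A}Be_k,\psi_n\rangle_{\mathcal{H}}$,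 $A_{N_0}:=\mathrm{diag}(\lambda_1,\dots,\lambda_{N_0})$, $B_{N_0}:=(b_{n,k})_{1\leq n\leq N_0,1\leq k\leq m}\in\mathbb{K}^{N_0\times m}$. Assumption (A3). $(A_{N_0},B_{N_0})$ satisfies the Kalman (controllability) rank condition. Assumption (A4). (1) $f_1(x,X,v)$ and $f_2(x,X,v)$ are globally Lipschitz continuous in $(x,X)$ on $\mathbb{K}^n\times\mathcal{H}$, uniformly in $v$ over any compact subset of $\mathbb{K}^{m_v}$. (2) There are constants $D_1,D_2,D_3\geq0$ with $\Vert f_2(x,X,v)\Vert_{\mathcal{H}}\leq D_1\Vert x\Vert+D_2\Vert X\Vert_{\mathcal{H}}+D_3\Vert v\Vert$ for all $x\in\mathbb{K}^n$, $X\in\mathcal{H}$, $v\in\mathbb{K}^{m_v}$. (3) There are constants $\tilde{\kappa}_0>0$ and $\tilde{C}_0,\tilde{C}_1,\tilde{C}_2\in\mathbb{R}_+$ such that for any $x_0\in\mathbb{K}^n$, $X\in\mathcal{C}^0(\mathbb{R}_+;\mathcal{H})$, $v\in\mathcal{C}^0(\mathbb{R}_+;\mathbb{K}^{m_v})$, the solution of $\dot{x}=f_1(x,X,v)$, $x(0)=x_0$, satisfies for all $t\geq0$: $\Vert x(t)\Vert^2\leq\tilde{C}_0^2e^{-2\tilde{\kappa}_0t}\Vert x_0\Vert^2+\sup_{\tau\in[0,t]}\{\tilde{C}_1^2\Vert X(\tau)\Vert_{\mathcal{H}}^2+\tilde{C}_2^2\Vert v(\tau)\Vert^2\}$. Fixed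 data. The delay $D>0$; $t_0>0$; $\varphi\in\mathcal{C}^2([-D,+\infty);\mathbb{R})$ with $0\leq\varphi\leq1$, $\varphi=0$ on $[-D,0]$, $\varphi=1$ on $[t_0,+\infty)$; a gain $K\in\mathbb{K}^{m\times N_0}$ such that $A_{\mathrm{cl}}:=A_{N_0}+e^{-DA_{N_0}}B_{N_0}K$ is Hurwitz; $P$ the Hermitian positive definite matrix with $A_{\mathrm{cl}}^*P+PA_{\mathrm{cl}}=-I_{N_0}$; $\lambda_m(P),\lambda_M(P)$ its smallest and largest eigenvalues; $K_i$ the $i$-th row of $K$. Constants. $C_1:=2\max(1,De^{2D\Vert A_{N_0}\Vert}\Vert B_{N_0}K\Vert^2)$; $C_5:=\frac{2m}{\alpha m_R}\sum_{i=1}^m\{\Vert\mathcal{A}Be_i\Vert_{\mathcal{H}}^2\Vert K_i\Vert^2+\Vert Be_i\Vert_{\mathcal{H}}^2\Vert K_iA_{\mathrm{cl}}\Vert^2\}$. Fix $\beta\in(0,1)$, $\gamma_1>C_1/\lambda_m(P)$ and $\gamma_2>\max\left(\Vert BK\Vert^2/(m_R\lambda_m(P)),\,C_5/(1-\beta)\right)$. Then $C_3:=\gamma_2\lambda_m(P)-\Vert BK\Vert^2/m_R>0$, $C_4:=\sqrt{2M_R}+\Vert BK\Vert/\sqrt{C_3}$, $\kappa_0:=\frac12\min\left(\frac{1-\beta}{\lambda_M(P)},\frac{1-\beta-C_5/\gamma_2}{\lambda_M(P)},\frac{\alpha}{2}\right)>0$, $C_6:=\frac{1}{m_R}\left(\frac{2(m_R+\Vert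 BK\Vert^2)}{\alpha m_R}+\frac{(\gamma_1(1+D)+\gamma_2)\Vert P\Vert^2}{\beta}\right)$. Interconnected closed-loop system (IC), for $t\geq0$: $\dot{x}(t)=f_1(x(t),X(t),v(t))$; $\frac{\mathrm{d}X}{\mathrm{d}t}(t)=\mathcal{A}X(t)+f_2(x(t),X(t),v(t))$; $\mathcal{B}X(t)=u_D(t):=u(t-D)$; $u|_{[-D,0]}=0$; $u(t)=\varphi(t)KY(t)+\varphi(t)K\int_{\max(t-D,0)}^te^{(t-s-D)A_{N_0}}B_{N_0}u(s)\,\mathrm{d}s$; $Y(t)=(\langle X(t),\psi_1\rangle_{\mathcal{H}},\dots,\langle X(t),\psi_{N_0}\rangle_{\mathcal{H}})^\top$; $x(0)=x_0$; $X(0)=X_0$. A classical solution is $(x,X)\in\mathcal{C}^1(\mathbb{R}_+;\mathbb{K}^n)\times(\mathcal{C}^0(\mathbb{R}_+;D(\mathcal{A}))\cap\mathcal{C}^1(\mathbb{R}_+;\mathcal{H}))$ satisfying these equations; when $(\mathcal{A},\mathcal{B})$ is an abstract boundary control system, $f_1\in\mathcal{C}^1(\mathbb{K}^n\times\mathcal{H}\times\mathbb{K}^{m_v};\mathbb{K}^n)$, $f_2\in\mathcal{C}^1(\mathbb{K}^n\times\mathcal{H}\times\mathbb{K}^{m_v};\mathcal{H})$, and Assumptions (A1), (A2), (A3) and (A4) hold, for $(x_0,X_0)\in\mathbb{K}^n\times D(\mathcal{A}_0)$ and $v\in\mathcal{C}^1(\mathbb{R}_+;\mathbb{K}^{m_v})$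 it exists and is unique. *)

theory Defs
  imports "HOL-Analysis.Analysis"
begin

section \<open>The scalar field\<close>

text \<open>
  A type of this class is isometrically isomorphic, as a field over the reals, to the real numbers
  or to the complex numbers: \<open>to_complex\<close> is an isometric embedding whose range is one of the two.
  The superclass \<open>euclidean_space\<close> only makes the library instances for finite dimensional spaces
  available for vectors and matrices over the field.
\<close>

class real_or_complex = real_normed_field + euclidean_space +
  fixes to_complex :: "'a \<Rightarrow> complex"
    and conjK :: "'a \<Rightarrow> 'a"
  assumes to_complex_add: "to_complex (x + y) = to_complex x + to_complex y"
    and to_complex_mult: "to_complex (x * y) = to_complex x * to_complex y"
    and to_complex_scaleR: "to_complex (scaleR r x) = complex_of_real r * to_complex x"
    and norm_to_complex: "cmod (to_complex x) = norm x"
    and range_to_complex: "range to_complex = \<real> \<or> range to_complex = UNIV"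
    and to_complex_conjK: "to_complex (conjK x) = cnj (to_complex x)"

instantiation real :: real_or_complex
begin
definition to_complex_real :: "real \<Rightarrow> complex" where "to_complex_real x = complex_of_real x"
definition conjK_real :: "real \<Rightarrow> real" where "conjK_real x = x"
instance by standard (auto simp: to_complex_real_def conjK_real_def Reals_def)
end

instantiation complex :: real_or_complex
begin
definition to_complex_complex :: "complex \<Rightarrow> complex" where "to_complex_complex x = x"
definition conjK_complex :: "complex \<Rightarrow> complex" where "conjK_complex x = cnj x"
instance by standard (auto simp: to_complex_complex_def conjK_complex_def scaleR_conv_of_real)
end

definition ReK :: "'k::real_or_complex \<Rightarrow> real" where
  "ReK z = Re (to_complex z)"


section \<open>Separable Hilbert spaces over the scalar field\<close>

text \<open>
  The real Banach space structure of the type \<open>'h\<close> (norm, topology, completeness, derivatives) is the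
  one induced by the scalar product.
\<close>

locale separable_hilbert_space = vector_space sc
  for sc :: "'k::real_or_complex \<Rightarrow> 'h::banach \<Rightarrow> 'h" +
  fixes ip :: "'h \<Rightarrow> 'h \<Rightarrow> 'k"
  assumes scale_of_real: "sc (of_real r) x = r *\<^sub>R x"
    and ip_add_left: "ip (x + y) z = ip x z + ip y z"
    and ip_scale_left: "ip (sc c x) y = c * ip x y"
    and ip_commute: "ip y x = conjK (ip x y)"
    and ip_self: "ip x x = of_real ((norm x)\<^sup>2)"
    and separable: "separable_space (euclidean :: 'h topology)"


section \<open>Unbounded operators\<close>

text \<open>An operator is given by a total function together with its domain; values of the function
  outside the domain are irrelevant.\<close>

definition linear_operator ::
  "('k::field \<Rightarrow> 'a::ab_group_add \<Rightarrow> 'a) \<Rightarrow> ('k \<Rightarrow> 'b::ab_group_add \<Rightarrow> 'b) \<Rightarrow> 'a set \<Rightarrow> ('a \<Rightarrow> 'b) \<Rightarrow> bool"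
where
  "linear_operator s1 s2 D A \<longleftrightarrow>
     module.subspace s1 D \<and>
     (\<forall>x\<in>D. \<forall>y\<in>D. A (x + y) = A x + A y) \<and>
     (\<forall>c. \<forall>x\<in>D. A (s1 c x) = s2 c (A x))"

definition closed_operator :: "'a::topological_space set \<Rightarrow> ('a \<Rightarrow> 'b::topological_space) \<Rightarrow> bool" where
  "closed_operator D A \<longleftrightarrow> closed {(x, A x) | x. x \<in> D}"

definition bounded_operator ::
  "('k::field \<Rightarrow> 'a::real_normed_vector \<Rightarrow> 'a) \<Rightarrow> ('k \<Rightarrow> 'b::real_normed_vector \<Rightarrow> 'b) \<Rightarrow> ('a \<Rightarrow> 'b) \<Rightarrow> bool"
where
  "bounded_operator s1 s2 T \<longleftrightarrow> bounded_linear T \<and> (\<forall>c x. T (s1 c x) = s2 c (T x))"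

definition C0_semigroup ::
  "('k::field \<Rightarrow> 'h::real_normed_vector \<Rightarrow> 'h) \<Rightarrow> (real \<Rightarrow> 'h \<Rightarrow> 'h) \<Rightarrow> bool"
where
  "C0_semigroup sc S \<longleftrightarrow>
     (\<forall>t\<ge>0. bounded_operator sc sc (S t)) \<and>
     (\<forall>x. S 0 x = x) \<and>
     (\<forall>s\<ge>0. \<forall>t\<ge>0. \<forall>x. S (s + t) x = S s (S t x)) \<and>
     (\<forall>x. ((\<lambda>t. S t x) \<longlongrightarrow> x) (at_right 0))"

definition generates_semigroup ::
  "'h::real_normed_vector set \<Rightarrow> ('h \<Rightarrow> 'h) \<Rightarrow> (real \<Rightarrow> 'h \<Rightarrow> 'h) \<Rightarrow> bool"
where
  "generates_semigroup D A S \<longleftrightarrow>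
     (\<forall>x y. x \<in> D \<and> A x = y \<longleftrightarrow> ((\<lambda>h. (1 / h) *\<^sub>R (S h x - x)) \<longlongrightarrow> y) (at_right 0))"

text \<open>\<open>root_space sc D A \<mu> j\<close> is the kernel of the \<open>j\<close>-th power of the operator \<open>A - \<mu>\<close> on its
  natural domain. An eigenvalue is simple if its algebraic multiplicity is one, i.e. if its
  generalized eigenspace is the line spanned by an eigenvector.\<close>

primrec root_space ::
  "('k::field \<Rightarrow> 'h::ab_group_add \<Rightarrow> 'h) \<Rightarrow> 'h set \<Rightarrow> ('h \<Rightarrow> 'h) \<Rightarrow> 'k \<Rightarrow> nat \<Rightarrow> 'h set"
where
  "root_space sc D A \<mu> 0 = {0}"
| "root_space sc D A \<mu> (Suc j) = {x \<in> D. A x - sc \<mu> x \<in> root_space sc D A \<mu> j}"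

definition simple_eigenvalue ::
  "('k::field \<Rightarrow> 'h::ab_group_add \<Rightarrow> 'h) \<Rightarrow> 'h set \<Rightarrow> ('h \<Rightarrow> 'h) \<Rightarrow> 'k \<Rightarrow> bool"
where
  "simple_eigenvalue sc D A \<mu> \<longleftrightarrow>
     (\<exists>v\<in>D. v \<noteq> 0 \<and> A v = sc \<mu> v \<and> (\<Union>j. root_space sc D A \<mu> j) = module.span sc {v})"


section \<open>Abstract boundary control systems\<close>

definition dom0 :: "'h set \<Rightarrow> ('h \<Rightarrow> 'k::zero^'m) \<Rightarrow> 'h set" where
  "dom0 DA \<B> = {x \<in> DA. \<B> x = 0}"

definition lifting_operator ::
  "('k::real_or_complex \<Rightarrow> 'h::banach \<Rightarrow> 'h) \<Rightarrow> 'h set \<Rightarrow> ('h \<Rightarrow> 'h) \<Rightarrow> ('h \<Rightarrow> 'k^'m) \<Rightarrow> ('k^'m \<Rightarrow> 'h) \<Rightarrow> bool"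
where
  "lifting_operator sc DA \<A> \<B> B \<longleftrightarrow>
     bounded_operator (*s) sc B \<and>
     range B \<subseteq> DA \<and>
     bounded_operator (*s) sc (\<lambda>w. \<A> (B w)) \<and>
     (\<forall>w. \<B> (B w) = w)"

definition abstract_boundary_control_system ::
  "('k::real_or_complex \<Rightarrow> 'h::banach \<Rightarrow> 'h) \<Rightarrow> 'h set \<Rightarrow> ('h \<Rightarrow> 'h) \<Rightarrow> 'h set \<Rightarrow> ('h \<Rightarrow> 'k^'m) \<Rightarrow> bool"
where
  "abstract_boundary_control_system sc DA \<A> DB \<B> \<longleftrightarrow>
     linear_operator sc sc DA \<A> \<and>
     linear_operator sc (*s) DB \<B> \<and>
     DA \<subseteq> DB \<and>
     (\<exists>S. C0_semigroup sc S \<and> generates_semigroup (dom0 DA \<B>) \<A> S) \<and>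
     (\<exists>B. lifting_operator sc DA \<A> \<B> B)"


section \<open>Riesz spectral operators\<close>

text \<open>Sequences are indexed from 1; their entry at 0 is irrelevant.\<close>

definition riesz_basis ::
  "('k::real_or_complex \<Rightarrow> 'h::banach \<Rightarrow> 'h) \<Rightarrow> (nat \<Rightarrow> 'h) \<Rightarrow> real \<Rightarrow> real \<Rightarrow> bool"
where
  "riesz_basis sc \<phi> m\<^sub>R M\<^sub>R \<longleftrightarrow>
     closure (module.span sc (\<phi> ` {1..})) = UNIV \<and>
     m\<^sub>R > 0 \<and> M\<^sub>R > 0 \<and>
     (\<forall>N\<ge>1. \<forall>a :: nat \<Rightarrow> 'k.
        m\<^sub>R * (\<Sum>n=1..N. (norm (a n))\<^sup>2) \<le> (norm (\<Sum>n=1..N. sc (a n) (\<phi> n)))\<^sup>2 \<and>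
        (norm (\<Sum>n=1..N. sc (a n) (\<phi> n)))\<^sup>2 \<le> M\<^sub>R * (\<Sum>n=1..N. (norm (a n))\<^sup>2))"

definition segment_free :: "'k::real_vector set \<Rightarrow> bool" where
  "segment_free C \<longleftrightarrow> (\<forall>a\<in>C. \<forall>b\<in>C. a \<noteq> b \<longrightarrow> \<not> closed_segment a b \<subseteq> C)"

definition riesz_spectral_operator ::
  "('k::real_or_complex \<Rightarrow> 'h::banach \<Rightarrow> 'h) \<Rightarrow> 'h set \<Rightarrow> ('h \<Rightarrow> 'h) \<Rightarrow>
   (nat \<Rightarrow> 'k) \<Rightarrow> (nat \<Rightarrow> 'h) \<Rightarrow> real \<Rightarrow> real \<Rightarrow> bool"
where
  "riesz_spectral_operator sc D A lam \<phi> m\<^sub>R M\<^sub>R \<longleftrightarrow>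
     linear_operator sc sc D A \<and>
     closed_operator D A \<and>
     inj_on lam {1..} \<and>
     (\<forall>n\<ge>1. simple_eigenvalue sc D A (lam n)) \<and>
     (\<forall>n\<ge>1. \<phi> n \<in> D \<and> \<phi> n \<noteq> 0 \<and> A (\<phi> n) = sc (lam n) (\<phi> n)) \<and>
     riesz_basis sc \<phi> m\<^sub>R M\<^sub>R \<and>
     segment_free (closure (lam ` {1..}))"

definition biorthogonal :: "('h \<Rightarrow> 'h \<Rightarrow> 'k::real_or_complex) \<Rightarrow> (nat \<Rightarrow> 'h) \<Rightarrow> (nat \<Rightarrow> 'h) \<Rightarrow> bool" where
  "biorthogonal ip \<phi> \<psi> \<longleftrightarrow> (\<forall>k\<ge>1. \<forall>l\<ge>1. ip (\<phi> k) (\<psi> l) = (if k = l then 1 else 0))"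


section \<open>Matrices\<close>

text \<open>Vectors of the library type \<open>'k^'n\<close> carry the Euclidean norm.\<close>

definition mnorm :: "'k::real_or_complex^'n^'m \<Rightarrow> real" where
  "mnorm M = onorm (\<lambda>x. M *v x)"

primrec mpow :: "'k::real_or_complex^'n^'n \<Rightarrow> nat \<Rightarrow> 'k^'n^'n" where
  "mpow M 0 = mat 1"
| "mpow M (Suc j) = M ** mpow M j"

definition mexp :: "'k::real_or_complex^'n^'n \<Rightarrow> 'k^'n^'n" where
  "mexp M = (\<Sum>j. (1 / fact j) *\<^sub>R mpow M j)"

definition adjointK :: "'k::real_or_complex^'n^'m \<Rightarrow> 'k^'m^'n" where
  "adjointK M = (\<chi> i j. conjK (M $ j $ i))"

text \<open>Over the reals, too, eigenvalues of a matrix are its complex eigenvalues.\<close>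

definition eigenvalues :: "'k::real_or_complex^'n^'n \<Rightarrow> complex set" where
  "eigenvalues M = {z. \<exists>v :: complex^'n. v \<noteq> 0 \<and> map_matrix to_complex M *v v = z *s v}"

definition hurwitz :: "'k::real_or_complex^'n^'n \<Rightarrow> bool" where
  "hurwitz M \<longleftrightarrow> (\<forall>z\<in>eigenvalues M. Re z < 0)"

definition hermitian_pos_def :: "'k::real_or_complex^'n^'n \<Rightarrow> bool" where
  "hermitian_pos_def P \<longleftrightarrow>
     adjointK P = P \<and>
     (\<forall>v. v \<noteq> 0 \<longrightarrow> ReK (\<Sum>i\<in>UNIV. (P *v v) $ i * conjK (v $ i)) > 0)"

text \<open>These two are meant for Hermitian matrices only, whose eigenvalues are real.\<close>

definition lambda_min :: "'k::real_or_complex^'n^'n \<Rightarrow> real" where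
  "lambda_min P = Min (Re ` eigenvalues P)"

definition lambda_max :: "'k::real_or_complex^'n^'n \<Rightarrow> real" where
  "lambda_max P = Max (Re ` eigenvalues P)"

text \<open>The index type \<open>'p\<close> stands for \<open>{1..N}\<close> through the bijection \<open>\<iota>\<close>. The column of the controllability
  matrix \<open>(B, A B, \<dots>, A^(N-1) B)\<close> with index \<open>(j, k)\<close> is column \<open>k\<close> of its block number \<open>\<iota> j\<close>.\<close>

definition kalman_matrix ::
  "('p::finite \<Rightarrow> nat) \<Rightarrow> 'k::real_or_complex^'p^'p \<Rightarrow> 'k^'m::finite^'p \<Rightarrow> 'k^('p \<times> 'm)^'p"
where
  "kalman_matrix \<iota> A B = (\<chi> i jk. (mpow A (\<iota> (fst jk) - 1) ** B) $ i $ snd jk)"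

definition kalman_condition ::
  "('p::finite \<Rightarrow> nat) \<Rightarrow> 'k::real_or_complex^'p^'p \<Rightarrow> 'k^'m::finite^'p \<Rightarrow> bool"
where
  "kalman_condition \<iota> A B \<longleftrightarrow> rank (kalman_matrix \<iota> A B) = CARD('p)"

text \<open>The truncated model: the modes \<open>lam 1, \<dots>, lam N\<close> and the input coefficients \<open>b\<^sub>n\<^sub>,\<^sub>k\<close>.\<close>

definition modes_matrix :: "('p::finite \<Rightarrow> nat) \<Rightarrow> (nat \<Rightarrow> 'k::real_or_complex) \<Rightarrow> 'k^'p^'p" where
  "modes_matrix \<iota> lam = (\<chi> i j. if i = j then lam (\<iota> i) else 0)"

definition input_coeff ::
  "('h \<Rightarrow> 'h \<Rightarrow> 'k) \<Rightarrow> ('h \<Rightarrow> 'h) \<Rightarrow> ('k^'m \<Rightarrow> 'h) \<Rightarrow> (nat \<Rightarrow> 'k) \<Rightarrow> (nat \<Rightarrow> 'h) \<Rightarrow>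
   nat \<Rightarrow> 'm::finite \<Rightarrow> 'k::real_or_complex"
where
  "input_coeff ip \<A> B lam \<psi> n k =
     - lam n * ip (B (axis k 1)) (\<psi> n) + ip (\<A> (B (axis k 1))) (\<psi> n)"

definition input_matrix ::
  "('p::finite \<Rightarrow> nat) \<Rightarrow> ('h \<Rightarrow> 'h \<Rightarrow> 'k) \<Rightarrow> ('h \<Rightarrow> 'h) \<Rightarrow> ('k^'m \<Rightarrow> 'h) \<Rightarrow> (nat \<Rightarrow> 'k) \<Rightarrow>
   (nat \<Rightarrow> 'h) \<Rightarrow> 'k::real_or_complex^'m::finite^'p"
where
  "input_matrix \<iota> ip \<A> B lam \<psi> = (\<chi> i k. input_coeff ip \<A> B lam \<psi> (\<iota> i) k)"


section \<open>Regularity\<close>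

text \<open>Functions of a real variable on an interval \<open>S\<close>; derivatives at end points are one-sided.\<close>

definition C1_on :: "real set \<Rightarrow> (real \<Rightarrow> 'a::real_normed_vector) \<Rightarrow> bool" where
  "C1_on S f \<longleftrightarrow>
     (\<exists>f'. (\<forall>t\<in>S. (f has_vector_derivative f' t) (at t within S)) \<and> continuous_on S f')"

definition C2_on :: "real set \<Rightarrow> (real \<Rightarrow> 'a::real_normed_vector) \<Rightarrow> bool" where
  "C2_on S f \<longleftrightarrow>
     (\<exists>f'. (\<forall>t\<in>S. (f has_vector_derivative f' t) (at t within S)) \<and> C1_on S f')"

text \<open>Continuous Frechet differentiability over the reals, also when the scalar field is complex.\<close>

definition C1_map :: "('a::real_normed_vector \<Rightarrow> 'b::real_normed_vector) \<Rightarrow> bool" where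
  "C1_map f \<longleftrightarrow>
     (\<exists>f' :: 'a \<Rightarrow> 'a \<Rightarrow>\<^sub>L 'b.
        (\<forall>z. (f has_derivative blinfun_apply (f' z)) (at z)) \<and> continuous_on UNIV f')"

definition uniformly_lipschitz ::
  "('x::metric_space \<Rightarrow> 'h::metric_space \<Rightarrow> 'v::topological_space \<Rightarrow> 'b::metric_space) \<Rightarrow> bool"
where
  "uniformly_lipschitz f \<longleftrightarrow>
     (\<forall>V. compact V \<longrightarrow> (\<exists>L. \<forall>v\<in>V. L-lipschitz_on UNIV (\<lambda>(x, X). f x X v)))"


section \<open>The interconnected closed-loop system\<close>

text \<open>Input-to-state estimate for \<open>x' = f\<^sub>1(x, X, v)\<close> with external inputs \<open>X\<close> and \<open>v\<close>.\<close>

definition ode_iss ::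
  "('x::real_normed_vector \<Rightarrow> 'h::real_normed_vector \<Rightarrow> 'v::real_normed_vector \<Rightarrow> 'x) \<Rightarrow>
   real \<Rightarrow> real \<Rightarrow> real \<Rightarrow> real \<Rightarrow> bool"
where
  "ode_iss f\<^sub>1 \<kappa> C0 C1 C2 \<longleftrightarrow>
     (\<forall>x\<^sub>0 X v x.
        continuous_on {0..} X \<longrightarrow> continuous_on {0..} v \<longrightarrow>
        x 0 = x\<^sub>0 \<longrightarrow>
        (\<forall>t\<ge>0. (x has_vector_derivative f\<^sub>1 (x t) (X t) (v t)) (at t within {0..})) \<longrightarrow>
        (\<forall>t\<ge>0. (norm (x t))\<^sup>2 \<le>
           C0\<^sup>2 * exp (- 2 * \<kappa> * t) * (norm x\<^sub>0)\<^sup>2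
           + (SUP \<tau>\<in>{0..t}. C1\<^sup>2 * (norm (X \<tau>))\<^sup>2 + C2\<^sup>2 * (norm (v \<tau>))\<^sup>2)))"

definition mode_coords ::
  "('p::finite \<Rightarrow> nat) \<Rightarrow> ('h \<Rightarrow> 'h \<Rightarrow> 'k) \<Rightarrow> (nat \<Rightarrow> 'h) \<Rightarrow> 'h \<Rightarrow> 'k::real_or_complex^'p"
where
  "mode_coords \<iota> ip \<psi> X = (\<chi> i. ip X (\<psi> (\<iota> i)))"

text \<open>
  The predictor feedback \<open>u = \<theta> K Y + \<theta> K \<integral> e\<^bsup>(t-s-D)A\<^esup> B\<^sub>N u(s) ds\<close> is implicit in \<open>u\<close>, which vanishes
  on \<open>[-D, 0]\<close> and is sought among continuous functions on \<open>[-D, \<infinity>)\<close>.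
\<close>

definition predictor_feedback ::
  "real \<Rightarrow> (real \<Rightarrow> real) \<Rightarrow> 'k::real_or_complex^'p^'p \<Rightarrow> 'k^'m^'p \<Rightarrow> 'k^'p^'m \<Rightarrow>
   (real \<Rightarrow> 'k^'p) \<Rightarrow> (real \<Rightarrow> 'k^'m) \<Rightarrow> bool"
where
  "predictor_feedback D \<theta> A B\<^sub>N K Y u \<longleftrightarrow>
     continuous_on {-D..} u \<and>
     (\<forall>t\<in>{-D..0}. u t = 0) \<and>
     (\<forall>t\<ge>0. u t =
        \<theta> t *\<^sub>R (K *v Y t)
        + \<theta> t *\<^sub>R (K *v integral {max (t - D) 0..t}
                          (\<lambda>s. mexp ((t - s - D) *\<^sub>R A) *v (B\<^sub>N *v u s))))"

text \<open>
  \<open>x\<close> is continuously differentiable on \<open>[0, \<infinity>)\<close>, and so is \<open>X\<close>, which is moreover continuous with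
  values in the domain of \<open>\<A>\<close> equipped with the graph norm.
\<close>

definition classical_solution ::
  "'h::banach set \<Rightarrow> ('h \<Rightarrow> 'h) \<Rightarrow> ('h \<Rightarrow> 'k::real_or_complex^'m) \<Rightarrow>
   ('k^'n \<Rightarrow> 'h \<Rightarrow> 'k^'v \<Rightarrow> 'k^'n) \<Rightarrow> ('k^'n \<Rightarrow> 'h \<Rightarrow> 'k^'v \<Rightarrow> 'h) \<Rightarrow>
   ('p::finite \<Rightarrow> nat) \<Rightarrow> ('h \<Rightarrow> 'h \<Rightarrow> 'k) \<Rightarrow> (nat \<Rightarrow> 'h) \<Rightarrow>
   real \<Rightarrow> (real \<Rightarrow> real) \<Rightarrow> 'k^'p^'p \<Rightarrow> 'k^'m^'p \<Rightarrow> 'k^'p^'m \<Rightarrow>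
   'k^'n \<Rightarrow> 'h \<Rightarrow> (real \<Rightarrow> 'k^'v) \<Rightarrow>
   (real \<Rightarrow> 'k^'n) \<Rightarrow> (real \<Rightarrow> 'h) \<Rightarrow> (real \<Rightarrow> 'k^'m) \<Rightarrow> bool"
where
  "classical_solution DA \<A> \<B> f\<^sub>1 f\<^sub>2 \<iota> ip \<psi> D \<theta> A B\<^sub>N K x\<^sub>0 X\<^sub>0 v x X u \<longleftrightarrow>
     C1_on {0..} x \<and> C1_on {0..} X \<and>
     (\<forall>t\<ge>0. X t \<in> DA) \<and> continuous_on {0..} X \<and> continuous_on {0..} (\<lambda>t. \<A> (X t)) \<and>
     (\<forall>t\<ge>0. (x has_vector_derivative f\<^sub>1 (x t) (X t) (v t)) (at t within {0..})) \<and>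
     (\<forall>t\<ge>0. (X has_vector_derivative \<A> (X t) + f\<^sub>2 (x t) (X t) (v t)) (at t within {0..})) \<and>
     (\<forall>t\<ge>0. \<B> (X t) = u (t - D)) \<and>
     predictor_feedback D \<theta> A B\<^sub>N K (\<lambda>t. mode_coords \<iota> ip \<psi> (X t)) u \<and>
     x 0 = x\<^sub>0 \<and> X 0 = X\<^sub>0"

end

theory Submission
  imports Defs
begin

text \<open>
  The modes above \<open>N\<^sub>0\<close> are stable, and the Artstein predictor \<open>Z\<close> turns the delayed equation of the
  finitely many remaining modes into \<open>Z' = A\<^sub>c\<^sub>l Z + F\<close> for \<open>t \<ge> t\<^sub>0\<close>. On \<open>[D + t\<^sub>0, \<infinity>)\<close> the functional
  \<open>V = \<gamma>\<^sub>1 (Z\<^sup>*PZ + \<integral> Z\<^sup>*PZ over [t - D, t]) + \<gamma>\<^sub>2 Z\<^sup>*PZ(t - D) + 1/2 \<Sum>n>N\<^sub>0. |\<langle>X - B u\<^sub>D, \<psi>\<^sub>n\<rangle>|\<^sup>2\<close>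
  satisfies \<open>V' \<le> - 2 \<kappa>\<^sub>0 V + C\<^sub>6 sup |f\<^sub>2|\<^sup>2\<close>, the supremum being over \<open>[t - D, t]\<close>, and \<open>|X| \<le> C\<^sub>4 \<surd>V\<close>. To
  avoid differentiating a series, the sum is cut at a finite \<open>N\<close>; all estimates are uniform in \<open>N\<close>.
  Comparing the suprema of \<open>e\<^bsup>\<delta>t\<^esup> |X|\<close> and \<open>e\<^bsup>\<delta>t\<^esup> |x|\<close> on \<open>[0, t]\<close>, the loop gain tends to the one of the small
  gain condition as \<open>\<delta>\<close> tends to 0.
\<close>

section \<open>The scalar field and its vectors\<close>

text \<open>Factors of the small gain product: \<open>D\<^sub>1\<close> and \<open>D\<^sub>2\<close>
  lead from \<open>x\<close> and \<open>X\<close> to the forcing, \<open>C1'\<close> from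
  \<open>X\<close> to \<open>x\<close>, the square root from the forcing to the root of the
  functional, and \<open>C\<^sub>4\<close> from there back to \<open>X\<close>. Strictness leaves
  room for exponential weights. Three obstacles shape the proof. The estimate assumed for
  \<open>x\<close> bounds its inputs by an unweighted supremum; restarting it on windows gives it
  fading memory. The equation of \<open>Z\<close> closes up only after \<open>t\<^sub>0\<close>, and
  the functional looks back by \<open>D\<close>, so on \<open>[0, D + t\<^sub>0]\<close> no decay is
  available, only a bound by the supremum of the state, obtained by Gronwall for the implicit
  control law. Finally, projecting the state equation on \<psi>_n requires \<psi>_n to behave as an
  eigenvector of the adjoint of an unbounded operator; this is derived from the semigroup, whose
  operators are bounded and commute with limits. All suprema are over compact intervals, hence
  finite before any stability is known; this is what permits solving the loop inequality.\<close>

lemma to_complex_0 [simp]: "to_complex (0::'k::real_or_complex) = 0"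
  using norm_to_complex[of "0::'k"] by simp

lemma to_complex_minus: "to_complex (- x :: 'k::real_or_complex) = - to_complex x"
  using to_complex_scaleR[of "-1" x] by simp

lemma to_complex_diff: "to_complex (x - y :: 'k::real_or_complex) = to_complex x - to_complex y"
  using to_complex_add[of x "- y"] by (simp add: to_complex_minus)

lemma to_complex_inject [simp]: "to_complex x = to_complex y \<longleftrightarrow> x = (y::'k::real_or_complex)"
proof
  assume "to_complex x = to_complex y"
  then have "norm (x - y) = 0"
    using norm_to_complex[of "x - y"] by (simp add: to_complex_diff)
  then show "x = y" by simp
qed simp

lemma to_complex_1 [simp]: "to_complex (1::'k::real_or_complex) = 1"
proof -
  have "to_complex (1::'k) * to_complex (1::'k) = to_complex (1::'k)"
    by (metis mult_1 to_complex_mult)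
  moreover have "to_complex (1::'k) \<noteq> 0"
    by (metis to_complex_0 to_complex_inject zero_neq_one)
  ultimately show ?thesis by simp
qed

lemma to_complex_of_real [simp]: "to_complex (of_real r :: 'k::real_or_complex) = complex_of_real r"
  using to_complex_scaleR[of r "1::'k"] by (simp add: scaleR_conv_of_real)

lemma to_complex_sum: "to_complex (\<Sum>i\<in>I. f i :: 'k::real_or_complex) = (\<Sum>i\<in>I. to_complex (f i))"
  by (induction I rule: infinite_finite_induct) (auto simp: to_complex_add)

lemma conjK_mult: "conjK (x * y) = conjK x * conjK (y::'k::real_or_complex)"
  by (rule to_complex_inject[THEN iffD1]) (simp add: to_complex_conjK to_complex_mult)

lemma conjK_add: "conjK (x + y) = conjK x + conjK (y::'k::real_or_complex)"
  by (rule to_complex_inject[THEN iffD1]) (simp add: to_complex_conjK to_complex_add)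

lemma conjK_conjK [simp]: "conjK (conjK x) = (x::'k::real_or_complex)"
  by (rule to_complex_inject[THEN iffD1]) (simp add: to_complex_conjK)

lemma mult_conjK: "x * conjK x = of_real ((norm (x::'k::real_or_complex))\<^sup>2)"
proof (rule to_complex_inject[THEN iffD1])
  show "to_complex (x * conjK x) = to_complex (of_real ((norm x)\<^sup>2) :: 'k)"
    using complex_norm_square[of "to_complex x"]
    by (simp add: norm_to_complex to_complex_mult to_complex_conjK del: of_real_power)
qed

text \<open>The class does not relate the \<open>inner\<close> of \<open>euclidean_space\<close> to
  the field structure; polarisation of the norm does, because the embedding is isometric. From here
  on estimates use the real \<open>inner\<close>, also over complex scalars.\<close>

lemma inner_eq_Re: "inner x y = Re (to_complex x * cnj (to_complex y))" for x y :: "'k::real_or_complex"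
proof -
  have "(norm (x + y))\<^sup>2 = (norm x)\<^sup>2 + (norm y)\<^sup>2 + 2 * Re (to_complex x * cnj (to_complex y))"
    unfolding norm_to_complex[where 'a='k, symmetric] to_complex_add cmod_power2
    by (simp add: power2_eq_square algebra_simps)
  then show ?thesis
    by (simp add: dot_norm)
qed

lemma inner_mult_left_conjK: "inner (a * x) y = inner x (conjK a * y)" for a :: "'k::real_or_complex"
  unfolding inner_eq_Re[where 'k='k] to_complex_mult to_complex_conjK by (simp add: algebra_simps)

lemma inner_mult_self: "inner x (a * x) = ReK a * (norm x)\<^sup>2" for a :: "'k::real_or_complex"
  unfolding inner_eq_Re[where 'k='k] ReK_def norm_to_complex[where 'a='k, symmetric] cmod_power2 to_complex_mult
  by (simp add: power2_eq_square algebra_simps)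

lemma norm_matrix_vector_mult_le: "norm (M *v x) \<le> mnorm M * norm (x :: 'k::real_or_complex^'n)"
  unfolding mnorm_def by (rule onorm) simp

lemma norm_vec_power2: "(norm (x::'a::real_normed_vector^'n))\<^sup>2 = (\<Sum>i\<in>UNIV. (norm (x $ i))\<^sup>2)"
  by (simp add: norm_vec_def L2_set_def sum_nonneg)

lemma mnorm_nonneg [simp]: "mnorm M \<ge> 0" for M :: "'k::real_or_complex^'n^'m"
  unfolding mnorm_def by (rule onorm_pos_le) simp

section \<open>Hermitian matrices\<close>

text \<open>The conjugate transpose is the adjoint even for the real \<open>inner\<close>, since a
  scalar factor moves across it as its conjugate. So the Lyapunov equation can be used with real
  forms.\<close>

lemma inner_adjointK: "inner (adjointK M *v x) y = inner x (M *v y)"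
  for M :: "'k::real_or_complex^'n^'m"
proof -
  have "inner (adjointK M *v x) y = (\<Sum>j\<in>UNIV. \<Sum>i\<in>UNIV. inner (conjK (M $ i $ j) * x $ i) (y $ j))"
    by (simp add: inner_vec_def matrix_vector_mult_def adjointK_def inner_sum_left)
  also have "\<dots> = (\<Sum>j\<in>UNIV. \<Sum>i\<in>UNIV. inner (x $ i) (M $ i $ j * y $ j))"
    by (simp add: inner_mult_left_conjK)
  also have "\<dots> = inner x (M *v y)"
    by (subst sum.swap) (simp add: inner_vec_def matrix_vector_mult_def inner_sum_right)
  finally show ?thesis .
qed

lemma quadratic_form_eq_inner: "ReK (\<Sum>i\<in>UNIV. (P *v v) $ i * conjK (v $ i)) = inner (P *v v) v"
  for P :: "'k::real_or_complex^'n^'n"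
  unfolding ReK_def to_complex_sum to_complex_mult to_complex_conjK inner_vec_def inner_eq_Re[where 'k='k]
  by simp

text \<open>A minimiser \<open>v\<close> of the Rayleigh quotient on the compact unit sphere is an
  eigenvector: otherwise the form could be lowered along the residual \<open>w\<close>.\<close>

lemma selfadjoint_min_eigenvector:
  fixes T :: "'a::euclidean_space \<Rightarrow> 'a"
  assumes lin: "linear T" and sym: "\<And>x y. inner (T x) y = inner x (T y)"
  obtains v \<mu> where "norm v = 1" "T v = \<mu> *\<^sub>R v" "\<And>x. \<mu> * (norm x)\<^sup>2 \<le> inner (T x) x"
proof -
  have bl: "bounded_linear T" using lin by (rule linear_conv_bounded_linear[THEN iffD1])
  interpret bounded_linear T by fact
  have "continuous_on (sphere 0 1) (\<lambda>x. inner (T x) x)"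
    by (intro continuous_intros linear_continuous_on bl)
  moreover have "(sphere 0 1 :: 'a set) \<noteq> {}"
    using vector_choose_size[of 1] by force
  ultimately obtain v where v: "norm v = 1" and
    vmin: "\<And>y. norm y = 1 \<Longrightarrow> inner (T v) v \<le> inner (T y) y"
    using continuous_attains_inf[OF compact_sphere, of 0 1 "\<lambda>x. inner (T x) x"] by auto
  define \<mu> where "\<mu> = inner (T v) v"
  have ge: "\<mu> * (norm x)\<^sup>2 \<le> inner (T x) x" for x
  proof (cases "x = 0")
    case False
    have "\<mu> \<le> inner (T (x /\<^sub>R norm x)) (x /\<^sub>R norm x)"
      unfolding \<mu>_def by (rule vmin) (use False in simp)
    also have "\<dots> = inner (T x) x / (norm x)\<^sup>2"
      by (simp add: scaleR divide_inverse power2_eq_square)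
    finally show ?thesis using False by (simp add: pos_le_divide_eq)
  qed simp
  \<comment> \<open>\<open>w\<close> is orthogonal to \<open>v\<close>, so along
    \<open>v + s w\<close> the nonnegative form of \<open>T - \<mu>\<close> is a quadratic in
    \<open>s\<close> without constant term and with slope \<open>2 |w|^2\<close> at 0. A small
    negative \<open>s\<close> makes it negative unless \<open>w = 0\<close>.\<close>
  define w where "w = T v - \<mu> *\<^sub>R v"
  have eq: "inner (T (v + s *\<^sub>R w)) (v + s *\<^sub>R w) - \<mu> * (norm (v + s *\<^sub>R w))\<^sup>2
        = 2 * s * (norm w)\<^sup>2 + s\<^sup>2 * (inner (T w) w - \<mu> * (norm w)\<^sup>2)" for s
  proof -
    have vv: "inner v v = 1" using v by (simp add: dot_square_norm)
    have 1: "inner (T w) v = inner w (T v)" by (rule sym)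
    have 2: "inner v w = 0"
      unfolding w_def by (simp add: inner_diff_right vv \<mu>_def inner_commute)
    have 3: "inner w w = inner w (T v)"
      using 2 by (subst (2) w_def) (simp add: inner_diff_right inner_commute)
    have 4: "inner w v = 0" "inner (T v) w = inner w w" "inner (T w) v = inner w w"
      using 1 2 3 by (simp_all add: inner_commute)
    show ?thesis
      unfolding power2_norm_eq_inner add scaleR inner_add_left inner_add_right inner_scaleR_left
        inner_scaleR_right 2 4 vv \<mu>_def[symmetric]
      by (simp add: power2_eq_square algebra_simps)
  qed
  have "w = 0"
  proof (rule ccontr)
    assume "w \<noteq> 0"
    \<comment> \<open>\<open>c\<close> is positive and dominates the quadratic coefficient, so
      \<open>s = - |w|^2 / c\<close> gives at most \<open>- |w|^4 / c\<close>.\<close>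
    define c where "c = \<bar>inner (T w) w - \<mu> * (norm w)\<^sup>2\<bar> + 1"
    have c: "c > 0" unfolding c_def by simp
    define s where "s = - (norm w)\<^sup>2 / c"
    have s: "s < 0" unfolding s_def using \<open>w \<noteq> 0\<close> c by (simp add: divide_neg_pos)
    have "0 \<le> 2 * s * (norm w)\<^sup>2 + s\<^sup>2 * (inner (T w) w - \<mu> * (norm w)\<^sup>2)"
      using eq[of s] ge[of "v + s *\<^sub>R w"] by simp
    also have "\<dots> \<le> 2 * s * (norm w)\<^sup>2 + s\<^sup>2 * c"
      unfolding c_def by (intro add_left_mono mult_left_mono) auto
    also have "\<dots> = s * (norm w)\<^sup>2"
    proof -
      have "s * c = - (norm w)\<^sup>2" using c by (simp add: s_def)
      then have "s\<^sup>2 * c = - s * (norm w)\<^sup>2" by (simp add: power2_eq_square mult.assoc)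
      then show ?thesis by simp
    qed
    also have "\<dots> < 0" using s \<open>w \<noteq> 0\<close> by (simp add: mult_neg_pos)
    finally show False by simp
  qed
  then have "T v = \<mu> *\<^sub>R v" by (simp add: w_def)
  with v ge that show ?thesis by blast
qed

lemma inner_map_to_complex_vec:
  fixes a b :: "'k::real_or_complex^'n"
  shows "inner (\<chi> i. to_complex (a $ i)) (\<chi> i. to_complex (b $ i)) = inner a b"
  by (simp add: inner_vec_def inner_eq_Re[where 'k='k] inner_complex_def)

lemma map_to_complex_mult_vec:
  fixes M :: "'k::real_or_complex^'n^'m"
  shows "map_matrix to_complex M *v (\<chi> i. to_complex (a $ i)) = (\<chi> i. to_complex ((M *v a) $ i))"
  by (simp add: vec_eq_iff matrix_vector_mult_def map_matrix_def to_complex_sum to_complex_mult)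

lemma adjointK_map_to_complex:
  fixes M :: "'k::real_or_complex^'n^'m"
  shows "adjointK (map_matrix to_complex M) = map_matrix to_complex (adjointK M)"
  by (simp add: vec_eq_iff adjointK_def map_matrix_def conjK_complex_def to_complex_conjK)

text \<open>Over the reals the vector splits into real and imaginary part; over the complex numbers
  \<open>b\<close> is simply taken to be 0. The alternative in the conclusion later makes the cross
  terms between the two components vanish.\<close>

lemma vec_complex_decompose:
  fixes v :: "complex^'n"
  obtains a b :: "'k::real_or_complex^'n"
  where "v = (\<chi> i. to_complex (a $ i)) + \<i> *s (\<chi> i. to_complex (b $ i))"
    and "b = 0 \<or> range (to_complex :: 'k \<Rightarrow> complex) = \<real>"
proof (cases "range (to_complex :: 'k \<Rightarrow> complex) = \<real>")
  case True
  have inv: "to_complex (inv to_complex (of_real r) :: 'k) = of_real r" for r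
    by (rule f_inv_into_f) (simp add: True)
  show thesis
    by (rule that[of "\<chi> i. inv to_complex (of_real (Re (v $ i)))" "\<chi> i. inv to_complex (of_real (Im (v $ i)))"])
      (simp_all add: vec_eq_iff inv True complex_eq mult.commute)
next
  case False
  then have "range (to_complex :: 'k \<Rightarrow> complex) = UNIV" using range_to_complex by blast
  then have inv: "to_complex (inv to_complex z :: 'k) = z" for z
    by (intro f_inv_into_f) simp
  show thesis
    by (rule that[of "\<chi> i. inv to_complex (v $ i)" 0]) (simp_all add: vec_eq_iff inv)
qed

text \<open>Finiteness gives the \<open>Min\<close> and \<open>Max\<close> in
  \<open>lambda_min\<close> and \<open>lambda_max\<close> their meaning. Eigenvalues are real
  because multiplication by the imaginary unit is skew for \<open>inner\<close>; eigenvectors of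
  different eigenvalues are then orthogonal, hence independent.\<close>

lemma finite_eigenvalues_hermitian:
  fixes P :: "'k::real_or_complex^'n^'n"
  assumes "adjointK P = P"
  shows "finite (eigenvalues P)" "z \<in> eigenvalues P \<Longrightarrow> Im z = 0"
proof -
  let ?P = "map_matrix to_complex P"
  have sym: "inner (?P *v x) y = inner x (?P *v y)" for x y
    using inner_adjointK[of ?P] assms by (simp add: adjointK_map_to_complex)
  show real: "Im z = 0" if "z \<in> eigenvalues P" for z
  proof -
    obtain v where v: "v \<noteq> 0" "?P *v v = z *s v" using \<open>z \<in> _\<close> by (auto simp: eigenvalues_def)
    have "?P *v (\<i> *s v) = \<i> *s (z *s v)"
      unfolding v(2)[symmetric] by (rule vector_scalar_commute)
    then have "inner (z *s v) (\<i> *s v) = inner v (\<i> *s (z *s v))"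
      using sym[of v "\<i> *s v"] v(2) by simp
    moreover have "inner (z *s v) (\<i> *s v) = Im z * (norm v)\<^sup>2"
      unfolding inner_vec_def norm_vec_power2 sum_distrib_left cmod_power2
      by (rule sum.cong) (simp_all add: inner_complex_def power2_eq_square algebra_simps)
    moreover have "inner v (\<i> *s (z *s v)) = - Im z * (norm v)\<^sup>2"
      unfolding inner_vec_def norm_vec_power2 sum_distrib_left cmod_power2
      by (rule sum.cong) (simp_all add: inner_complex_def power2_eq_square algebra_simps)
    ultimately show ?thesis using v by simp
  qed
  have "\<forall>z\<in>eigenvalues P. \<exists>v. v \<noteq> 0 \<and> ?P *v v = z *s v" by (auto simp: eigenvalues_def)
  then obtain v where v: "\<And>z. z \<in> eigenvalues P \<Longrightarrow> v z \<noteq> 0 \<and> ?P *v v z = z *s v z" by metis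
  have scale: "w *s x = Re w *\<^sub>R x" if "Im w = 0" for w and x :: "complex^'n"
    using that by (simp add: vec_eq_iff complex_eq_iff)
  have orth: "inner (v z) (v w) = 0" if "z \<in> eigenvalues P" "w \<in> eigenvalues P" "z \<noteq> w" for z w
  proof -
    have "Re z \<noteq> Re w" using real that by (auto simp: complex_eq_iff)
    moreover have "Re z * inner (v z) (v w) = Re w * inner (v z) (v w)"
      using sym[of "v z" "v w"] v that real by (simp add: scale)
    ultimately show ?thesis by simp
  qed
  have "inj_on v (eigenvalues P)"
  proof (rule inj_onI)
    fix z w assume "z \<in> eigenvalues P" "w \<in> eigenvalues P" "v z = v w"
    then show "z = w" using orth[of z w] v[of z] by auto
  qed
  moreover have "pairwise orthogonal (v ` eigenvalues P)"
    using orth by (auto simp: pairwise_def orthogonal_def)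
  then have "independent (v ` eigenvalues P)"
    using v by (intro pairwise_orthogonal_independent) auto
  then have "finite (v ` eigenvalues P)" by (rule independent_imp_finite)
  ultimately show "finite (eigenvalues P)" by (simp add: finite_image_iff)
qed

text \<open>The Rayleigh minimum of the complexified matrix is an eigenvalue and lies below all
  others, so it is \<open>lambda_min P\<close>. The upper bound comes from the same argument for the
  negated matrix.\<close>

lemma hermitian_form_bounds:
  fixes P :: "'k::real_or_complex^'n^'n"
  assumes "hermitian_pos_def P"
  shows lambda_min_pos: "lambda_min P > 0"
    and lambda_min_le: "lambda_min P * (norm x)\<^sup>2 \<le> inner (P *v x) x"
    and lambda_max_ge: "inner (P *v x) x \<le> lambda_max P * (norm x)\<^sup>2"
    and lambda_max_pos: "lambda_max P > 0"
proof -
  let ?P = "map_matrix to_complex P"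
  have adj: "adjointK P = P" using assms by (simp add: hermitian_pos_def_def)
  have fin: "finite (Re ` eigenvalues P)" using finite_eigenvalues_hermitian(1)[OF adj] by simp
  have sym: "inner (?P *v x) y = inner x (?P *v y)" for x y
    using inner_adjointK[of ?P] adj by (simp add: adjointK_map_to_complex)
  have lin: "linear (\<lambda>x. ?P *v x)" by (simp add: bounded_linear.linear)
  have eigI: "\<mu> \<in> Re ` eigenvalues P" if "norm v = 1" "?P *v v = \<mu> *\<^sub>R v" for v \<mu>
  proof -
    have "?P *v v = of_real \<mu> *s v" using that(2) by (simp add: vec_eq_iff complex_eq_iff)
    moreover have "v \<noteq> 0" using that(1) by auto
    ultimately have "complex_of_real \<mu> \<in> eigenvalues P" by (auto simp: eigenvalues_def)
    then show ?thesis by (rule rev_image_eqI) simp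
  qed
  have transfer: "inner (P *v x) x = inner (?P *v (\<chi> i. to_complex (x $ i))) (\<chi> i. to_complex (x $ i))"
      "norm x = norm (\<chi> i. to_complex (x $ i))" for x
    by (simp_all add: map_to_complex_mult_vec inner_map_to_complex_vec norm_eq_sqrt_inner)
  obtain v \<mu> where v: "norm v = 1" "?P *v v = \<mu> *\<^sub>R v" "\<And>x. \<mu> * (norm x)\<^sup>2 \<le> inner (?P *v x) x"
    using selfadjoint_min_eigenvector[OF lin sym] by blast
  have min_le: "lambda_min P \<le> \<mu>" unfolding lambda_min_def using fin eigI[OF v(1,2)] by simp
  have ge_min: "\<mu> \<le> Re z" if z: "z \<in> eigenvalues P" for z
  proof -
    obtain w where w: "w \<noteq> 0" "?P *v w = z *s w" using z by (auto simp: eigenvalues_def)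
    have "inner (?P *v w) w = Re z * (norm w)\<^sup>2"
      using w(2) finite_eigenvalues_hermitian(2)[OF adj z]
      unfolding inner_vec_def norm_vec_power2 sum_distrib_left cmod_power2
      by (intro sum.cong) (simp_all add: inner_complex_def power2_eq_square algebra_simps)
    then show ?thesis using v(3)[of w] w(1) by simp
  qed
  \<comment> \<open>Positivity is assumed for vectors over the field only, while the eigenvector
    \<open>v\<close> is complex: its form splits into those of the components \<open>a\<close> and
    \<open>b\<close>.\<close>
  have "\<mu> > 0"
  proof -
    obtain a b :: "'k^'n" where ab: "v = (\<chi> i. to_complex (a $ i)) + \<i> *s (\<chi> i. to_complex (b $ i))"
      and b: "b = 0 \<or> range (to_complex :: 'k \<Rightarrow> complex) = \<real>"
      using vec_complex_decompose by blast
    let ?a = "\<chi> i. to_complex (a $ i)" and ?b = "\<chi> i. to_complex (b $ i)"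
    have pos: "inner (P *v x) x \<ge> 0" "x \<noteq> 0 \<Longrightarrow> inner (P *v x) x > 0" for x
      using assms by (cases "x = 0"; force simp: hermitian_pos_def_def quadratic_form_eq_inner)+
    have cross: "inner (\<chi> i. to_complex (x $ i)) (\<i> *s (\<chi> i. to_complex (b $ i))) = 0" for x :: "'k^'n"
      using b
    proof
      assume "range (to_complex :: 'k \<Rightarrow> complex) = \<real>"
      then have "to_complex c \<in> \<real>" for c :: 'k by blast
      then have "Im (to_complex c) = 0" for c :: 'k by (simp add: complex_is_Real_iff)
      then show ?thesis by (simp add: inner_vec_def inner_complex_def)
    qed (simp add: inner_vec_def)
    have cross2: "inner (?P *v (\<i> *s ?b)) ?a = 0"
      unfolding sym using cross[of "P *v a"] by (simp add: map_to_complex_mult_vec inner_commute)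
    have rot: "inner (\<i> *s x) (\<i> *s y) = inner x y" for x y :: "complex^'n"
      by (simp add: inner_vec_def inner_complex_def add.commute)
    have "\<mu> = inner (?P *v v) v" using v(1,2) by (simp add: dot_square_norm)
    also have "\<dots> = inner (?P *v ?a) ?a + inner (?P *v (\<i> *s ?b)) (\<i> *s ?b)"
      unfolding ab using cross[of "P *v a"] cross2
      by (simp add: matrix_vector_right_distrib inner_add_left inner_add_right map_to_complex_mult_vec)
    also have "inner (?P *v (\<i> *s ?b)) (\<i> *s ?b) = inner (?P *v ?b) ?b"
      unfolding vector_scalar_commute by (rule rot)
    also have "inner (?P *v ?a) ?a = inner (P *v a) a" by (simp add: transfer)
    also have "inner (?P *v ?b) ?b = inner (P *v b) b" by (simp add: transfer)
    finally have \<mu>: "\<mu> = inner (P *v a) a + inner (P *v b) b" .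
    have "a \<noteq> 0 \<or> b \<noteq> 0"
    proof (rule ccontr)
      assume "\<not> (a \<noteq> 0 \<or> b \<noteq> 0)"
      then have "v = 0" unfolding ab by (simp add: vec_eq_iff)
      then show False using v(1) by simp
    qed
    then show ?thesis using pos[of a] pos[of b] \<mu> by linarith
  qed
  have ne: "Re ` eigenvalues P \<noteq> {}" using eigI[OF v(1,2)] by blast
  have "lambda_min P \<in> Re ` eigenvalues P" unfolding lambda_min_def using fin ne by (rule Min_in)
  then have min: "lambda_min P = \<mu>" using ge_min min_le by force
  then show "lambda_min P > 0" using \<open>\<mu> > 0\<close> by simp
  show "lambda_min P * (norm x)\<^sup>2 \<le> inner (P *v x) x"
    unfolding min transfer by (rule v(3))
  have "linear (\<lambda>x. - (?P *v x))" "\<And>x y. inner (- (?P *v x)) y = inner x (- (?P *v y))"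
    using linear_compose_neg[OF lin] by (simp_all add: sym)
  then obtain w \<nu> where w: "norm w = 1" "- (?P *v w) = \<nu> *\<^sub>R w"
    "\<And>x. \<nu> * (norm x)\<^sup>2 \<le> inner (- (?P *v x)) x"
    using selfadjoint_min_eigenvector by blast
  have "- \<nu> \<in> Re ` eigenvalues P" using w(1,2) by (intro eigI[of w]) (auto simp: minus_equation_iff)
  then have max: "- \<nu> \<le> lambda_max P" unfolding lambda_max_def using fin by simp
  have "inner (?P *v y) y \<le> lambda_max P * (norm y)\<^sup>2" for y
  proof -
    have "inner (?P *v y) y \<le> - \<nu> * (norm y)\<^sup>2" using w(3)[of y] by simp
    also have "\<dots> \<le> lambda_max P * (norm y)\<^sup>2" using max by (intro mult_right_mono) auto
    finally show ?thesis .
  qed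
  then show "inner (P *v x) x \<le> lambda_max P * (norm x)\<^sup>2" unfolding transfer by blast
  have "\<mu> \<le> lambda_max P" unfolding lambda_max_def using fin eigI[OF v(1,2)] by simp
  then show "lambda_max P > 0" using \<open>\<mu> > 0\<close> by simp
qed

section \<open>The exponential of a diagonal matrix\<close>

lemma mpow_diag:
  fixes d :: "'p::finite \<Rightarrow> 'k::real_or_complex"
  shows "mpow (\<chi> i j. if i = j then d i else 0) n = (\<chi> i j. if i = j then d i ^ n else 0)"
proof (induction n)
  case 0
  then show ?case by (simp add: mat_def cong: if_cong)
next
  case (Suc n)
  have "(\<Sum>k\<in>UNIV. (if i = k then d i else 0) * (if k = j then d k ^ n else 0))
        = (\<Sum>k\<in>UNIV. if k = i then (if i = j then d i ^ Suc n else 0) else 0)" for i j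
    by (intro sum.cong) auto
  then show ?case
    by (simp add: Suc matrix_matrix_mult_def vec_eq_iff)
qed

text \<open>Powers of a diagonal matrix act entrywise, so the series is summed entry by entry. As
  \<open>A\<^sub>N\<close> is diagonal, every matrix exponential below reduces to scalar
  ones.\<close>

lemma mexp_diag:
  fixes d :: "'p::finite \<Rightarrow> 'k::real_or_complex"
  shows "mexp (\<chi> i j. if i = j then d i else 0) = (\<chi> i j. if i = j then exp (d i) else 0)"
proof -
  have "(\<lambda>j. (1 / fact j) *\<^sub>R mpow (\<chi> i j. if i = j then d i else 0) j)
          sums (\<chi> i j. if i = j then exp (d i) else 0)"
    unfolding sums_def
  proof (intro vec_tendstoI)
    fix i k
    have "(\<lambda>n. \<Sum>j<n. if i = k then d i ^ j /\<^sub>R fact j else 0) \<longlonglongrightarrow> (if i = k then exp (d i) else 0)"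
      using exp_converges[of "d i"] by (cases "i = k") (simp_all add: sums_def)
    then show "(\<lambda>n. (\<Sum>j<n. (1 / fact j) *\<^sub>R mpow (\<chi> i j. if i = j then d i else 0) j) $ i $ k)
          \<longlonglongrightarrow> (\<chi> i j. if i = j then exp (d i) else 0) $ i $ k"
      unfolding mpow_diag by (cases "i = k") (simp_all add: inverse_eq_divide)
  qed
  then show ?thesis
    unfolding mexp_def by (rule sums_unique[symmetric])
qed

lemma mexp_modes_matrix:
  "mexp (r *\<^sub>R modes_matrix \<iota> lam) = (\<chi> i j. if i = j then exp (r *\<^sub>R lam (\<iota> i)) else 0)"
proof -
  have "r *\<^sub>R modes_matrix \<iota> lam = (\<chi> i j. if i = j then r *\<^sub>R lam (\<iota> i) else 0)"
    by (simp add: modes_matrix_def vec_eq_iff)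
  then show ?thesis by (simp add: mexp_diag)
qed

lemma diag_mult_vec:
  "((\<chi> i j. if i = j then d i else 0) *v y) $ i = d i * (y $ i :: 'k::real_or_complex)"
proof -
  have "(\<Sum>j\<in>UNIV. (if i = j then d i else 0) * y $ j) = (\<Sum>j\<in>UNIV. if j = i then d i * y $ i else 0)"
    by (intro sum.cong) auto
  then show ?thesis by (simp add: matrix_vector_mult_def)
qed

lemma modes_matrix_mult_vec: "(modes_matrix \<iota> lam *v y) $ i = lam (\<iota> i) * y $ i"
  by (simp add: modes_matrix_def diag_mult_vec)

lemma mexp_modes_matrix_mult_vec:
  "(mexp (r *\<^sub>R modes_matrix \<iota> lam) *v y) $ i = exp (r *\<^sub>R lam (\<iota> i)) * y $ i"
  by (simp add: mexp_modes_matrix diag_mult_vec)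

lemma norm_axis: "norm (axis i x :: 'a::real_normed_vector^'n) = norm x"
proof -
  have "(\<Sum>j\<in>UNIV. (norm (axis i x $ j :: 'a))\<^sup>2) = (\<Sum>j\<in>UNIV. if j = i then (norm x)\<^sup>2 else 0)"
    by (intro sum.cong) (auto simp: axis_def)
  then show ?thesis by (simp add: norm_vec_def L2_set_def)
qed

lemma norm_mode_le_mnorm: "norm (lam (\<iota> i)) \<le> mnorm (modes_matrix \<iota> lam)"
proof -
  have "norm (lam (\<iota> i)) = norm ((modes_matrix \<iota> lam *v axis i 1) $ i)"
    by (simp add: modes_matrix_mult_vec)
  also have "\<dots> \<le> norm (modes_matrix \<iota> lam *v axis i 1)" by (rule Finite_Cartesian_Product.norm_nth_le)
  also have "\<dots> \<le> mnorm (modes_matrix \<iota> lam) * norm (axis i (1::'a))" by (rule norm_matrix_vector_mult_le)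
  finally show ?thesis by (simp add: norm_axis)
qed

text \<open>Diagonality allows a comparison coordinate by coordinate, each eigenvalue being bounded
  by \<open>mnorm\<close>; the exponential factor of \<open>C\<^sub>1\<close> arises in this
  way.\<close>

lemma norm_mexp_modes_matrix_mult_vec_le:
  "norm (mexp (r *\<^sub>R modes_matrix \<iota> lam) *v y) \<le> exp (\<bar>r\<bar> * mnorm (modes_matrix \<iota> lam)) * norm y"
proof -
  have "norm (exp (r *\<^sub>R lam (\<iota> i)) * y $ i) \<le> exp (\<bar>r\<bar> * mnorm (modes_matrix \<iota> lam)) * norm (y $ i)" for i
  proof -
    have "norm (exp (r *\<^sub>R lam (\<iota> i))) \<le> exp (norm (r *\<^sub>R lam (\<iota> i)))" by (rule norm_exp)
    also have "\<dots> \<le> exp (\<bar>r\<bar> * mnorm (modes_matrix \<iota> lam))"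
      by (simp add: mult_left_mono norm_mode_le_mnorm)
    finally show ?thesis by (simp add: norm_mult mult_right_mono)
  qed
  then have "norm (mexp (r *\<^sub>R modes_matrix \<iota> lam) *v y)
      \<le> norm (exp (\<bar>r\<bar> * mnorm (modes_matrix \<iota> lam)) *\<^sub>R y)"
    by (intro norm_le_componentwise_cart) (simp add: mexp_modes_matrix_mult_vec)
  then show ?thesis by simp
qed

section \<open>Coordinate bounds for matrix rows and for operators on the input space\<close>

lemma norm_row_mult_le: "norm ((M *v y) $ i) \<le> norm (M $ i) * norm (y :: 'k::real_or_complex^'n)"
proof -
  have "norm ((M *v y) $ i) \<le> (\<Sum>j\<in>UNIV. norm (M $ i $ j) * norm (y $ j))"
    unfolding matrix_vector_mult_def by (simp add: sum_norm_le norm_mult)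
  also have "\<dots> \<le> norm (M $ i) * norm y"
    using L2_set_mult_ineq[of "\<lambda>j. norm (M $ i $ j)" "\<lambda>j. norm (y $ j)" UNIV]
    by (simp add: norm_vec_def)
  finally show ?thesis .
qed

lemma sum_power2_le_card:
  fixes g :: "'i \<Rightarrow> real"
  shows "(\<Sum>i\<in>I. g i)\<^sup>2 \<le> real (card I) * (\<Sum>i\<in>I. (g i)\<^sup>2)"
  using Cauchy_Schwarz_ineq_sum[of "\<lambda>_. 1" g I] by simp

lemma bounded_operator_vec_expand:
  fixes T :: "'k::real_or_complex^'m \<Rightarrow> 'h::banach"
  assumes "bounded_operator (*s) sc T"
  shows "T w = (\<Sum>i\<in>UNIV. sc (w $ i) (T (axis i 1)))"
proof -
  interpret bounded_linear T using assms by (simp add: bounded_operator_def)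
  have "T w = T (\<Sum>i\<in>UNIV. w $ i *s axis i 1)" by (simp add: basis_expansion)
  also have "\<dots> = (\<Sum>i\<in>UNIV. T (w $ i *s axis i 1))" by (rule sum)
  finally show ?thesis using assms by (simp add: bounded_operator_def)
qed

section \<open>Hilbert spaces\<close>

context separable_hilbert_space
begin

lemma ip_scaleR_left: "ip (r *\<^sub>R x) y = r *\<^sub>R ip x y"
  using ip_scale_left[of "of_real r" x y] by (simp add: scale_of_real scaleR_conv_of_real)

lemma ip_add_right: "ip x (y + z) = ip x y + ip x z"
  by (metis ip_commute ip_add_left conjK_add)

lemma ip_scale_right: "ip x (sc c y) = conjK c * ip x y"
  by (metis ip_commute ip_scale_left conjK_mult)

lemma ip_minus_left: "ip (- x) y = - ip x y"
  using ip_scaleR_left[of "-1" x y] by simp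

lemma ip_diff_left: "ip (x - y) z = ip x z - ip y z"
  using ip_add_left[of x "- y" z] by (simp add: ip_minus_left)

lemma ip_minus_right: "ip x (- y) = - ip x y"
  using ip_add_right[of x y "- y"] ip_add_right[of x 0 0] by (simp add: eq_neg_iff_add_eq_0 add.commute)

lemma ip_diff_right: "ip x (y - z) = ip x y - ip x z"
  using ip_add_right[of x y "- z"] by (simp add: ip_minus_right)

lemma norm_ip_le: "norm (ip x y) \<le> norm x * norm y"
proof (cases "y = 0")
  case True
  then show ?thesis using ip_add_right[of x 0 0] by simp
next
  case False
  define a where "a = (norm x)\<^sup>2"
  define b where "b = (norm y)\<^sup>2"
  define c where "c = ip x y"
  \<comment> \<open>A multiple of the residual of projecting \<open>x\<close> on \<open>y\<close>,
    scaled by \<open>b\<close> to avoid division; nonnegativity of its squared norm is the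
    inequality.\<close>
  define z where "z = sc (of_real b) x - sc c y"
  have conj_real: "conjK (of_real b) = (of_real b :: 'k)"
    by (rule to_complex_inject[THEN iffD1]) (simp add: to_complex_conjK)
  have yx: "ip y x = conjK c" unfolding c_def by (rule ip_commute)
  have cc: "c * conjK c = of_real ((norm c)\<^sup>2)" by (rule mult_conjK)
  have "(of_real ((norm z)\<^sup>2) :: 'k) = ip z z" by (rule ip_self[symmetric])
  also have "\<dots> = of_real b * (of_real b * of_real a - c * conjK c)"
    unfolding z_def ip_diff_left ip_diff_right ip_scale_left ip_scale_right
    unfolding ip_self conj_real yx
      a_def[symmetric] b_def[symmetric] c_def[symmetric]
    by (simp add: algebra_simps)
  also have "\<dots> = of_real (b * (b * a - (norm c)\<^sup>2))" unfolding cc by simp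
  finally have "(norm z)\<^sup>2 = b * (b * a - (norm c)\<^sup>2)" by (simp only: of_real_eq_iff)
  moreover have "b > 0" using False by (simp add: b_def)
  ultimately have "(norm c)\<^sup>2 \<le> b * a"
    by (metis diff_ge_0_iff_ge zero_le_mult_iff zero_le_power2 less_le_not_le)
  then have "(norm c)\<^sup>2 \<le> (norm x * norm y)\<^sup>2"
    by (simp add: a_def b_def power_mult_distrib mult.commute)
  then show ?thesis unfolding c_def by (rule power2_le_imp_le) simp
qed

lemma bounded_linear_ip: "bounded_linear (\<lambda>x. ip x y)"
  by (rule bounded_linear_intro[of _ "norm y"])
    (simp_all add: ip_add_left ip_scaleR_left norm_ip_le)

lemma ip_sum_left: "ip (\<Sum>i\<in>I. g i) y = (\<Sum>i\<in>I. ip (g i) y)"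
  by (rule linear_sum[OF bounded_linear.linear[OF bounded_linear_ip]])

lemma ip_zero_left [simp]: "ip 0 y = 0"
  using ip_add_left[of 0 0 y] by simp

lemma continuous_on_ip [continuous_intros]:
  "continuous_on S g \<Longrightarrow> continuous_on S (\<lambda>t. ip (g t) y)"
  by (rule bounded_linear.continuous_on[OF bounded_linear_ip])

lemma norm_scale: "norm (sc c x) = norm c * norm x"
proof -
  have "(of_real ((norm (sc c x))\<^sup>2) :: 'k) = c * conjK c * of_real ((norm x)\<^sup>2)"
    unfolding ip_self[symmetric] ip_scale_left ip_scale_right by (simp add: mult.assoc)
  also have "\<dots> = of_real ((norm c * norm x)\<^sup>2)"
    unfolding mult_conjK by (simp add: power_mult_distrib)
  finally have "(norm (sc c x))\<^sup>2 = (norm c * norm x)\<^sup>2" by (simp only: of_real_eq_iff)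
  then show ?thesis by (simp add: power2_eq_iff_nonneg)
qed

text \<open>Expansion over the input coordinates, then Cauchy-Schwarz for a sum of
  \<open>CARD('m')\<close> terms; this is the origin of the factor m in
  \<open>C\<^sub>5\<close>.\<close>

lemma norm_bounded_operator_power2_le:
  fixes T :: "'k^'m \<Rightarrow> 'h"
  assumes T: "bounded_operator (*s) sc T" and w: "\<And>i. norm (w $ i) \<le> c i * r"
  shows "(norm (T w))\<^sup>2 \<le> real CARD('m) * (\<Sum>i\<in>UNIV. (norm (T (axis i 1)))\<^sup>2 * (c i)\<^sup>2) * r\<^sup>2"
proof -
  have "norm (T w) \<le> (\<Sum>i\<in>UNIV. norm (w $ i) * norm (T (axis i 1)))"
    by (subst bounded_operator_vec_expand[OF T]) (simp add: sum_norm_le norm_scale)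
  also have "\<dots> \<le> (\<Sum>i\<in>UNIV. c i * r * norm (T (axis i 1)))"
    by (intro sum_mono mult_right_mono w) auto
  finally have "(norm (T w))\<^sup>2 \<le> (\<Sum>i\<in>UNIV. c i * r * norm (T (axis i 1)))\<^sup>2"
    by (intro power_mono) auto
  also have "\<dots> \<le> real CARD('m) * (\<Sum>i\<in>UNIV. (c i * r * norm (T (axis i 1)))\<^sup>2)"
    by (rule sum_power2_le_card)
  also have "\<dots> = real CARD('m) * (\<Sum>i\<in>UNIV. (norm (T (axis i 1)))\<^sup>2 * (c i)\<^sup>2) * r\<^sup>2"
    by (simp add: sum_distrib_left sum_distrib_right power_mult_distrib mult_ac)
  finally show ?thesis .
qed

text \<open>A member of the span has only finitely many nonzero coefficients. The form with an
  eventual index makes the property stable under addition, where the two vectors may need different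
  lengths.\<close>

lemma span_biorthogonal_expansion:
  assumes "x \<in> span (\<phi> ` {1..})" and bi: "biorthogonal ip \<phi> \<psi>"
  shows "\<forall>\<^sub>F M in sequentially. x = (\<Sum>n=1..M. sc (ip x (\<psi> n)) (\<phi> n))"
  using assms(1)
proof (induction rule: span_induct)
  case base
  show ?case
    unfolding subspace_def
  proof (intro conjI allI ballI CollectI)
    show "\<forall>\<^sub>F M in sequentially. 0 = (\<Sum>n=1..M. sc (ip 0 (\<psi> n)) (\<phi> n))" by simp
  next
    fix x y
    assume x: "x \<in> {a. \<forall>\<^sub>F M in sequentially. a = (\<Sum>n=1..M. sc (ip a (\<psi> n)) (\<phi> n))}"
      and y: "y \<in> {a. \<forall>\<^sub>F M in sequentially. a = (\<Sum>n=1..M. sc (ip a (\<psi> n)) (\<phi> n))}"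
    show "\<forall>\<^sub>F M in sequentially. x + y = (\<Sum>n=1..M. sc (ip (x + y) (\<psi> n)) (\<phi> n))"
      using x[unfolded mem_Collect_eq] y[unfolded mem_Collect_eq]
    proof eventually_elim
      case (elim M)
      show ?case
        unfolding ip_add_left scale_left_distrib sum.distrib
        using elim by simp
    qed
  next
    fix c x
    assume x: "x \<in> {a. \<forall>\<^sub>F M in sequentially. a = (\<Sum>n=1..M. sc (ip a (\<psi> n)) (\<phi> n))}"
    show "\<forall>\<^sub>F M in sequentially. sc c x = (\<Sum>n=1..M. sc (ip (sc c x) (\<psi> n)) (\<phi> n))"
      using x[unfolded mem_Collect_eq]
    proof eventually_elim
      case (elim M)
      show ?case
        unfolding ip_scale_left scale_scale[symmetric] scale_sum_right[symmetric]
        using elim by simp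
    qed
  qed
next
  case (step x)
  then obtain k where k: "k \<ge> 1" "x = \<phi> k" by auto
  have "x = (\<Sum>n=1..M. sc (ip x (\<psi> n)) (\<phi> n))" if "M \<ge> k" for M
  proof -
    have "(\<Sum>n=1..M. sc (ip x (\<psi> n)) (\<phi> n)) = (\<Sum>n=1..M. if n = k then \<phi> k else 0)"
      using bi k by (intro sum.cong) (auto simp: biorthogonal_def)
    then show ?thesis using that k by simp
  qed
  then show ?case by (auto simp: eventually_sequentially)
qed

text \<open>On the span this is the lower Riesz bound for an exact expansion. For fixed
  \<open>N\<close> the inequality is a closed condition, so it passes to the closure, which is the
  whole space.\<close>

lemma riesz_bessel:
  assumes rb: "riesz_basis sc \<phi> m\<^sub>R M\<^sub>R" and bi: "biorthogonal ip \<phi> \<psi>"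
  shows "(\<Sum>n=1..N. (norm (ip x (\<psi> n)))\<^sup>2) \<le> (norm x)\<^sup>2 / m\<^sub>R"
proof -
  have mR: "m\<^sub>R > 0" using rb by (simp add: riesz_basis_def)
  let ?S = "{x. (\<Sum>n=1..N. (norm (ip x (\<psi> n)))\<^sup>2) \<le> (norm x)\<^sup>2 / m\<^sub>R}"
  have "span (\<phi> ` {1..}) \<subseteq> ?S"
  proof
    fix x assume "x \<in> span (\<phi> ` {1..})"
    then have "\<forall>\<^sub>F M in sequentially. x = (\<Sum>n=1..M. sc (ip x (\<psi> n)) (\<phi> n)) \<and> M \<ge> N + 1"
      using span_biorthogonal_expansion[OF _ bi] eventually_ge_at_top by (intro eventually_conj) auto
    then obtain M where M: "x = (\<Sum>n=1..M. sc (ip x (\<psi> n)) (\<phi> n))" "M \<ge> N + 1"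
      using eventually_happens by fastforce
    have "m\<^sub>R * (\<Sum>n=1..N. (norm (ip x (\<psi> n)))\<^sup>2) \<le> m\<^sub>R * (\<Sum>n=1..M. (norm (ip x (\<psi> n)))\<^sup>2)"
      using mR M by (intro mult_left_mono sum_mono2) auto
    also have "\<dots> \<le> (norm (\<Sum>n=1..M. sc (ip x (\<psi> n)) (\<phi> n)))\<^sup>2"
      using rb M(2) by (simp add: riesz_basis_def)
    also have "\<dots> = (norm x)\<^sup>2" using M(1) by simp
    finally show "x \<in> ?S" using mR by (simp add: field_simps)
  qed
  moreover have "closed ?S"
    using mR by (intro closed_Collect_le continuous_intros) auto
  ultimately have "closure (span (\<phi> ` {1..})) \<subseteq> ?S" by (rule closure_minimal)
  then show ?thesis using rb by (auto simp: riesz_basis_def)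
qed

text \<open>Instead of summing a series, \<open>x\<close> is approximated by \<open>y\<close> in the
  span: the upper Riesz bound applies to \<open>y\<close>, and the coefficients of
  \<open>y - x\<close> are small by \<open>riesz_bessel\<close>. The error \<open>e\<close> then
  tends to 0.\<close>

lemma riesz_upper_bound:
  assumes rb: "riesz_basis sc \<phi> m\<^sub>R M\<^sub>R" and bi: "biorthogonal ip \<phi> \<psi>"
    and C: "\<And>N. (\<Sum>n=1..N. (norm (ip x (\<psi> n)))\<^sup>2) \<le> C"
  shows "(norm x)\<^sup>2 \<le> M\<^sub>R * C"
proof -
  have mR: "m\<^sub>R > 0" "M\<^sub>R > 0" using rb by (simp_all add: riesz_basis_def)
  have "C \<ge> 0" using C[of 0] by simp
  have approx: "norm x \<le> e + sqrt M\<^sub>R * (sqrt C + e / sqrt m\<^sub>R)" if "e > 0" for e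
  proof -
    have "x \<in> closure (span (\<phi> ` {1..}))" using rb by (simp add: riesz_basis_def)
    then obtain y where y: "y \<in> span (\<phi> ` {1..})" "norm (y - x) < e"
      using \<open>e > 0\<close> by (metis closure_approachable dist_norm)
    have "\<forall>\<^sub>F M in sequentially. y = (\<Sum>n=1..M. sc (ip y (\<psi> n)) (\<phi> n)) \<and> M \<ge> 1"
      using span_biorthogonal_expansion[OF y(1) bi] eventually_ge_at_top by (intro eventually_conj) auto
    then obtain M where M: "y = (\<Sum>n=1..M. sc (ip y (\<psi> n)) (\<phi> n))" "M \<ge> 1"
      using eventually_happens by fastforce
    let ?l = "\<lambda>z. L2_set (\<lambda>n. norm (ip z (\<psi> n))) {1..M}"
    have "(norm (\<Sum>n=1..M. sc (ip y (\<psi> n)) (\<phi> n)))\<^sup>2 \<le> M\<^sub>R * (\<Sum>n=1..M. (norm (ip y (\<psi> n)))\<^sup>2)"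
      using rb M(2) by (simp add: riesz_basis_def)
    then have "(norm y)\<^sup>2 \<le> M\<^sub>R * (\<Sum>n=1..M. (norm (ip y (\<psi> n)))\<^sup>2)"
      by (simp only: M(1)[symmetric])
    then have "norm y \<le> sqrt M\<^sub>R * ?l y"
      unfolding L2_set_def real_sqrt_mult[symmetric] by (rule real_le_rsqrt)
    also have "?l y \<le> L2_set (\<lambda>n. norm (ip x (\<psi> n)) + norm (ip (y - x) (\<psi> n))) {1..M}"
      by (intro L2_set_mono) (use norm_triangle_sub in \<open>auto simp: ip_diff_left\<close>)
    also have "\<dots> \<le> ?l x + ?l (y - x)" by (rule L2_set_triangle_ineq)
    also have "?l x \<le> sqrt C" unfolding L2_set_def using C[of M] by (rule real_sqrt_le_mono)
    also have "?l (y - x) \<le> sqrt ((norm (y - x))\<^sup>2 / m\<^sub>R)"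
      unfolding L2_set_def using riesz_bessel[OF rb bi] by (rule real_sqrt_le_mono)
    also have "\<dots> \<le> e / sqrt m\<^sub>R"
      using y(2) mR by (simp add: real_sqrt_divide divide_right_mono)
    finally have "norm y \<le> sqrt M\<^sub>R * (sqrt C + e / sqrt m\<^sub>R)" using mR by simp
    moreover have "norm x \<le> norm (y - x) + norm y" by (metis norm_minus_commute norm_triangle_sub add.commute)
    ultimately show ?thesis using y(2) by linarith
  qed
  have "((\<lambda>e. e + sqrt M\<^sub>R * (sqrt C + e / sqrt m\<^sub>R)) \<longlongrightarrow> 0 + sqrt M\<^sub>R * (sqrt C + 0 / sqrt m\<^sub>R)) (at_right 0)"
    using mR by (intro tendsto_intros) auto
  then have "norm x \<le> 0 + sqrt M\<^sub>R * (sqrt C + 0 / sqrt m\<^sub>R)"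
    by (rule tendsto_lowerbound) (auto simp: eventually_at_right_less approx intro!: eventually_at_rightI[of 0 1])
  then have "(norm x)\<^sup>2 \<le> (sqrt M\<^sub>R * sqrt C)\<^sup>2" by (intro power_mono) auto
  then show ?thesis using mR \<open>C \<ge> 0\<close> by (simp add: power_mult_distrib)
qed

end

section \<open>Eigenvectors of the adjoint\<close>

context separable_hilbert_space
begin

text \<open>\<open>S t\<close> commutes with the generator and hence preserves the eigenspace, which
  simplicity makes a line. The scalar is not identified as an exponential; its existence is enough
  for what follows.\<close>

lemma semigroup_eigenvector_line:
  assumes S: "C0_semigroup sc S" and gen: "generates_semigroup Dm A S"
    and simple: "simple_eigenvalue sc Dm A \<mu>" and y: "y \<in> Dm" "y \<noteq> 0" "A y = sc \<mu> y" and "t \<ge> 0"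
  shows "\<exists>c. S t y = sc c y"
proof -
  have bo: "bounded_operator sc sc (S t)" using S \<open>t \<ge> 0\<close> by (simp add: C0_semigroup_def)
  then interpret T: bounded_linear "S t" by (simp add: bounded_operator_def)
  have "((\<lambda>h. (1 / h) *\<^sub>R (S h y - y)) \<longlongrightarrow> sc \<mu> y) (at_right 0)"
    using gen y unfolding generates_semigroup_def by blast
  then have "((\<lambda>h. S t ((1 / h) *\<^sub>R (S h y - y))) \<longlongrightarrow> S t (sc \<mu> y)) (at_right 0)"
    by (rule T.tendsto)
  moreover have "\<forall>\<^sub>F h in at_right 0. S t ((1 / h) *\<^sub>R (S h y - y)) = (1 / h) *\<^sub>R (S h (S t y) - S t y)"
    using eventually_at_right_less
  proof eventually_elim
    case (elim h)
    then have "S h (S t y) = S t (S h y)"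
      using S \<open>t \<ge> 0\<close> unfolding C0_semigroup_def by (metis add.commute less_imp_le)
    then show ?case by (simp add: T.scaleR T.diff)
  qed
  ultimately have "((\<lambda>h. (1 / h) *\<^sub>R (S h (S t y) - S t y)) \<longlongrightarrow> S t (sc \<mu> y)) (at_right 0)"
    by (rule Lim_transform_eventually)
  then have St: "S t y \<in> Dm" "A (S t y) = S t (sc \<mu> y)"
    using gen unfolding generates_semigroup_def by blast+
  have "A (S t y) = sc \<mu> (S t y)" using St(2) bo by (simp add: bounded_operator_def)
  then have "S t y \<in> root_space sc Dm A \<mu> 1" "y \<in> root_space sc Dm A \<mu> 1"
    using St(1) y by simp_all
  moreover obtain v where "(\<Union>j. root_space sc Dm A \<mu> j) = span {v}"
    using simple unfolding simple_eigenvalue_def by blast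
  ultimately have "S t y \<in> span {v}" "y \<in> span {v}" by blast+
  then obtain a b where a: "S t y = sc a v" and b: "y = sc b v" by (auto simp: span_singleton)
  have "b \<noteq> 0" using b y(2) by auto
  then have "sc (a / b) y = sc a v" by (simp add: b)
  then have "S t y = sc (a / b) y" using a by simp
  then show ?thesis by blast
qed

text \<open>The unbounded \<open>A\<close> cannot be passed through limits of finite expansions, but
  the bounded \<open>S t\<close> can. So the identity is first proved for the semigroup and then
  differentiated at time 0, without constructing the adjoint.\<close>

lemma riesz_spectral_adjoint_eigenvector:
  assumes S: "C0_semigroup sc S" and gen: "generates_semigroup Dm A S"
    and rs: "riesz_spectral_operator sc Dm A lam \<phi> m\<^sub>R M\<^sub>R" and bi: "biorthogonal ip \<phi> \<psi>"
    and n: "n \<ge> 1" and w: "w \<in> Dm"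
  shows "ip (A w) (\<psi> n) = lam n * ip w (\<psi> n)"
proof -
  have eig: "\<phi> k \<in> Dm" "\<phi> k \<noteq> 0" "A (\<phi> k) = sc (lam k) (\<phi> k)" "simple_eigenvalue sc Dm A (lam k)" if "k \<ge> 1" for k
    using rs that by (simp_all add: riesz_spectral_operator_def)
  have bi': "ip (\<phi> k) (\<psi> n) = (if k = n then 1 else 0)" if "k \<ge> 1" for k
    using bi n that by (simp add: biorthogonal_def)
  have "\<forall>t. \<exists>c. t \<ge> 0 \<longrightarrow> S t (\<phi> n) = sc c (\<phi> n)"
    using semigroup_eigenvector_line[OF S gen eig(4,1,2,3)] n by blast
  then obtain c where c: "\<And>t. t \<ge> 0 \<Longrightarrow> S t (\<phi> n) = sc (c t) (\<phi> n)" by metis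
  \<comment> \<open>\<open>S t\<close> scales each \<open>\<phi> k\<close>, so on these vectors both
    sides vanish for \<open>k \<noteq> n\<close>, and for \<open>k = n\<close> the factor is
    \<open>c t\<close>. Linearity and continuity extend this to the whole space.\<close>
  have eq: "ip (S t x) (\<psi> n) = c t * ip x (\<psi> n)" if t: "t \<ge> 0" for t x
  proof -
    have bo: "bounded_operator sc sc (S t)" using S t by (simp add: C0_semigroup_def)
    then interpret T: bounded_linear "S t" by (simp add: bounded_operator_def)
    let ?E = "{x. ip (S t x) (\<psi> n) = c t * ip x (\<psi> n)}"
    have "subspace ?E"
      using bo unfolding subspace_def bounded_operator_def
      by (simp add: T.add T.zero ip_add_left ip_scale_left algebra_simps)
    moreover have "\<phi> ` {1..} \<subseteq> ?E"
    proof (rule image_subsetI)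
      fix k :: nat assume k: "k \<in> {1..}"
      obtain d where d: "S t (\<phi> k) = sc d (\<phi> k)"
        using semigroup_eigenvector_line[OF S gen eig(4,1,2,3) t] k by (metis atLeast_iff)
      show "\<phi> k \<in> ?E"
        by (cases "k = n") (use c[OF t] d bi' k in \<open>auto simp: ip_scale_left\<close>)
    qed
    ultimately have "span (\<phi> ` {1..}) \<subseteq> ?E" by (intro span_minimal)
    moreover have "closed ?E"
      by (intro closed_Collect_eq continuous_intros linear_continuous_on T.bounded_linear_axioms)
    ultimately have "closure (span (\<phi> ` {1..})) \<subseteq> ?E" by (rule closure_minimal)
    then show ?thesis using rs by (auto simp: riesz_spectral_operator_def riesz_basis_def)
  qed
  have lim: "((\<lambda>h. ((1 / h) *\<^sub>R (c h - 1)) * ip x (\<psi> n)) \<longlongrightarrow> ip (A x) (\<psi> n)) (at_right 0)"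
    if "x \<in> Dm" for x
  proof -
    have "((\<lambda>h. (1 / h) *\<^sub>R (S h x - x)) \<longlongrightarrow> A x) (at_right 0)"
      using gen that unfolding generates_semigroup_def by blast
    then have "((\<lambda>h. ip ((1 / h) *\<^sub>R (S h x - x)) (\<psi> n)) \<longlongrightarrow> ip (A x) (\<psi> n)) (at_right 0)"
      by (rule bounded_linear.tendsto[OF bounded_linear_ip])
    moreover have "\<forall>\<^sub>F h in at_right 0.
        ip ((1 / h) *\<^sub>R (S h x - x)) (\<psi> n) = ((1 / h) *\<^sub>R (c h - 1)) * ip x (\<psi> n)"
      using eventually_at_right_less
      by eventually_elim (simp add: ip_scaleR_left ip_diff_left eq algebra_simps)
    ultimately show ?thesis by (rule Lim_transform_eventually)
  qed
  \<comment> \<open>The case \<open>x = \<phi> n\<close> of the limit identifies the derivative of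
    \<open>c\<close> at 0.\<close>
  have "((\<lambda>h. (1 / h) *\<^sub>R (c h - 1)) \<longlongrightarrow> lam n) (at_right 0)"
    using lim[OF eig(1)[OF n]] n by (simp add: eig(3) ip_scale_left bi')
  then have "((\<lambda>h. ((1 / h) *\<^sub>R (c h - 1)) * ip w (\<psi> n)) \<longlongrightarrow> lam n * ip w (\<psi> n)) (at_right 0)"
    by (intro tendsto_intros)
  with lim[OF w] show ?thesis by (rule tendsto_unique[OF trivial_limit_at_right_real])
qed

end

section \<open>Real functions\<close>

lemma le_if_deriv_nonpos:
  fixes f :: "real \<Rightarrow> real"
  assumes "a \<le> b" and cont: "continuous_on {a..b} f"
    and deriv: "\<And>x. a < x \<Longrightarrow> x < b \<Longrightarrow> \<exists>y. (f has_real_derivative y) (at x) \<and> y \<le> 0"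
  shows "f b \<le> f a"
proof (cases "a = b")
  case False
  then have "a < b" using assms(1) by simp
  then obtain l z where z: "a < z" "z < b" "(f has_real_derivative l) (at z)" "f b - f a = (b - a) * l"
    using MVT[OF _ cont] deriv by (metis real_differentiable_def)
  then have "l \<le> 0" using deriv DERIV_unique by blast
  then have "(b - a) * l \<le> 0" using \<open>a < b\<close> by (simp add: mult_nonneg_nonpos)
  with z(4) show ?thesis by simp
qed simp

lemma gronwall:
  fixes g :: "real \<Rightarrow> real"
  assumes cont: "continuous_on {0..T} g" and t: "0 \<le> t" "t \<le> T"
    and le: "\<And>s. 0 \<le> s \<Longrightarrow> s \<le> T \<Longrightarrow> g s \<le> a + L * integral {0..s} g" and "L \<ge> 0"
  shows "g t \<le> a * exp (L * t)"
proof -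
  define G where "G s = integral {0..s} g" for s
  have G: "(G has_real_derivative g s) (at s within {0..T})" if "s \<in> {0..T}" for s
    unfolding G_def using integral_has_vector_derivative[OF cont that]
    by (simp add: has_real_derivative_iff_has_vector_derivative)
  have contG: "continuous_on {0..T} G"
    using G by (rule DERIV_continuous_on)
  define f where "f s = exp (- L * s) * (a + L * G s)" for s
  have "f t \<le> f 0"
  proof (rule le_if_deriv_nonpos[where f = f])
    show "continuous_on {0..t} f"
      unfolding f_def using t by (intro continuous_intros continuous_on_subset[OF contG]) auto
    fix s assume s: "0 < s" "s < t"
    have "(G has_real_derivative g s) (at s)"
      using G[of s] s t by (simp add: at_within_Icc_at)
    then have "(f has_real_derivative exp (- L * s) * L * (g s - (a + L * G s))) (at s)"
      unfolding f_def by (auto intro!: derivative_eq_intros simp: algebra_simps)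
    moreover have "exp (- L * s) * L * (g s - (a + L * G s)) \<le> 0"
      using le[of s] s t \<open>L \<ge> 0\<close> by (intro mult_nonneg_nonpos) (auto simp: G_def)
    ultimately show "\<exists>y. (f has_real_derivative y) (at s) \<and> y \<le> 0" by blast
  qed (use t in auto)
  then have "a + L * G t \<le> a * exp (L * t)"
    by (simp add: f_def G_def exp_minus field_simps)
  with le[OF t] show ?thesis by (simp add: G_def)
qed

text \<open>Nonnegativity of the integral of \<open>(g - m)^2\<close>, with \<open>m\<close> the
  mean value.\<close>

lemma integral_power2_le:
  fixes g :: "real \<Rightarrow> real"
  assumes "a < b" and cont: "continuous_on {a..b} g"
  shows "(integral {a..b} g)\<^sup>2 \<le> (b - a) * integral {a..b} (\<lambda>s. (g s)\<^sup>2)"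
proof -
  define I where "I = integral {a..b} g"
  define m where "m = I / (b - a)"
  have int: "g integrable_on {a..b}" "(\<lambda>s. (g s)\<^sup>2) integrable_on {a..b}"
    by (intro integrable_continuous_real continuous_intros cont)+
  have "0 \<le> integral {a..b} (\<lambda>s. (g s - m)\<^sup>2)"
    by (rule integral_nonneg) (auto intro!: integrable_continuous_real continuous_intros cont)
  also have "(\<lambda>s. (g s - m)\<^sup>2) = (\<lambda>s. (g s)\<^sup>2 - 2 * m * g s + m\<^sup>2)"
    by (simp add: power2_diff fun_eq_iff)
  also have "integral {a..b} \<dots> = integral {a..b} (\<lambda>s. (g s)\<^sup>2 - 2 * m * g s) + (b - a) * m\<^sup>2"
    using int \<open>a < b\<close> by (subst integral_add) (auto intro!: integrable_diff integrable_on_mult_right)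
  also have "integral {a..b} (\<lambda>s. (g s)\<^sup>2 - 2 * m * g s) = integral {a..b} (\<lambda>s. (g s)\<^sup>2) - 2 * m * I"
    unfolding I_def using int by (subst integral_diff) (auto intro!: integrable_on_mult_right)
  also have "integral {a..b} (\<lambda>s. (g s)\<^sup>2) - 2 * m * I + (b - a) * m\<^sup>2
      = integral {a..b} (\<lambda>s. (g s)\<^sup>2) - I\<^sup>2 / (b - a)"
  proof -
    have "(b - a) * m = I" using \<open>a < b\<close> by (simp add: m_def)
    then have "(b - a) * m\<^sup>2 = m * I" by (simp add: power2_eq_square mult.commute mult.left_commute)
    moreover have "m * I = I\<^sup>2 / (b - a)" by (simp add: m_def power2_eq_square)
    ultimately show ?thesis by linarith
  qed
  finally show ?thesis using \<open>a < b\<close> by (simp add: I_def field_simps)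
qed

lemma mult_le_weighted_squares:
  fixes a b :: real assumes "c > 0"
  shows "a * b \<le> c * a\<^sup>2 + b\<^sup>2 / (4 * c)"
proof -
  have "0 \<le> (2 * c * a - b)\<^sup>2 / (4 * c)" using assms by simp
  then show ?thesis using assms by (simp add: power2_diff field_simps power2_eq_square)
qed

lemma has_vector_derivative_vec:
  fixes f :: "real \<Rightarrow> 'a::real_normed_vector^'n"
  assumes "\<And>i. ((\<lambda>t. f t $ i) has_vector_derivative f' $ i) (at x within S)"
  shows "(f has_vector_derivative f') (at x within S)"
  unfolding has_vector_derivative_def has_derivative_within
proof (intro conjI vec_tendstoI)
  show "bounded_linear (\<lambda>x. x *\<^sub>R f')" by (rule bounded_linear_scaleR_left)
  show "((\<lambda>y. ((1 / norm (y - x)) *\<^sub>R (f y - (f x + (y - x) *\<^sub>R f'))) $ i) \<longlongrightarrow> 0 $ i) (at x within S)" for i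
    using assms[of i] by (simp add: has_vector_derivative_def has_derivative_within)
qed

lemma has_vector_derivative_at_if_within_atLeast:
  assumes "(f has_vector_derivative f') (at t within {a..})" "t > (a::real)"
  shows "(f has_vector_derivative f') (at t)"
proof -
  have "at t within {a..} = at t"
    by (rule at_within_interior) (use assms(2) in simp)
  with assms(1) show ?thesis by simp
qed

lemma power2_sum_le: "(a + b)\<^sup>2 \<le> 2 * a\<^sup>2 + 2 * b\<^sup>2" for a b :: real
  using sum_squares_bound[of a b] by (simp add: power2_sum)

section \<open>The predictor\<close>

text \<open>Without forcing this is the future state \<open>Y (t + D)\<close> carried back by
  \<open>mexp (- D A)\<close>: the inputs still in the delay line are those of the last
  \<open>D\<close> time units. The lower limit is cut at 0 because earlier inputs vanish.\<close>

definition predictor ::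
  "real \<Rightarrow> 'k::real_or_complex^'p^'p \<Rightarrow> 'k^'m^'p \<Rightarrow> (real \<Rightarrow> 'k^'p) \<Rightarrow> (real \<Rightarrow> 'k^'m) \<Rightarrow> real \<Rightarrow> 'k^'p"
where
  "predictor D A B Y u t =
     Y t + integral {max (t - D) 0..t} (\<lambda>s. mexp ((t - s - D) *\<^sub>R A) *v (B *v u s))"

context
  fixes D :: real and \<iota> :: "'p::finite \<Rightarrow> nat" and lam :: "nat \<Rightarrow> 'k::real_or_complex"
    and A :: "'k^'p^'p" and B :: "'k^'m^'p" and u :: "real \<Rightarrow> 'k^'m"
  assumes D: "D > 0" and A: "A = modes_matrix \<iota> lam"
    and cont_u: "continuous_on {-D..} u" and u_zero: "\<And>t. t \<in> {-D..0} \<Longrightarrow> u t = 0"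
begin

text \<open>Factoring the exponential in \<open>t\<close> out of the convolution leaves an integrand
  free of \<open>t\<close>, so the predictor can be differentiated by the fundamental theorem alone.
  Starting at \<open>- D\<close> keeps the shifted argument \<open>t - D\<close> in range for all
  \<open>t \<ge> 0\<close>.\<close>

definition history :: "'p \<Rightarrow> real \<Rightarrow> 'k" where
  "history i t = integral {-D..t} (\<lambda>s. exp ((- s) *\<^sub>R lam (\<iota> i)) * (B *v u s) $ i)"

lemma continuous_on_Bu: "continuous_on {-D..} (\<lambda>s. B *v u s)"
  by (rule bounded_linear.continuous_on[OF matrix_vector_mul_bounded_linear cont_u])

lemma continuous_on_exp_Bu: "continuous_on {-D..} (\<lambda>s. exp ((r - s) *\<^sub>R lam (\<iota> i)) * (B *v u s) $ i)"
  by (intro continuous_intros continuous_on_Bu)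

lemma continuous_on_exp_minus_Bu: "continuous_on {-D..} (\<lambda>s. exp ((- s) *\<^sub>R lam (\<iota> i)) * (B *v u s) $ i)"
  by (intro continuous_intros continuous_on_Bu)

lemma continuous_on_mexp_Bu: "continuous_on {-D..} (\<lambda>s. mexp ((r - s - D) *\<^sub>R A) *v (B *v u s))"
proof -
  have eq: "r - s - D = r - D - s" for s by simp
  have "(\<lambda>s. mexp ((r - s - D) *\<^sub>R A) *v (B *v u s))
      = (\<lambda>s. \<chi> i. exp (((r - D) - s) *\<^sub>R lam (\<iota> i)) * (B *v u s) $ i)"
    by (simp add: A vec_eq_iff fun_eq_iff mexp_modes_matrix_mult_vec eq)
  then show ?thesis by (simp only:) (intro continuous_on_vec_lambda continuous_on_exp_Bu)
qed

lemma history_has_vector_derivative: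
  assumes "t > - D"
  shows "(history i has_vector_derivative exp ((- t) *\<^sub>R lam (\<iota> i)) * (B *v u t) $ i) (at t)"
proof -
  have "continuous_on {-D..t + 1} (\<lambda>s. exp ((- s) *\<^sub>R lam (\<iota> i)) * (B *v u s) $ i)"
    by (rule continuous_on_subset[OF continuous_on_exp_minus_Bu]) auto
  then have "(history i has_vector_derivative exp ((- t) *\<^sub>R lam (\<iota> i)) * (B *v u t) $ i)
      (at t within {-D..t + 1})"
    unfolding history_def using assms by (intro integral_has_vector_derivative) auto
  then show ?thesis using assms by (simp add: at_within_Icc_at)
qed

lemma continuous_on_history: "continuous_on {-D..} (history i)"
proof -
  have "continuous_on {-D..r} (history i)" for r
  proof (cases "r \<ge> - D")
    case True
    have "continuous_on {-D..r} (\<lambda>s. exp ((- s) *\<^sub>R lam (\<iota> i)) * (B *v u s) $ i)"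
      by (rule continuous_on_subset[OF continuous_on_exp_minus_Bu]) auto
    then show ?thesis unfolding history_def by (intro indefinite_integral_continuous_1 integrable_continuous_real)
  qed simp
  then show ?thesis
    unfolding continuous_on_eq_continuous_within
  proof (intro ballI)
    fix x assume *: "\<And>r. \<forall>x\<in>{-D..r}. continuous (at x within {-D..r}) (history i)" and x: "x \<in> {-D..}"
    have "continuous (at x within {-D..x + 1}) (history i)" using *[of "x + 1"] x by auto
    moreover have "at x within {-D..x + 1} = at x within {-D..}"
      by (rule at_within_nhd[of _ "{..<x + 1}"]) auto
    ultimately show "continuous (at x within {-D..}) (history i)" by simp
  qed
qed

lemma history_zero: "t \<le> 0 \<Longrightarrow> history i t = 0"
  unfolding history_def by (subst integral_cong[where g = "\<lambda>_. 0"]) (auto simp: u_zero)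

text \<open>The group law of the exponential separates \<open>t\<close> from \<open>s\<close>. The
  cut lower limit may be replaced by \<open>t - D\<close>, as \<open>history\<close> vanishes up to
  time 0.\<close>

lemma predictor_integral_nth:
  assumes "t \<ge> 0"
  shows "integral {max (t - D) 0..t} (\<lambda>s. mexp ((t - s - D) *\<^sub>R A) *v (B *v u s)) $ i
    = exp ((t - D) *\<^sub>R lam (\<iota> i)) * (history i t - history i (t - D))"
proof -
  let ?h = "\<lambda>s. exp ((- s) *\<^sub>R lam (\<iota> i)) * (B *v u s) $ i"
  let ?a = "max (t - D) 0"
  have at: "?a \<le> t" "- D \<le> ?a" using assms D by auto
  have "(\<lambda>s. mexp ((t - s - D) *\<^sub>R A) *v (B *v u s)) integrable_on {?a..t}"
    using D by (intro integrable_continuous_real continuous_on_subset[OF continuous_on_mexp_Bu]) auto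
  from integral_linear[OF this bounded_linear_vec_nth[of i]]
  have "integral {?a..t} (\<lambda>s. mexp ((t - s - D) *\<^sub>R A) *v (B *v u s)) $ i
     = integral {?a..t} (\<lambda>s. exp ((t - s - D) *\<^sub>R lam (\<iota> i)) * (B *v u s) $ i)"
    by (simp add: o_def A mexp_modes_matrix_mult_vec)
  also have "\<dots> = integral {?a..t} (\<lambda>s. exp ((t - D) *\<^sub>R lam (\<iota> i)) * ?h s)"
  proof (rule integral_cong)
    fix s
    have "exp ((t - s - D) *\<^sub>R lam (\<iota> i)) = exp ((t - D) *\<^sub>R lam (\<iota> i)) * exp ((- s) *\<^sub>R lam (\<iota> i))"
      unfolding exp_add[symmetric] by (simp add: algebra_simps)
    then show "exp ((t - s - D) *\<^sub>R lam (\<iota> i)) * (B *v u s) $ i = exp ((t - D) *\<^sub>R lam (\<iota> i)) * ?h s"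
      by (simp add: mult.assoc)
  qed
  also have "\<dots> = exp ((t - D) *\<^sub>R lam (\<iota> i)) * integral {?a..t} ?h" by simp
  also have "integral {?a..t} ?h = history i t - history i ?a"
  proof -
    have "?h integrable_on {-D..t}"
      by (intro integrable_continuous_real continuous_on_subset[OF continuous_on_exp_minus_Bu]) auto
    then show ?thesis
      unfolding history_def using Henstock_Kurzweil_Integration.integral_combine[OF at(2,1), of ?h]
      by (simp add: algebra_simps)
  qed
  also have "history i ?a = history i (t - D)"
    by (cases "t \<ge> D") (auto simp: max_def history_zero)
  finally show ?thesis .
qed

lemma predictor_nth:
  "t \<ge> 0 \<Longrightarrow> predictor D A B Y u t $ i
    = Y t $ i + exp ((t - D) *\<^sub>R lam (\<iota> i)) * (history i t - history i (t - D))"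
  by (simp only: predictor_def vector_add_component predictor_integral_nth)

lemma continuous_on_predictor:
  assumes Y: "continuous_on {0..} Y"
  shows "continuous_on {0..} (predictor D A B Y u)"
proof -
  have "continuous_on {0..} (\<lambda>t. \<chi> i. Y t $ i + exp ((t - D) *\<^sub>R lam (\<iota> i)) * (history i t - history i (t - D)))"
    using D by (intro continuous_on_vec_lambda continuous_intros Y continuous_on_subset[OF continuous_on_history]
      continuous_on_compose2[OF continuous_on_history, where f = "\<lambda>t. t - D"]) auto
  then show ?thesis
    by (rule continuous_on_eq) (simp add: vec_eq_iff predictor_nth)
qed

text \<open>The lower end of the window contributes \<open>- B u (t - D)\<close> to the derivative,
  which cancels the delayed input of \<open>Y\<close>. The delay disappears and the input acts at
  once, through \<open>mexp (- D A) B\<close>.\<close>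

lemma predictor_has_vector_derivative:
  assumes t: "t > 0"
    and Y: "(Y has_vector_derivative A *v Y t + B *v u (t - D) + F) (at t)"
  shows "(predictor D A B Y u has_vector_derivative
      A *v predictor D A B Y u t + mexp ((- D) *\<^sub>R A) *v (B *v u t) + F) (at t)"
proof (rule has_vector_derivative_vec)
  fix i
  let ?l = "lam (\<iota> i)"
  let ?g = "\<lambda>s. (B *v u s) $ i"
  have Yi: "((\<lambda>t. Y t $ i) has_vector_derivative ?l * Y t $ i + ?g (t - D) + F $ i) (at t)"
    using bounded_linear.has_vector_derivative[OF bounded_linear_vec_nth Y, of i]
    by (simp add: A modes_matrix_mult_vec)
  have h1: "(history i has_vector_derivative exp ((- t) *\<^sub>R ?l) * ?g t) (at t)"
    using t D by (intro history_has_vector_derivative) simp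
  have shift: "((\<lambda>s. s - D) has_vector_derivative 1) (at t)"
    by (auto intro!: derivative_eq_intros)
  have h2: "((\<lambda>s. history i (s - D)) has_vector_derivative exp ((- (t - D)) *\<^sub>R ?l) * ?g (t - D)) (at t)"
    using vector_diff_chain_at[OF shift history_has_vector_derivative, of i] t by (simp add: o_def)
  have e: "((\<lambda>s. exp ((s - D) *\<^sub>R ?l)) has_vector_derivative exp ((t - D) *\<^sub>R ?l) * ?l) (at t)"
    using vector_diff_chain_at[OF shift exp_scaleR_has_vector_derivative_right, of ?l] by (simp add: o_def)
  let ?H = "history i t - history i (t - D)"
  have v: "((\<lambda>s. Y s $ i + exp ((s - D) *\<^sub>R ?l) * (history i s - history i (s - D))) has_vector_derivative
      (?l * Y t $ i + ?g (t - D) + F $ i)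
      + (exp ((t - D) *\<^sub>R ?l) * (exp ((- t) *\<^sub>R ?l) * ?g t - exp ((- (t - D)) *\<^sub>R ?l) * ?g (t - D))
        + exp ((t - D) *\<^sub>R ?l) * ?l * ?H)) (at t)"
    by (intro has_vector_derivative_add Yi has_vector_derivative_mult e has_vector_derivative_diff h1 h2)
  have c_eq: "exp ((t - D) *\<^sub>R ?l) * (exp ((- t) *\<^sub>R ?l) * ?g t - exp ((- (t - D)) *\<^sub>R ?l) * ?g (t - D))
     = exp ((- D) *\<^sub>R ?l) * ?g t - ?g (t - D)"
  proof -
    have "exp ((t - D) *\<^sub>R ?l) * exp ((- t) *\<^sub>R ?l) = exp ((- D) *\<^sub>R ?l)"
      "exp ((t - D) *\<^sub>R ?l) * exp ((- (t - D)) *\<^sub>R ?l) = 1"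
      unfolding exp_add[symmetric] scaleR_left_distrib[symmetric] by simp_all
    then show ?thesis by (simp add: right_diff_distrib flip: mult.assoc)
  qed
  have rhs: "(A *v predictor D A B Y u t + mexp ((- D) *\<^sub>R A) *v (B *v u t) + F) $ i
     = ?l * (Y t $ i + exp ((t - D) *\<^sub>R ?l) * ?H) + exp ((- D) *\<^sub>R ?l) * ?g t + F $ i"
    using predictor_nth[of t Y i] t
    by (simp only: vector_add_component A modes_matrix_mult_vec mexp_modes_matrix_mult_vec)
  have alg: "(l * y + b + f) + ((d - b) + e * l * h) = l * (y + e * h) + d + f" for l y b f d e h :: 'k
    by (simp add: algebra_simps)
  have d: "((\<lambda>s. Y s $ i + exp ((s - D) *\<^sub>R ?l) * (history i s - history i (s - D)))
      has_vector_derivative (A *v predictor D A B Y u t + mexp ((- D) *\<^sub>R A) *v (B *v u t) + F) $ i) (at t)"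
    by (rule back_subst[of "\<lambda>d. (_ has_vector_derivative d) _", OF v])
      (subst rhs, subst c_eq, rule alg)
  show "((\<lambda>s. predictor D A B Y u s $ i) has_vector_derivative
      (A *v predictor D A B Y u t + mexp ((- D) *\<^sub>R A) *v (B *v u t) + F) $ i) (at t)"
    using has_vector_derivative_transform_within_open[OF d, of "{0<..}"] t by (auto simp: predictor_nth)
qed

lemma norm_predictor_integral_le:
  assumes "t \<ge> 0"
  shows "norm (integral {max (t - D) 0..t} (\<lambda>s. mexp ((t - s - D) *\<^sub>R A) *v (B *v u s)))
    \<le> exp (D * mnorm A) * integral {max (t - D) 0..t} (\<lambda>s. norm (B *v u s))"
proof -
  let ?a = "max (t - D) 0"
  have sub: "{?a..t} \<subseteq> {-D..}" using D by auto
  have "norm (integral {?a..t} (\<lambda>s. mexp ((t - s - D) *\<^sub>R A) *v (B *v u s)))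
     \<le> integral {?a..t} (\<lambda>s. exp (D * mnorm A) * norm (B *v u s))"
  proof (rule integral_norm_bound_integral)
    show "(\<lambda>s. mexp ((t - s - D) *\<^sub>R A) *v (B *v u s)) integrable_on {?a..t}"
      by (intro integrable_continuous_real continuous_on_subset[OF continuous_on_mexp_Bu sub])
    show "(\<lambda>s. exp (D * mnorm A) * norm (B *v u s)) integrable_on {?a..t}"
      by (intro integrable_continuous_real continuous_intros continuous_on_subset[OF continuous_on_Bu sub])
    fix s assume s: "s \<in> {?a..t}"
    have "norm (mexp ((t - s - D) *\<^sub>R A) *v (B *v u s)) \<le> exp (\<bar>t - s - D\<bar> * mnorm A) * norm (B *v u s)"
      unfolding A by (rule norm_mexp_modes_matrix_mult_vec_le)
    \<comment> \<open>On the window, \<open>t - s - D\<close> lies in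
      \<open>[- D, 0]\<close>.\<close>
    also have "\<dots> \<le> exp (D * mnorm A) * norm (B *v u s)"
      using s by (intro mult_right_mono) (auto intro!: mult_right_mono)
    finally show "norm (mexp ((t - s - D) *\<^sub>R A) *v (B *v u s)) \<le> exp (D * mnorm A) * norm (B *v u s)" .
  qed
  then show ?thesis by simp
qed

end

section \<open>The linear closed loop\<close>

text \<open>The fixed linear data and the constants built from them. The vector fields are kept out:
  they enter later as a forcing term.\<close>

locale predictor_feedback_loop = separable_hilbert_space sc ip
  for sc :: "'k::real_or_complex \<Rightarrow> 'h::banach \<Rightarrow> 'h" and ip :: "'h \<Rightarrow> 'h \<Rightarrow> 'k" +
  fixes DA DB :: "'h set"
    and \<A> :: "'h \<Rightarrow> 'h"
    and \<B> :: "'h \<Rightarrow> 'k^'m"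
    and B :: "'k^'m \<Rightarrow> 'h"
    and lam :: "nat \<Rightarrow> 'k"
    and \<phi> \<psi> :: "nat \<Rightarrow> 'h"
    and m\<^sub>R M\<^sub>R \<alpha> :: real
    and N\<^sub>0 :: nat
    and \<iota> :: "'p::finite \<Rightarrow> nat"
    and A\<^sub>N :: "'k^'p^'p"
    and B\<^sub>N :: "'k^'m^'p"
    and D t\<^sub>0 :: real
    and \<theta> :: "real \<Rightarrow> real"
    and K :: "'k^'p^'m"
    and A\<^sub>c\<^sub>l P :: "'k^'p^'p"
    and \<beta> \<gamma>\<^sub>1 \<gamma>\<^sub>2 :: real
    and nBK C\<^sub>1 C\<^sub>3 C\<^sub>4 C\<^sub>5 C\<^sub>6 \<kappa>\<^sub>0 :: real
  assumes bcs: "abstract_boundary_control_system sc DA \<A> DB \<B>"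
    and lifting: "lifting_operator sc DA \<A> \<B> B"
    and A1: "riesz_spectral_operator sc (dom0 DA \<B>) \<A> lam \<phi> m\<^sub>R M\<^sub>R"
    and biorth: "biorthogonal ip \<phi> \<psi>"
    and \<alpha>: "\<alpha> > 0"
    and A2: "\<forall>n\<ge>N\<^sub>0 + 1. ReK (lam n) \<le> - \<alpha>"
    and \<iota>: "bij_betw \<iota> (UNIV :: 'p set) {1..N\<^sub>0}"
    and AN: "A\<^sub>N = modes_matrix \<iota> lam"
    and BN: "B\<^sub>N = input_matrix \<iota> ip \<A> B lam \<psi>"
    and D: "D > 0"
    and t0: "t\<^sub>0 > 0"
    and \<theta>_range: "\<forall>t\<ge>-D. 0 \<le> \<theta> t \<and> \<theta> t \<le> 1"
    and \<theta>_one: "\<forall>t\<ge>t\<^sub>0. \<theta> t = 1"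
    and Acl: "A\<^sub>c\<^sub>l = A\<^sub>N + mexp ((- D) *\<^sub>R A\<^sub>N) ** B\<^sub>N ** K"
    and P_pos_def: "hermitian_pos_def P"
    and P_lyapunov: "adjointK A\<^sub>c\<^sub>l ** P + P ** A\<^sub>c\<^sub>l = - mat 1"
    and nBK: "nBK = onorm (\<lambda>y. B (K *v y))"
    and C1: "C\<^sub>1 = 2 * max 1 (D * exp (2 * D * mnorm A\<^sub>N) * (mnorm (B\<^sub>N ** K))\<^sup>2)"
    and C5: "C\<^sub>5 = 2 * real CARD('m) / (\<alpha> * m\<^sub>R) *
               (\<Sum>i\<in>UNIV. (norm (\<A> (B (axis i 1))))\<^sup>2 * (norm (K $ i))\<^sup>2
                         + (norm (B (axis i 1)))\<^sup>2 * (norm (K $ i v* A\<^sub>c\<^sub>l))\<^sup>2)"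
    and \<beta>: "0 < \<beta>" "\<beta> < 1"
    and \<gamma>1: "\<gamma>\<^sub>1 > C\<^sub>1 / lambda_min P"
    and \<gamma>2: "\<gamma>\<^sub>2 > max (nBK\<^sup>2 / (m\<^sub>R * lambda_min P)) (C\<^sub>5 / (1 - \<beta>))"
    and C3: "C\<^sub>3 = \<gamma>\<^sub>2 * lambda_min P - nBK\<^sup>2 / m\<^sub>R"
    and C4: "C\<^sub>4 = sqrt (2 * M\<^sub>R) + nBK / sqrt C\<^sub>3"
    and \<kappa>0: "\<kappa>\<^sub>0 = 1 / 2 * Min {(1 - \<beta>) / lambda_max P,
                              (1 - \<beta> - C\<^sub>5 / \<gamma>\<^sub>2) / lambda_max P,
                              \<alpha> / 2}"
    and C6: "C\<^sub>6 = 1 / m\<^sub>R * (2 * (m\<^sub>R + nBK\<^sup>2) / (\<alpha> * m\<^sub>R)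
                           + (\<gamma>\<^sub>1 * (1 + D) + \<gamma>\<^sub>2) * (mnorm P)\<^sup>2 / \<beta>)"
begin

subsection \<open>The constants\<close>

lemma riesz: "riesz_basis sc \<phi> m\<^sub>R M\<^sub>R"
  using A1 by (simp add: riesz_spectral_operator_def)

lemma m\<^sub>R_pos: "m\<^sub>R > 0" and M\<^sub>R_pos: "M\<^sub>R > 0"
  using riesz by (simp_all add: riesz_basis_def)

lemma bounded_linear_BK: "bounded_linear (\<lambda>y. B (K *v y))"
  using lifting bounded_linear_compose[of B "(*v) K"]
  by (simp add: lifting_operator_def bounded_operator_def matrix_vector_mul_bounded_linear)

lemma norm_BK_le: "norm (B (K *v y)) \<le> nBK * norm y"
  unfolding nBK by (rule onorm[OF bounded_linear_BK])

lemma nBK_nonneg: "nBK \<ge> 0"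
  unfolding nBK by (rule onorm_pos_le[OF bounded_linear_BK])

lemma norm_BK_power2_le: "(norm (B (K *v y)))\<^sup>2 \<le> nBK\<^sup>2 * (norm y)\<^sup>2"
  unfolding power_mult_distrib[symmetric] by (intro power_mono norm_BK_le) auto

lemma lambda_min_pos': "lambda_min P > 0"
  and lambda_max_pos': "lambda_max P > 0"
  using lambda_min_pos lambda_max_pos P_pos_def by blast+

lemma C5_nonneg: "C\<^sub>5 \<ge> 0"
  unfolding C5 using \<alpha> m\<^sub>R_pos by (intro mult_nonneg_nonneg sum_nonneg add_nonneg_nonneg) auto

lemma \<gamma>2_pos: "\<gamma>\<^sub>2 > 0"
proof -
  have "0 \<le> C\<^sub>5 / (1 - \<beta>)" using C5_nonneg \<beta> by simp
  then show ?thesis using \<gamma>2 by linarith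
qed

lemma C1_ge: "C\<^sub>1 \<ge> 2" "C\<^sub>1 \<ge> 2 * (D * exp (2 * D * mnorm A\<^sub>N) * (mnorm (B\<^sub>N ** K))\<^sup>2)"
  unfolding C1 by simp_all

lemma \<gamma>1_ge: "\<gamma>\<^sub>1 * lambda_min P \<ge> C\<^sub>1"
  using \<gamma>1 lambda_min_pos' by (simp add: field_simps)

lemma \<gamma>1_pos: "\<gamma>\<^sub>1 > 0"
proof -
  have "0 \<le> C\<^sub>1 / lambda_min P" using C1_ge(1) lambda_min_pos' by simp
  then show ?thesis using \<gamma>1 by linarith
qed

lemma C3_pos: "C\<^sub>3 > 0"
proof -
  have "nBK\<^sup>2 / (m\<^sub>R * lambda_min P) < \<gamma>\<^sub>2" using \<gamma>2 by simp
  then show ?thesis unfolding C3 using lambda_min_pos' m\<^sub>R_pos by (simp add: field_simps)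
qed

lemma C4_nonneg: "C\<^sub>4 \<ge> 0"
  unfolding C4 using M\<^sub>R_pos nBK_nonneg C3_pos by simp

lemma C6_nonneg: "C\<^sub>6 \<ge> 0"
  unfolding C6 using m\<^sub>R_pos \<alpha> \<gamma>1_pos \<gamma>2_pos D \<beta> by simp

text \<open>Each entry of the minimum pays for one kind of term in the functional: the terms
  weighted by \<open>\<gamma>\<^sub>1\<close>, the delayed term weighted by
  \<open>\<gamma>\<^sub>2\<close> after \<open>C\<^sub>5\<close> has been taken from it, and the
  tail modes.\<close>

lemma \<kappa>0_le: "2 * \<kappa>\<^sub>0 * lambda_max P \<le> 1 - \<beta>"
    "2 * \<kappa>\<^sub>0 * lambda_max P * \<gamma>\<^sub>2 \<le> (1 - \<beta>) * \<gamma>\<^sub>2 - C\<^sub>5" "2 * \<kappa>\<^sub>0 \<le> \<alpha> / 2"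
  and \<kappa>0_pos: "\<kappa>\<^sub>0 > 0"
proof -
  have le: "2 * \<kappa>\<^sub>0 \<le> (1 - \<beta>) / lambda_max P" "2 * \<kappa>\<^sub>0 \<le> (1 - \<beta> - C\<^sub>5 / \<gamma>\<^sub>2) / lambda_max P"
    "2 * \<kappa>\<^sub>0 \<le> \<alpha> / 2"
    unfolding \<kappa>0 by (auto intro: min.coboundedI1 min.coboundedI2 simp del: le_divide_eq_numeral1)
  then show "2 * \<kappa>\<^sub>0 \<le> \<alpha> / 2" by simp
  show "2 * \<kappa>\<^sub>0 * lambda_max P \<le> 1 - \<beta>"
    using le(1) lambda_max_pos' by (simp add: pos_le_divide_eq)
  have "2 * \<kappa>\<^sub>0 * lambda_max P \<le> 1 - \<beta> - C\<^sub>5 / \<gamma>\<^sub>2"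
    using le(2) lambda_max_pos' by (simp add: pos_le_divide_eq)
  then have "2 * \<kappa>\<^sub>0 * lambda_max P * \<gamma>\<^sub>2 \<le> (1 - \<beta> - C\<^sub>5 / \<gamma>\<^sub>2) * \<gamma>\<^sub>2"
    using \<gamma>2_pos by (intro mult_right_mono) auto
  also have "\<dots> = (1 - \<beta>) * \<gamma>\<^sub>2 - C\<^sub>5" using \<gamma>2_pos by (simp add: field_simps)
  finally show "2 * \<kappa>\<^sub>0 * lambda_max P * \<gamma>\<^sub>2 \<le> (1 - \<beta>) * \<gamma>\<^sub>2 - C\<^sub>5" .
  have "C\<^sub>5 / (1 - \<beta>) < \<gamma>\<^sub>2" using \<gamma>2 by simp
  then have "C\<^sub>5 / \<gamma>\<^sub>2 < 1 - \<beta>" using \<beta> \<gamma>2_pos by (simp add: field_simps)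
  then have "(1 - \<beta> - C\<^sub>5 / \<gamma>\<^sub>2) / lambda_max P > 0" "(1 - \<beta>) / lambda_max P > 0"
    using lambda_max_pos' \<beta> by simp_all
  then show "\<kappa>\<^sub>0 > 0" unfolding \<kappa>0 using \<alpha> by simp
qed

subsection \<open>Modes\<close>

lemma bessel:
  assumes "finite I" "I \<subseteq> {1..}"
  shows "(\<Sum>n\<in>I. (norm (ip x (\<psi> n)))\<^sup>2) \<le> (norm x)\<^sup>2 / m\<^sub>R"
proof -
  obtain N where "I \<subseteq> {1..N}"
    using assms finite_nat_set_iff_bounded_le[of I] by (metis atLeastAtMost_iff atLeast_iff subset_eq)
  then have "(\<Sum>n\<in>I. (norm (ip x (\<psi> n)))\<^sup>2) \<le> (\<Sum>n=1..N. (norm (ip x (\<psi> n)))\<^sup>2)"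
    by (intro sum_mono2) auto
  also have "\<dots> \<le> (norm x)\<^sup>2 / m\<^sub>R" by (rule riesz_bessel[OF riesz biorth])
  finally show ?thesis .
qed

lemma norm_mode_coords_power2: "(norm (mode_coords \<iota> ip \<psi> x))\<^sup>2 = (\<Sum>n=1..N\<^sub>0. (norm (ip x (\<psi> n)))\<^sup>2)"
  unfolding norm_vec_power2 mode_coords_def
  using sum.reindex_bij_betw[OF \<iota>, of "\<lambda>n. (norm (ip x (\<psi> n)))\<^sup>2"] by simp

lemma norm_mode_coords_power2_le: "(norm (mode_coords \<iota> ip \<psi> x))\<^sup>2 \<le> (norm x)\<^sup>2 / m\<^sub>R"
  unfolding norm_mode_coords_power2 by (rule bessel) auto

lemma \<iota>_ge_1: "\<iota> i \<ge> 1"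
  using \<iota> by (auto dest: bij_betwE)

text \<open>The corrected vector \<open>x - B (\<B> x)\<close> has zero boundary value, so it lies
  in the domain of the generator, where \<open>\<psi> n\<close> acts as an eigenvector of the
  adjoint.\<close>

lemma ip_\<A>:
  assumes x: "x \<in> DA" and n: "n \<ge> 1"
  shows "ip (\<A> x) (\<psi> n) = lam n * ip (x - B (\<B> x)) (\<psi> n) + ip (\<A> (B (\<B> x))) (\<psi> n)"
proof -
  define y where "y = x - B (\<B> x)"
  have lin: "linear_operator sc sc DA \<A>" "linear_operator sc (*s) DB \<B>" "DA \<subseteq> DB"
    using bcs by (simp_all add: abstract_boundary_control_system_def)
  obtain S where S: "C0_semigroup sc S" "generates_semigroup (dom0 DA \<B>) \<A> S"
    using bcs by (auto simp: abstract_boundary_control_system_def)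
  have Bx: "B (\<B> x) \<in> DA" "\<B> (B (\<B> x)) = \<B> x"
    using lifting by (auto simp: lifting_operator_def)
  have y: "y \<in> DA" unfolding y_def
    using lin(1) x Bx(1) by (intro subspace_diff) (simp_all add: linear_operator_def)
  have xy: "x = y + B (\<B> x)" by (simp add: y_def)
  have "\<B> x = \<B> y + \<B> (B (\<B> x))"
    using lin(2,3) y Bx(1) xy unfolding linear_operator_def by (metis subsetD)
  then have "\<B> y = 0" using Bx(2) by simp
  then have "y \<in> dom0 DA \<B>" using y by (simp add: dom0_def)
  then have "ip (\<A> y) (\<psi> n) = lam n * ip y (\<psi> n)"
    by (rule riesz_spectral_adjoint_eigenvector[OF S A1 biorth n])
  moreover have "\<A> x = \<A> y + \<A> (B (\<B> x))"
    using lin(1) y Bx(1) xy unfolding linear_operator_def by metis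
  ultimately show ?thesis by (simp add: ip_add_left y_def)
qed

text \<open>These are exactly the terms of \<open>ip_\<A>\<close> that depend on the boundary value,
  which explains the form of \<open>input_coeff\<close>.\<close>

lemma input_matrix_mult_nth:
  "(B\<^sub>N *v w) $ i = - lam (\<iota> i) * ip (B w) (\<psi> (\<iota> i)) + ip (\<A> (B w)) (\<psi> (\<iota> i))"
proof -
  have "bounded_operator (*s) sc B" "bounded_operator (*s) sc (\<lambda>w. \<A> (B w))"
    using lifting by (simp_all add: lifting_operator_def)
  from this[THEN bounded_operator_vec_expand, of w] show ?thesis
    unfolding BN input_matrix_def input_coeff_def matrix_vector_mult_def
    by (simp add: ip_sum_left ip_scale_left sum_distrib_left sum_subtractf sum_negf algebra_simps)
qed

text \<open>\<open>C\<^sub>5\<close> is the cost of the lifted input and of its time derivative in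
  the tail modes: \<open>2 / \<alpha>\<close> comes from Young's inequality,
  \<open>1 / m\<^sub>R\<close> from Bessel's, and the rows of \<open>K\<close> and
  \<open>K A\<^sub>c\<^sub>l\<close> from the input coordinates.\<close>

lemma norm_AB_power2_le:
  "2 / \<alpha> * ((norm (\<A> (B (K *v z))))\<^sup>2 / m\<^sub>R) + 2 / \<alpha> * ((norm (B (K *v (A\<^sub>c\<^sub>l *v z))))\<^sup>2 / m\<^sub>R)
    \<le> C\<^sub>5 * (norm z)\<^sup>2"
proof -
  let ?S1 = "\<Sum>i\<in>UNIV. (norm (\<A> (B (axis i 1))))\<^sup>2 * (norm (K $ i))\<^sup>2"
  let ?S2 = "\<Sum>i\<in>UNIV. (norm (B (axis i 1)))\<^sup>2 * (norm (K $ i v* A\<^sub>c\<^sub>l))\<^sup>2"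
  have op: "bounded_operator (*s) sc B" "bounded_operator (*s) sc (\<lambda>w. \<A> (B w))"
    using lifting by (simp_all add: lifting_operator_def)
  have "(norm (\<A> (B (K *v z))))\<^sup>2 \<le> real CARD('m) * ?S1 * (norm z)\<^sup>2"
    by (rule norm_bounded_operator_power2_le[OF op(2)]) (rule norm_row_mult_le)
  moreover have "(norm (B (K *v (A\<^sub>c\<^sub>l *v z))))\<^sup>2 \<le> real CARD('m) * ?S2 * (norm z)\<^sup>2"
  proof (rule norm_bounded_operator_power2_le[OF op(1)])
    fix i
    have "(K ** A\<^sub>c\<^sub>l) $ i = K $ i v* A\<^sub>c\<^sub>l"
      by (simp add: matrix_matrix_mult_def vector_matrix_mult_def mult.commute)
    then show "norm ((K *v (A\<^sub>c\<^sub>l *v z)) $ i) \<le> norm (K $ i v* A\<^sub>c\<^sub>l) * norm z"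
      using norm_row_mult_le[of "K ** A\<^sub>c\<^sub>l" z i] by (simp add: matrix_vector_mul_assoc)
  qed
  ultimately have "2 / (\<alpha> * m\<^sub>R) * ((norm (\<A> (B (K *v z))))\<^sup>2 + (norm (B (K *v (A\<^sub>c\<^sub>l *v z))))\<^sup>2)
     \<le> 2 / (\<alpha> * m\<^sub>R) * (real CARD('m) * ?S1 * (norm z)\<^sup>2 + real CARD('m) * ?S2 * (norm z)\<^sup>2)"
    using \<alpha> m\<^sub>R_pos by (intro mult_left_mono add_mono) auto
  also have "\<dots> = C\<^sub>5 * (norm z)\<^sup>2"
    unfolding C5 sum.distrib by (simp add: algebra_simps)
  finally show ?thesis by (simp add: algebra_simps)
qed

subsection \<open>The Lyapunov equation\<close>

definition quad :: "'k^'p \<Rightarrow> real" where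
  "quad z = inner (P *v z) z"

lemma P_selfadjoint: "inner (P *v x) y = inner x (P *v y)"
  using inner_adjointK[of P x y] P_pos_def by (simp add: hermitian_pos_def_def)

lemma quad_ge: "lambda_min P * (norm z)\<^sup>2 \<le> quad z"
  and quad_le: "quad z \<le> lambda_max P * (norm z)\<^sup>2"
  unfolding quad_def using lambda_min_le[OF P_pos_def] lambda_max_ge[OF P_pos_def] by auto

lemma quad_nonneg: "quad z \<ge> 0"
  using quad_ge[of z] lambda_min_pos' by (meson mult_nonneg_nonneg less_imp_le order_trans zero_le_power2)

lemma quad_le_mnorm: "quad z \<le> mnorm P * (norm z)\<^sup>2"
proof -
  have "quad z \<le> norm (P *v z) * norm z" unfolding quad_def by (rule norm_cauchy_schwarz)
  also have "\<dots> \<le> mnorm P * norm z * norm z" by (intro mult_right_mono norm_matrix_vector_mult_le) simp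
  finally show ?thesis by (simp add: power2_eq_square mult.assoc)
qed

lemma lyapunov: "2 * inner (P *v z) (A\<^sub>c\<^sub>l *v z) = - (norm z)\<^sup>2"
proof -
  have "(- mat 1 :: 'k^'p^'p) *v z = - z"
    using matrix_vector_mult_diff_rdistrib[of 0 "mat 1" z] by simp
  then have "inner ((adjointK A\<^sub>c\<^sub>l ** P + P ** A\<^sub>c\<^sub>l) *v z) z = - (norm z)\<^sup>2"
    unfolding P_lyapunov by (simp add: power2_norm_eq_inner)
  moreover have "inner ((adjointK A\<^sub>c\<^sub>l ** P + P ** A\<^sub>c\<^sub>l) *v z) z = 2 * inner (P *v z) (A\<^sub>c\<^sub>l *v z)"
    unfolding matrix_vector_mult_add_rdistrib inner_add_left matrix_vector_mul_assoc[symmetric]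
      inner_adjointK P_selfadjoint[of "A\<^sub>c\<^sub>l *v z"]
    by (simp add: inner_commute)
  ultimately show ?thesis by simp
qed

text \<open>Young's inequality spends a share \<open>\<beta>\<close> of the unit decay on the
  perturbation; hence \<open>1 - \<beta>\<close> in \<open>\<kappa>\<^sub>0\<close> and
  \<open>1 / \<beta>\<close> in \<open>C\<^sub>6\<close>.\<close>

lemma lyapunov_perturbed:
  "2 * inner (P *v z) (A\<^sub>c\<^sub>l *v z + F) \<le> - (1 - \<beta>) * (norm z)\<^sup>2 + (mnorm P)\<^sup>2 / \<beta> * (norm F)\<^sup>2"
proof -
  have "2 * inner (P *v z) F \<le> 2 * (norm (P *v z) * norm F)"
    using norm_cauchy_schwarz[of "P *v z" F] by simp
  also have "\<dots> \<le> 2 * (mnorm P * norm z * norm F)"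
    by (intro mult_left_mono mult_right_mono norm_matrix_vector_mult_le) auto
  also have "\<dots> = 2 * (norm z * (mnorm P * norm F))" by simp
  also have "\<dots> \<le> 2 * (\<beta> / 2 * (norm z)\<^sup>2 + (mnorm P * norm F)\<^sup>2 / (4 * (\<beta> / 2)))"
    using \<beta> by (intro mult_left_mono mult_le_weighted_squares) auto
  also have "\<dots> = \<beta> * (norm z)\<^sup>2 + (mnorm P)\<^sup>2 / \<beta> * (norm F)\<^sup>2"
    using \<beta> by (simp add: power_mult_distrib field_simps)
  finally show ?thesis using lyapunov[of z] by (simp add: inner_add_right algebra_simps)
qed

lemma quad_has_real_derivative:
  assumes "(z has_vector_derivative z') (at t)"
  shows "((\<lambda>s. quad (z s)) has_real_derivative 2 * inner (P *v z t) z') (at t)"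
proof -
  have "((\<lambda>s. P *v z s) has_vector_derivative P *v z') (at t)"
    by (rule bounded_linear.has_vector_derivative[OF matrix_vector_mul_bounded_linear assms])
  from bounded_bilinear.has_vector_derivative[OF bounded_bilinear_inner this assms]
  have "((\<lambda>s. quad (z s)) has_vector_derivative inner (P *v z t) z' + inner (P *v z') (z t)) (at t)"
    unfolding quad_def .
  moreover have "inner (P *v z') (z t) = inner (P *v z t) z'"
    by (metis P_selfadjoint inner_commute)
  ultimately show ?thesis by (simp add: has_real_derivative_iff_has_vector_derivative)
qed

lemma continuous_on_quad [continuous_intros]: "continuous_on S z \<Longrightarrow> continuous_on S (\<lambda>s. quad (z s))"
  unfolding quad_def
  by (intro continuous_intros bounded_linear.continuous_on[OF matrix_vector_mul_bounded_linear])

lemma A\<^sub>c\<^sub>l_mult: "A\<^sub>c\<^sub>l *v z = A\<^sub>N *v z + mexp ((- D) *\<^sub>R A\<^sub>N) *v (B\<^sub>N *v (K *v z))"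
  unfolding Acl by (simp add: matrix_vector_mult_add_rdistrib flip: matrix_vector_mul_assoc)


subsection \<open>Closed-loop trajectories with a forcing term\<close>

text \<open>Explicit, since the final constants must not depend on the trajectory:
  \<open>1 / sqrt m\<^sub>R\<close> bounds the modes by the state, and the exponential is the
  Gronwall bound for the control on \<open>[0, D + t\<^sub>0]\<close>.\<close>

definition init_Z :: real where
  "init_Z = 1 / sqrt m\<^sub>R * (1 + exp (D * mnorm A\<^sub>N) * mnorm B\<^sub>N * ((D + t\<^sub>0) * (mnorm K
     * exp (mnorm K * (exp (D * mnorm A\<^sub>N) * mnorm B\<^sub>N) * (D + t\<^sub>0)))))"

text \<open>The terms of the functional at time \<open>D + t\<^sub>0\<close>, with
  \<open>init_Z\<close> in place of the norm of \<open>Z\<close> and 1 in place of that of the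
  state; the last summand stands for the tail of the homogenised state.\<close>

definition init_V :: real where
  "init_V = \<gamma>\<^sub>1 * (mnorm P * init_Z\<^sup>2 + D * (mnorm P * init_Z\<^sup>2)) + \<gamma>\<^sub>2 * (mnorm P * init_Z\<^sup>2)
     + (1 + nBK * init_Z)\<^sup>2 / m\<^sub>R / 2"

lemma init_V_nonneg: "init_V \<ge> 0"
  unfolding init_V_def using m\<^sub>R_pos D \<gamma>1_pos \<gamma>2_pos
  by (intro mult_nonneg_nonneg add_nonneg_nonneg divide_nonneg_nonneg) auto

text \<open>The forcing \<open>f\<close> is arbitrary; for the interconnection it is
  \<open>f\<^sub>2\<close> along the solution. The closed loop is thus treated as a linear system
  with an external input.\<close>

context
  fixes X :: "real \<Rightarrow> 'h" and f :: "real \<Rightarrow> 'h" and u :: "real \<Rightarrow> 'k^'m"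
  assumes X_dom: "\<And>t. t \<ge> 0 \<Longrightarrow> X t \<in> DA"
    and X_cont: "continuous_on {0..} X"
    and X_deriv: "\<And>t. t \<ge> 0 \<Longrightarrow> (X has_vector_derivative \<A> (X t) + f t) (at t within {0..})"
    and boundary: "\<And>t. t \<ge> 0 \<Longrightarrow> \<B> (X t) = u (t - D)"
    and feedback: "predictor_feedback D \<theta> A\<^sub>N B\<^sub>N K (\<lambda>t. mode_coords \<iota> ip \<psi> (X t)) u"
begin

definition Y :: "real \<Rightarrow> 'k^'p" where "Y t = mode_coords \<iota> ip \<psi> (X t)"
definition F :: "real \<Rightarrow> 'k^'p" where "F t = mode_coords \<iota> ip \<psi> (f t)"
definition Z :: "real \<Rightarrow> 'k^'p" where "Z = predictor D A\<^sub>N B\<^sub>N Y u"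

lemma u_cont: "continuous_on {-D..} u" and u_zero: "t \<in> {-D..0} \<Longrightarrow> u t = 0"
  using feedback by (simp_all add: predictor_feedback_def)

lemma u_eq: "t \<ge> 0 \<Longrightarrow> u t = \<theta> t *\<^sub>R (K *v Z t)"
  using feedback unfolding predictor_feedback_def Z_def predictor_def Y_def
  by (simp add: matrix_vector_right_distrib scaleR_right_distrib)

lemma u_eq_K: "t \<ge> t\<^sub>0 \<Longrightarrow> u t = K *v Z t"
  using u_eq[of t] \<theta>_one t0 by simp

lemma X_deriv_at: "t > 0 \<Longrightarrow> (X has_vector_derivative \<A> (X t) + f t) (at t)"
  using X_deriv[of t] by (intro has_vector_derivative_at_if_within_atLeast[where a = 0]) auto

lemma Y_deriv:
  assumes "t > 0"
  shows "(Y has_vector_derivative A\<^sub>N *v Y t + B\<^sub>N *v u (t - D) + F t) (at t)"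
proof (rule has_vector_derivative_vec)
  fix i
  have "((\<lambda>t. ip (X t) (\<psi> (\<iota> i))) has_vector_derivative ip (\<A> (X t) + f t) (\<psi> (\<iota> i))) (at t)"
    by (rule bounded_linear.has_vector_derivative[OF bounded_linear_ip X_deriv_at[OF assms]])
  moreover have "ip (\<A> (X t) + f t) (\<psi> (\<iota> i)) = (A\<^sub>N *v Y t + B\<^sub>N *v u (t - D) + F t) $ i"
    using assms ip_\<A>[OF X_dom \<iota>_ge_1, of t i] boundary[of t]
    by (simp add: ip_add_left AN modes_matrix_mult_vec input_matrix_mult_nth Y_def F_def
        mode_coords_def ip_diff_left algebra_simps)
  ultimately show "((\<lambda>t. Y t $ i) has_vector_derivative (A\<^sub>N *v Y t + B\<^sub>N *v u (t - D) + F t) $ i) (at t)"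
    by (simp add: Y_def mode_coords_def)
qed

lemma Y_cont: "continuous_on {0..} Y"
  unfolding Y_def mode_coords_def by (intro continuous_on_vec_lambda continuous_intros X_cont)

lemma Z_cont: "continuous_on {0..} Z"
  unfolding Z_def by (rule continuous_on_predictor[OF D AN u_cont u_zero Y_cont])

text \<open>From \<open>t\<^sub>0\<close> on the cut-off is 1 and \<open>u = K Z\<close>, so the
  input term is absorbed into \<open>A\<^sub>c\<^sub>l\<close>.\<close>

lemma Z_deriv:
  assumes "t \<ge> t\<^sub>0"
  shows "(Z has_vector_derivative A\<^sub>c\<^sub>l *v Z t + F t) (at t)"
proof -
  have "t > 0" using assms t0 by simp
  from predictor_has_vector_derivative[OF D AN u_cont u_zero this Y_deriv[OF this]]
  show ?thesis using u_eq_K[OF assms] by (simp add: Z_def A\<^sub>c\<^sub>l_mult)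
qed

lemma norm_F_power2_le: "(norm (F t))\<^sup>2 \<le> (norm (f t))\<^sup>2 / m\<^sub>R"
  unfolding F_def by (rule norm_mode_coords_power2_le)

section \<open>The quadratic form of the predictor and its integral over the delay window\<close>

lemma quad_Z_deriv:
  assumes "t \<ge> t\<^sub>0" "norm (f t) \<le> b"
  shows "\<exists>y. ((\<lambda>s. quad (Z s)) has_real_derivative y) (at t) \<and>
    y \<le> - (1 - \<beta>) * (norm (Z t))\<^sup>2 + (mnorm P)\<^sup>2 / \<beta> * (b\<^sup>2 / m\<^sub>R)"
proof (intro exI conjI)
  show "((\<lambda>s. quad (Z s)) has_real_derivative 2 * inner (P *v Z t) (A\<^sub>c\<^sub>l *v Z t + F t)) (at t)"
    by (rule quad_has_real_derivative[OF Z_deriv[OF assms(1)]])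
  have "(norm (f t))\<^sup>2 \<le> b\<^sup>2" using assms(2) by (intro power_mono) auto
  then have "(norm (F t))\<^sup>2 \<le> b\<^sup>2 / m\<^sub>R"
    using norm_F_power2_le[of t] m\<^sub>R_pos by (meson divide_right_mono less_imp_le order_trans)
  then have "(mnorm P)\<^sup>2 / \<beta> * (norm (F t))\<^sup>2 \<le> (mnorm P)\<^sup>2 / \<beta> * (b\<^sup>2 / m\<^sub>R)"
    using \<beta> by (intro mult_left_mono) auto
  then show "2 * inner (P *v Z t) (A\<^sub>c\<^sub>l *v Z t + F t)
     \<le> - (1 - \<beta>) * (norm (Z t))\<^sup>2 + (mnorm P)\<^sup>2 / \<beta> * (b\<^sup>2 / m\<^sub>R)"
    using lyapunov_perturbed[of "Z t" "F t"] by linarith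
qed

text \<open>A primitive, so that the integral over the moving window \<open>[t - D, t]\<close> is a
  difference of two values and easily differentiated.\<close>

definition Q :: "real \<Rightarrow> real" where "Q t = integral {0..t} (\<lambda>s. quad (Z s))"

lemma quad_Z_cont: "continuous_on {0..} (\<lambda>s. quad (Z s))"
  by (intro continuous_intros Z_cont)

lemma Q_deriv_within: "t \<in> {0..r} \<Longrightarrow> (Q has_real_derivative quad (Z t)) (at t within {0..r})"
  unfolding Q_def
  by (auto simp: has_real_derivative_iff_has_vector_derivative
      intro!: integral_has_vector_derivative continuous_on_subset[OF quad_Z_cont])

lemma Q_deriv: "t > 0 \<Longrightarrow> (Q has_real_derivative quad (Z t)) (at t)"
  using Q_deriv_within[of t "t + 1"] by (simp add: at_within_Icc_at)

lemma Q_cont: "continuous_on {0..r} Q"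
  by (rule DERIV_continuous_on[OF Q_deriv_within])

lemma Q_diff: "0 \<le> a \<Longrightarrow> a \<le> t \<Longrightarrow> Q t - Q a = integral {a..t} (\<lambda>s. quad (Z s))"
  unfolding Q_def
  using Henstock_Kurzweil_Integration.integral_combine[of 0 a t "\<lambda>s. quad (Z s)"]
    integrable_continuous_real[OF continuous_on_subset[OF quad_Z_cont, of "{0..t}"]]
  by simp

lemma Q_mono: "0 \<le> a \<Longrightarrow> a \<le> t \<Longrightarrow> Q a \<le> Q t"
  using Q_diff[of a t] integral_nonneg[of "\<lambda>s. quad (Z s)" "{a..t}"]
    integrable_continuous_real[OF continuous_on_subset[OF quad_Z_cont, of "{a..t}"]] quad_nonneg
  by auto

text \<open>The increment is the derivative of the integral over the moving window. Integrating the
  decay inequality of \<open>quad (Z s)\<close> over that window turns it into decay of this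
  integral itself; the forcing picks up the factor \<open>D\<close> seen in
  \<open>C\<^sub>6\<close>. The window must lie beyond \<open>t\<^sub>0\<close>, hence
  \<open>t \<ge> D + t\<^sub>0\<close>.\<close>

lemma quad_Z_increment_le:
  assumes t: "t \<ge> D + t\<^sub>0" and b: "\<And>s. s \<in> {t - D..t} \<Longrightarrow> norm (f s) \<le> b"
  shows "quad (Z t) - quad (Z (t - D))
    \<le> - 2 * \<kappa>\<^sub>0 * (Q t - Q (t - D)) + D * ((mnorm P)\<^sup>2 / \<beta> * (b\<^sup>2 / m\<^sub>R))"
proof -
  define c where "c = (mnorm P)\<^sup>2 / \<beta> * (b\<^sup>2 / m\<^sub>R)"
  \<comment> \<open>Monotonicity of \<open>h\<close> is the integrated form of the inequality
    \<open>q' \<le> - 2 \<kappa>\<^sub>0 q + c\<close> for \<open>q = quad (Z s)\<close>.\<close>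
  define h where "h s = quad (Z s) + 2 * \<kappa>\<^sub>0 * Q s - c * s" for s
  have "h t \<le> h (t - D)"
  proof (rule le_if_deriv_nonpos[where f = h])
    have sub: "{t - D..t} \<subseteq> {0..}" "{t - D..t} \<subseteq> {0..t}" using t t0 by auto
    show "continuous_on {t - D..t} h"
      unfolding h_def by (intro continuous_intros continuous_on_subset[OF Z_cont sub(1)]
          continuous_on_subset[OF Q_cont sub(2)])
    fix s assume s: "t - D < s" "s < t"
    then have st: "s \<ge> t\<^sub>0" "s > 0" using t t0 by auto
    obtain y where y: "((\<lambda>s. quad (Z s)) has_real_derivative y) (at s)"
      "y \<le> - (1 - \<beta>) * (norm (Z s))\<^sup>2 + c"
      using quad_Z_deriv[OF st(1) b] s unfolding c_def by auto
    have "(h has_real_derivative y + 2 * \<kappa>\<^sub>0 * quad (Z s) - c) (at s)"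
      unfolding h_def using y(1) Q_deriv[OF st(2)] by (auto intro!: derivative_eq_intros)
    moreover have "2 * \<kappa>\<^sub>0 * quad (Z s) \<le> (1 - \<beta>) * (norm (Z s))\<^sup>2"
    proof -
      have "2 * \<kappa>\<^sub>0 * quad (Z s) \<le> 2 * \<kappa>\<^sub>0 * (lambda_max P * (norm (Z s))\<^sup>2)"
        using \<kappa>0_pos by (intro mult_left_mono quad_le) auto
      also have "\<dots> \<le> (1 - \<beta>) * (norm (Z s))\<^sup>2"
        unfolding mult.assoc[symmetric] by (intro mult_right_mono \<kappa>0_le(1)) simp
      finally show ?thesis .
    qed
    ultimately show "\<exists>y. (h has_real_derivative y) (at s) \<and> y \<le> 0"
      using y(2) by (intro exI conjI) (assumption, linarith)
  qed (use D in simp)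
  then show ?thesis unfolding h_def c_def[symmetric] by (simp add: algebra_simps)
qed

section \<open>Energy of the modes above \<open>N\<^sub>0\<close>\<close>

text \<open>For \<open>t \<ge> D + t\<^sub>0\<close> the boundary input at time \<open>t\<close> is \<open>u (t - D) = K Z (t - D)\<close>, so \<open>W\<close> is the
  homogenised state \<open>X - B u\<^sub>D\<close>.\<close>

definition W :: "real \<Rightarrow> 'h" where "W t = X t - B (K *v Z (t - D))"

lemma W_cont: "continuous_on {D..} W"
  unfolding W_def using D
  by (intro continuous_intros continuous_on_subset[OF X_cont] bounded_linear.continuous_on[OF bounded_linear_BK]
      continuous_on_compose2[OF Z_cont, where f = "\<lambda>t. t - D"]) auto

text \<open>In the modes of \<open>X\<close> the input is multiplied by \<open>lam n\<close>, which
  may be unbounded in \<open>n\<close>. In those of \<open>W\<close> the eigenvalue acts on the mode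
  only, and what remains is bounded: the image of the lifting under \<open>\<A>\<close>, the
  forcing, and the time derivative of \<open>B K Z (t - D)\<close>, split into its closed-loop and
  its forced part.\<close>

lemma mode_energy_deriv:
  assumes t: "t \<ge> D + t\<^sub>0" and n: "n \<ge> N\<^sub>0 + 1"
  shows "\<exists>y. ((\<lambda>s. (norm (ip (W s) (\<psi> n)))\<^sup>2 / 2) has_real_derivative y) (at t) \<and>
    y \<le> - (\<alpha> / 2) * (norm (ip (W t) (\<psi> n)))\<^sup>2
       + 2 / \<alpha> * ((norm (ip (\<A> (B (K *v Z (t - D)))) (\<psi> n)))\<^sup>2 + (norm (ip (f t) (\<psi> n)))\<^sup>2
          + (norm (ip (B (K *v (A\<^sub>c\<^sub>l *v Z (t - D)))) (\<psi> n)))\<^sup>2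
          + (norm (ip (B (K *v F (t - D))) (\<psi> n)))\<^sup>2)"
proof -
  define z where "z = Z (t - D)"
  define a where "a = ip (W t) (\<psi> n)"
  define p where "p = ip (\<A> (B (K *v z))) (\<psi> n)"
  define q where "q = ip (f t) (\<psi> n)"
  define r where "r = ip (B (K *v (A\<^sub>c\<^sub>l *v z))) (\<psi> n)"
  define w where "w = ip (B (K *v F (t - D))) (\<psi> n)"
  have t': "t > 0" "t - D \<ge> t\<^sub>0" using t D t0 by auto
  have shift: "((\<lambda>s. s - D) has_vector_derivative 1) (at t)"
    by (auto intro!: derivative_eq_intros)
  have "((\<lambda>s. Z (s - D)) has_vector_derivative A\<^sub>c\<^sub>l *v z + F (t - D)) (at t)"
    using vector_diff_chain_at[OF shift Z_deriv[OF t'(2)]] by (simp add: o_def z_def)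
  then have "((\<lambda>s. B (K *v Z (s - D))) has_vector_derivative B (K *v (A\<^sub>c\<^sub>l *v z + F (t - D)))) (at t)"
    by (rule bounded_linear.has_vector_derivative[OF bounded_linear_BK])
  then have "(W has_vector_derivative (\<A> (X t) + f t) - B (K *v (A\<^sub>c\<^sub>l *v z + F (t - D)))) (at t)"
    unfolding W_def by (intro has_vector_derivative_diff X_deriv_at t')
  then have "((\<lambda>s. ip (W s) (\<psi> n)) has_vector_derivative
      ip ((\<A> (X t) + f t) - B (K *v (A\<^sub>c\<^sub>l *v z + F (t - D)))) (\<psi> n)) (at t)"
    by (rule bounded_linear.has_vector_derivative[OF bounded_linear_ip])
  moreover have "ip ((\<A> (X t) + f t) - B (K *v (A\<^sub>c\<^sub>l *v z + F (t - D)))) (\<psi> n) = lam n * a + (p + q - r - w)"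
  proof -
    have "\<B> (X t) = K *v z" using boundary[of t] u_eq_K[OF t'(2)] t' by (simp add: z_def)
    then have "ip (\<A> (X t)) (\<psi> n) = lam n * a + p"
      using ip_\<A>[OF X_dom, of t n] t' n by (simp add: a_def W_def z_def p_def)
    then show ?thesis
      using linear_add[OF bounded_linear.linear[OF bounded_linear_BK]]
      by (simp add: ip_add_left ip_diff_left q_def r_def w_def)
  qed
  ultimately have d: "((\<lambda>s. ip (W s) (\<psi> n)) has_vector_derivative lam n * a + (p + q - r - w)) (at t)"
    by simp
  have "((\<lambda>s. inner (ip (W s) (\<psi> n)) (ip (W s) (\<psi> n))) has_vector_derivative
      inner a (lam n * a + (p + q - r - w)) + inner (lam n * a + (p + q - r - w)) a) (at t)"
    using bounded_bilinear.has_vector_derivative[OF bounded_bilinear_inner d d] by (simp add: a_def)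
  then have "((\<lambda>s. (norm (ip (W s) (\<psi> n)))\<^sup>2) has_real_derivative
      2 * inner a (lam n * a + (p + q - r - w))) (at t)"
    by (simp add: has_real_derivative_iff_has_vector_derivative power2_norm_eq_inner inner_commute)
  from DERIV_cdivide[OF this, of 2]
  have deriv: "((\<lambda>s. (norm (ip (W s) (\<psi> n)))\<^sup>2 / 2) has_real_derivative
      inner a (lam n * a + (p + q - r - w))) (at t)"
    by simp
  have "inner a (lam n * a) \<le> - \<alpha> * (norm a)\<^sup>2"
    unfolding inner_mult_self using A2 n by (intro mult_right_mono) auto
  \<comment> \<open>Four applications cost \<open>4 * \<alpha> / 8\<close>, half of the dissipation
    rate, and produce the factor \<open>2 / \<alpha>\<close>.\<close>
  moreover have "inner a x \<le> \<alpha> / 8 * (norm a)\<^sup>2 + 2 / \<alpha> * (norm x)\<^sup>2" for x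
  proof -
    have "inner a x \<le> norm a * norm x" by (rule norm_cauchy_schwarz)
    also have "\<dots> \<le> \<alpha> / 8 * (norm a)\<^sup>2 + (norm x)\<^sup>2 / (4 * (\<alpha> / 8))"
      using \<alpha> by (intro mult_le_weighted_squares) simp
    finally show ?thesis by simp
  qed
  from this[of p] this[of q] this[of "- r"] this[of "- w"]
  have "inner a (p + q - r - w) \<le> \<alpha> / 2 * (norm a)\<^sup>2
      + 2 / \<alpha> * ((norm p)\<^sup>2 + (norm q)\<^sup>2 + (norm r)\<^sup>2 + (norm w)\<^sup>2)"
    by (simp add: inner_add_right inner_diff_right distrib_left)
  ultimately have "inner a (lam n * a + (p + q - r - w)) \<le> - (\<alpha> / 2) * (norm a)\<^sup>2
      + 2 / \<alpha> * ((norm p)\<^sup>2 + (norm q)\<^sup>2 + (norm r)\<^sup>2 + (norm w)\<^sup>2)"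
    unfolding inner_add_right[of a "lam n * a"] by linarith
  with deriv show ?thesis
    unfolding a_def p_def q_def r_def w_def z_def by blast
qed

definition tail_energy :: "nat \<Rightarrow> real \<Rightarrow> real" where
  "tail_energy N t = (\<Sum>n\<in>{N\<^sub>0 + 1..N}. (norm (ip (W t) (\<psi> n)))\<^sup>2 / 2)"

text \<open>Bessel's inequality bounds each sum over modes by a norm, so the estimate does not
  depend on \<open>N\<close>. Since \<open>F (t - D)\<close> occurs besides \<open>f t\<close>,
  \<open>f\<close> has to be bounded at both ends of the delay window.\<close>

lemma tail_energy_deriv:
  assumes t: "t \<ge> D + t\<^sub>0" and b: "\<And>s. s \<in> {t - D..t} \<Longrightarrow> norm (f s) \<le> b"
  shows "\<exists>y. (tail_energy N has_real_derivative y) (at t) \<and>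
    y \<le> - \<alpha> * tail_energy N t + C\<^sub>5 * (norm (Z (t - D)))\<^sup>2 + 2 * (m\<^sub>R + nBK\<^sup>2) / (\<alpha> * m\<^sub>R) * (b\<^sup>2 / m\<^sub>R)"
proof -
  let ?I = "{N\<^sub>0 + 1..N}"
  let ?z = "Z (t - D)"
  define S where "S x = (\<Sum>n\<in>?I. (norm (ip x (\<psi> n)))\<^sup>2)" for x
  define rhs where "rhs n = - (\<alpha> / 2) * (norm (ip (W t) (\<psi> n)))\<^sup>2
       + 2 / \<alpha> * ((norm (ip (\<A> (B (K *v ?z))) (\<psi> n)))\<^sup>2 + (norm (ip (f t) (\<psi> n)))\<^sup>2
          + (norm (ip (B (K *v (A\<^sub>c\<^sub>l *v ?z))) (\<psi> n)))\<^sup>2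
          + (norm (ip (B (K *v F (t - D))) (\<psi> n)))\<^sup>2)" for n
  have S: "S x \<le> (norm x)\<^sup>2 / m\<^sub>R" for x
    unfolding S_def by (rule bessel) auto
  have "\<forall>n\<in>?I. \<exists>y. ((\<lambda>s. (norm (ip (W s) (\<psi> n)))\<^sup>2 / 2) has_real_derivative y) (at t) \<and> y \<le> rhs n"
    unfolding rhs_def using mode_energy_deriv[OF t] by simp
  then obtain y where y: "\<And>n. n \<in> ?I \<Longrightarrow>
      ((\<lambda>s. (norm (ip (W s) (\<psi> n)))\<^sup>2 / 2) has_real_derivative y n) (at t)"
      "\<And>n. n \<in> ?I \<Longrightarrow> y n \<le> rhs n"
    by metis
  have "(tail_energy N has_real_derivative (\<Sum>n\<in>?I. y n)) (at t)"
    unfolding tail_energy_def by (intro DERIV_sum y)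
  moreover have "(\<Sum>n\<in>?I. y n) \<le> (\<Sum>n\<in>?I. rhs n)" by (intro sum_mono y)
  moreover have "(\<Sum>n\<in>?I. rhs n) = - \<alpha> * tail_energy N t
      + 2 / \<alpha> * (S (\<A> (B (K *v ?z))) + S (f t) + S (B (K *v (A\<^sub>c\<^sub>l *v ?z))) + S (B (K *v F (t - D))))"
    unfolding rhs_def S_def tail_energy_def sum.distrib sum_distrib_left[symmetric]
    by (simp add: sum_distrib_left)
  moreover have "2 / \<alpha> * (S (\<A> (B (K *v ?z))) + S (f t) + S (B (K *v (A\<^sub>c\<^sub>l *v ?z))) + S (B (K *v F (t - D))))
     \<le> 2 / \<alpha> * ((norm (\<A> (B (K *v ?z))))\<^sup>2 / m\<^sub>R + b\<^sup>2 / m\<^sub>R + (norm (B (K *v (A\<^sub>c\<^sub>l *v ?z))))\<^sup>2 / m\<^sub>R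
        + nBK\<^sup>2 * (b\<^sup>2 / m\<^sub>R) / m\<^sub>R)"
  proof (intro mult_left_mono add_mono S)
    have fb: "(norm (f s))\<^sup>2 \<le> b\<^sup>2" if "s \<in> {t - D..t}" for s using b[OF that] by (intro power_mono) auto
    show "S (f t) \<le> b\<^sup>2 / m\<^sub>R"
      using S[of "f t"] fb[of t] D m\<^sub>R_pos by (smt (verit) atLeastAtMost_iff divide_right_mono)
    have "(norm (F (t - D)))\<^sup>2 \<le> b\<^sup>2 / m\<^sub>R"
      using norm_F_power2_le[of "t - D"] fb[of "t - D"] D m\<^sub>R_pos
      by (smt (verit) atLeastAtMost_iff divide_right_mono)
    then have "(norm (B (K *v F (t - D))))\<^sup>2 \<le> nBK\<^sup>2 * (b\<^sup>2 / m\<^sub>R)"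
      using norm_BK_power2_le[of "F (t - D)"] by (meson mult_left_mono order_trans zero_le_power2)
    then show "S (B (K *v F (t - D))) \<le> nBK\<^sup>2 * (b\<^sup>2 / m\<^sub>R) / m\<^sub>R"
      using S[of "B (K *v F (t - D))"] m\<^sub>R_pos by (meson divide_right_mono less_imp_le order_trans)
  qed (use \<alpha> in simp)
  moreover have "2 / \<alpha> * ((norm (\<A> (B (K *v ?z))))\<^sup>2 / m\<^sub>R + b\<^sup>2 / m\<^sub>R + (norm (B (K *v (A\<^sub>c\<^sub>l *v ?z))))\<^sup>2 / m\<^sub>R
        + nBK\<^sup>2 * (b\<^sup>2 / m\<^sub>R) / m\<^sub>R)
     \<le> C\<^sub>5 * (norm ?z)\<^sup>2 + 2 * (m\<^sub>R + nBK\<^sup>2) / (\<alpha> * m\<^sub>R) * (b\<^sup>2 / m\<^sub>R)"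
  proof -
    have "2 / \<alpha> * (b\<^sup>2 / m\<^sub>R) + 2 / \<alpha> * (nBK\<^sup>2 * (b\<^sup>2 / m\<^sub>R) / m\<^sub>R)
        = 2 * (m\<^sub>R + nBK\<^sup>2) / (\<alpha> * m\<^sub>R) * (b\<^sup>2 / m\<^sub>R)"
      using m\<^sub>R_pos \<alpha> by (simp add: field_simps)
    then show ?thesis using norm_AB_power2_le[of ?z] unfolding distrib_left by linarith
  qed
  ultimately show ?thesis by (intro exI[of _ "\<Sum>n\<in>?I. y n"] conjI) linarith+
qed

text \<open>The bracket with \<open>\<gamma>\<^sub>1\<close> bounds the low modes of the state; the
  term with \<open>\<gamma>\<^sub>2\<close> absorbs the cost \<open>C\<^sub>5\<close> of the input
  in the tail and also bounds \<open>B K Z (t - D)\<close>; the tail supplies the high modes of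
  \<open>W\<close> up to \<open>N\<close>.\<close>

definition V :: "nat \<Rightarrow> real \<Rightarrow> real" where
  "V N t = \<gamma>\<^sub>1 * (quad (Z t) + (Q t - Q (t - D))) + \<gamma>\<^sub>2 * quad (Z (t - D)) + tail_energy N t"

lemma V_deriv:
  assumes t: "t \<ge> D + t\<^sub>0" and b: "\<And>s. s \<in> {t - D..t} \<Longrightarrow> norm (f s) \<le> b"
  shows "\<exists>y. (V N has_real_derivative y) (at t) \<and> y \<le> - 2 * \<kappa>\<^sub>0 * V N t + C\<^sub>6 * b\<^sup>2"
proof -
  define c where "c = (mnorm P)\<^sup>2 / \<beta> * (b\<^sup>2 / m\<^sub>R)"
  have t': "t \<ge> t\<^sub>0" "t > 0" "t - D \<ge> t\<^sub>0" "t - D > 0" using t D t0 by auto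
  obtain y1 where y1: "((\<lambda>s. quad (Z s)) has_real_derivative y1) (at t)"
    "y1 \<le> - (1 - \<beta>) * (norm (Z t))\<^sup>2 + c"
    using quad_Z_deriv[OF t'(1) b] D unfolding c_def by auto
  obtain y2 where y2: "((\<lambda>s. quad (Z s)) has_real_derivative y2) (at (t - D))"
    "y2 \<le> - (1 - \<beta>) * (norm (Z (t - D)))\<^sup>2 + c"
    using quad_Z_deriv[OF t'(3) b] D unfolding c_def by auto
  obtain y3 where y3: "(tail_energy N has_real_derivative y3) (at t)"
    "y3 \<le> - \<alpha> * tail_energy N t + C\<^sub>5 * (norm (Z (t - D)))\<^sup>2 + 2 * (m\<^sub>R + nBK\<^sup>2) / (\<alpha> * m\<^sub>R) * (b\<^sup>2 / m\<^sub>R)"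
    using tail_energy_deriv[OF t b] by blast
  have y2': "((\<lambda>s. quad (Z (s - D))) has_real_derivative y2) (at t)"
    using y2(1) by (simp add: DERIV_shift[of _ _ t "- D", simplified])
  have q2: "((\<lambda>s. Q (s - D)) has_real_derivative quad (Z (t - D))) (at t)"
    using Q_deriv[OF t'(4)] by (simp add: DERIV_shift[of _ _ t "- D", simplified])
  have deriv: "(V N has_real_derivative
      \<gamma>\<^sub>1 * (y1 + (quad (Z t) - quad (Z (t - D)))) + \<gamma>\<^sub>2 * y2 + y3) (at t)"
    unfolding V_def by (intro DERIV_add DERIV_cmult DERIV_diff y1 y2' y3 q2 Q_deriv t')
  have "y1 \<le> - 2 * \<kappa>\<^sub>0 * quad (Z t) + c"
  proof -
    have "2 * \<kappa>\<^sub>0 * quad (Z t) \<le> 2 * \<kappa>\<^sub>0 * (lambda_max P * (norm (Z t))\<^sup>2)"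
      using \<kappa>0_pos by (intro mult_left_mono quad_le) auto
    also have "\<dots> \<le> (1 - \<beta>) * (norm (Z t))\<^sup>2"
      unfolding mult.assoc[symmetric] by (intro mult_right_mono \<kappa>0_le(1)) simp
    finally show ?thesis using y1(2) by linarith
  qed
  moreover have "quad (Z t) - quad (Z (t - D)) \<le> - 2 * \<kappa>\<^sub>0 * (Q t - Q (t - D)) + D * c"
    unfolding c_def by (rule quad_Z_increment_le[OF t b])
  ultimately have "\<gamma>\<^sub>1 * (y1 + (quad (Z t) - quad (Z (t - D))))
      \<le> \<gamma>\<^sub>1 * ((- 2 * \<kappa>\<^sub>0 * quad (Z t) + c) + (- 2 * \<kappa>\<^sub>0 * (Q t - Q (t - D)) + D * c))"
    using \<gamma>1_pos by (intro mult_left_mono add_mono) auto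
  then have 1: "\<gamma>\<^sub>1 * (y1 + (quad (Z t) - quad (Z (t - D))))
      \<le> - 2 * \<kappa>\<^sub>0 * (\<gamma>\<^sub>1 * (quad (Z t) + (Q t - Q (t - D)))) + \<gamma>\<^sub>1 * (1 + D) * c"
    by (simp add: algebra_simps)
  have "\<gamma>\<^sub>2 * y2 \<le> \<gamma>\<^sub>2 * (- (1 - \<beta>) * (norm (Z (t - D)))\<^sup>2 + c)"
    using \<gamma>2_pos y2(2) by (intro mult_left_mono) auto
  moreover have "2 * \<kappa>\<^sub>0 * (\<gamma>\<^sub>2 * quad (Z (t - D))) \<le> ((1 - \<beta>) * \<gamma>\<^sub>2 - C\<^sub>5) * (norm (Z (t - D)))\<^sup>2"
  proof -
    have "2 * \<kappa>\<^sub>0 * (\<gamma>\<^sub>2 * quad (Z (t - D))) \<le> 2 * \<kappa>\<^sub>0 * (\<gamma>\<^sub>2 * (lambda_max P * (norm (Z (t - D)))\<^sup>2))"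
      using \<kappa>0_pos \<gamma>2_pos by (intro mult_left_mono quad_le) auto
    also have "\<dots> = 2 * \<kappa>\<^sub>0 * lambda_max P * \<gamma>\<^sub>2 * (norm (Z (t - D)))\<^sup>2" by simp
    also have "\<dots> \<le> ((1 - \<beta>) * \<gamma>\<^sub>2 - C\<^sub>5) * (norm (Z (t - D)))\<^sup>2"
      by (intro mult_right_mono \<kappa>0_le(2)) simp
    finally show ?thesis .
  qed
  \<comment> \<open>The \<open>C\<^sub>5\<close> term of the tail is paid by the decay of the
    delayed form; this is the second entry of the minimum in
    \<open>\<kappa>\<^sub>0\<close>.\<close>
  ultimately have 2: "\<gamma>\<^sub>2 * y2 + C\<^sub>5 * (norm (Z (t - D)))\<^sup>2 \<le> - 2 * \<kappa>\<^sub>0 * (\<gamma>\<^sub>2 * quad (Z (t - D))) + \<gamma>\<^sub>2 * c"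
    by (simp add: algebra_simps)
  have 3: "- \<alpha> * tail_energy N t \<le> - 2 * \<kappa>\<^sub>0 * tail_energy N t"
  proof -
    have "tail_energy N t \<ge> 0" unfolding tail_energy_def by (intro sum_nonneg) simp
    then have "2 * \<kappa>\<^sub>0 * tail_energy N t \<le> \<alpha> * tail_energy N t"
      using \<kappa>0_le(3) \<alpha> by (intro mult_right_mono) auto
    then show ?thesis by simp
  qed
  \<comment> \<open>Origin of \<open>C\<^sub>6\<close>: \<open>\<gamma>\<^sub>1 (1 + D)\<close> from
    the form at \<open>t\<close> and the moving window, \<open>\<gamma>\<^sub>2\<close> from the
    delayed form, the remaining summand from the tail.\<close>
  have "\<gamma>\<^sub>1 * (1 + D) * c + \<gamma>\<^sub>2 * c + 2 * (m\<^sub>R + nBK\<^sup>2) / (\<alpha> * m\<^sub>R) * (b\<^sup>2 / m\<^sub>R) = C\<^sub>6 * b\<^sup>2"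
    unfolding C6 c_def by (simp add: algebra_simps add_divide_distrib)
  with 1 2 3 y3(2) have "\<gamma>\<^sub>1 * (y1 + (quad (Z t) - quad (Z (t - D)))) + \<gamma>\<^sub>2 * y2 + y3
      \<le> - 2 * \<kappa>\<^sub>0 * V N t + C\<^sub>6 * b\<^sup>2"
    unfolding V_def distrib_left[of "- 2 * \<kappa>\<^sub>0"] by linarith
  with deriv show ?thesis by blast
qed

lemma V_cont: "continuous_on {D + t\<^sub>0..r} (V N)"
  unfolding V_def tail_energy_def using D t0
  by (intro continuous_intros continuous_on_subset[OF Z_cont] continuous_on_subset[OF W_cont]
      continuous_on_subset[OF Q_cont[of r]] continuous_on_compose2[OF Z_cont, where f = "\<lambda>t. t - D"]
      continuous_on_compose2[OF Q_cont[of r], where f = "\<lambda>t. t - D"]) auto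

text \<open>Through the delay window, forcing of size \<open>exp (- \<delta> s) \<Phi>\<close> is
  amplified by at most \<open>exp (\<delta> D)\<close>. Decay at rate
  \<open>2 \<kappa>\<^sub>0\<close> against a source decaying at rate \<open>2 \<delta>\<close>
  yields \<open>1 / (2 (\<kappa>\<^sub>0 - \<delta>))\<close>, which tends to the constant of the
  small gain condition.\<close>

lemma V_decay:
  assumes \<delta>: "0 < \<delta>" "\<delta> < \<kappa>\<^sub>0" and t: "t \<ge> D + t\<^sub>0"
    and \<Phi>: "\<And>s. s \<in> {0..t} \<Longrightarrow> exp (\<delta> * s) * norm (f s) \<le> \<Phi>"
  shows "exp (2 * \<delta> * t) * V N t
    \<le> exp (2 * \<delta> * (D + t\<^sub>0)) * V N (D + t\<^sub>0) + C\<^sub>6 * exp (2 * \<delta> * D) * \<Phi>\<^sup>2 / (2 * (\<kappa>\<^sub>0 - \<delta>))"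
proof -
  define t1 where "t1 = D + t\<^sub>0"
  define e where "e = 2 * (\<kappa>\<^sub>0 - \<delta>)"
  define c where "c = C\<^sub>6 * exp (2 * \<delta> * D) * \<Phi>\<^sup>2 / e"
  \<comment> \<open>After multiplication by \<open>exp (2 \<kappa>\<^sub>0 s)\<close> the source is
    at most \<open>c e exp (e s)\<close>; subtracting its primitive makes \<open>h\<close>
    nonincreasing.\<close>
  define h where "h s = exp (2 * \<kappa>\<^sub>0 * s) * V N s - c * exp (e * s)" for s
  have e: "e > 0" using \<delta> by (simp add: e_def)
  have c: "c \<ge> 0" unfolding c_def using C6_nonneg e by simp
  have "h t \<le> h t1"
  proof (rule le_if_deriv_nonpos[where f = h])
    show "continuous_on {t1..t} h"
      unfolding h_def t1_def by (intro continuous_intros V_cont)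
    fix s assume s: "t1 < s" "s < t"
    have "norm (f r) \<le> exp (- \<delta> * (s - D)) * \<Phi>" if r: "r \<in> {s - D..s}" for r
    proof -
      have r': "r \<in> {0..t}" using r s D t0 by (auto simp: t1_def)
      have "norm (f r) = exp (- \<delta> * r) * (exp (\<delta> * r) * norm (f r))"
        by (simp flip: mult.assoc exp_add)
      also have "\<dots> \<le> exp (- \<delta> * r) * \<Phi>" by (intro mult_left_mono \<Phi>[OF r']) simp
      also have "\<dots> \<le> exp (- \<delta> * (s - D)) * \<Phi>"
      proof (rule mult_right_mono)
        show "exp (- \<delta> * r) \<le> exp (- \<delta> * (s - D))" using r \<delta> by simp
        show "0 \<le> \<Phi>" using \<Phi>[OF r'] by (rule order_trans[rotated]) simp
      qed
      finally show ?thesis .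
    qed
    then obtain y where y: "(V N has_real_derivative y) (at s)"
      "y \<le> - 2 * \<kappa>\<^sub>0 * V N s + C\<^sub>6 * (exp (- \<delta> * (s - D)) * \<Phi>)\<^sup>2"
      using V_deriv[of s "exp (- \<delta> * (s - D)) * \<Phi>" N] s unfolding t1_def by auto
    have "(h has_real_derivative (exp (2 * \<kappa>\<^sub>0 * s) * (2 * \<kappa>\<^sub>0 * V N s + y) - c * (e * exp (e * s)))) (at s)"
      unfolding h_def by (auto intro!: derivative_eq_intros y(1) simp: algebra_simps)
    moreover have "exp (2 * \<kappa>\<^sub>0 * s) * (2 * \<kappa>\<^sub>0 * V N s + y) \<le> c * (e * exp (e * s))"
    proof -
      have "exp (2 * \<kappa>\<^sub>0 * s) * (2 * \<kappa>\<^sub>0 * V N s + y)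
          \<le> exp (2 * \<kappa>\<^sub>0 * s) * (C\<^sub>6 * (exp (- \<delta> * (s - D)) * \<Phi>)\<^sup>2)"
        using y(2) by (intro mult_left_mono) auto
      also have "\<dots> = C\<^sub>6 * \<Phi>\<^sup>2 * (exp (2 * \<kappa>\<^sub>0 * s) * (exp (- \<delta> * (s - D)))\<^sup>2)"
        by (simp add: power_mult_distrib)
      also have "exp (2 * \<kappa>\<^sub>0 * s) * (exp (- \<delta> * (s - D)))\<^sup>2 = exp (2 * \<delta> * D) * exp (e * s)"
        unfolding power2_eq_square exp_add[symmetric] by (simp add: e_def algebra_simps)
      finally show ?thesis using e by (simp add: c_def mult_ac)
    qed
    ultimately show "\<exists>y. (h has_real_derivative y) (at s) \<and> y \<le> 0"
      by (intro exI conjI) (assumption, simp)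
  qed (use t in \<open>simp add: t1_def\<close>)
  moreover have "h t1 \<le> exp (2 * \<kappa>\<^sub>0 * t1) * V N t1" using c by (simp add: h_def)
  ultimately have "exp (2 * \<kappa>\<^sub>0 * t) * V N t \<le> exp (2 * \<kappa>\<^sub>0 * t1) * V N t1 + c * exp (e * t)"
    by (simp add: h_def)
  then have "exp (- e * t) * (exp (2 * \<kappa>\<^sub>0 * t) * V N t)
      \<le> exp (- e * t) * (exp (2 * \<kappa>\<^sub>0 * t1) * V N t1 + c * exp (e * t))"
    by (intro mult_left_mono) auto
  moreover have "exp (- e * t) * (exp (2 * \<kappa>\<^sub>0 * t) * V N t) = exp (2 * \<delta> * t) * V N t"
    unfolding mult.assoc[symmetric] exp_add[symmetric] by (simp add: e_def algebra_simps)
  moreover have "exp (- e * t) * (exp (2 * \<kappa>\<^sub>0 * t1) * V N t1 + c * exp (e * t))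
      = exp (2 * \<kappa>\<^sub>0 * t1 - e * t) * V N t1 + c"
    by (simp add: distrib_left mult.left_commute flip: mult.assoc exp_add)
  moreover have "exp (2 * \<kappa>\<^sub>0 * t1 - e * t) * V N t1 \<le> exp (2 * \<delta> * t1) * V N t1"
  proof (rule mult_right_mono)
    have "e * t1 \<le> e * t" using e t by (intro mult_left_mono) (auto simp: t1_def)
    then show "exp (2 * \<kappa>\<^sub>0 * t1 - e * t) \<le> exp (2 * \<delta> * t1)"
      by (simp add: e_def algebra_simps)
    show "0 \<le> V N t1"
      unfolding V_def using quad_nonneg \<gamma>1_pos \<gamma>2_pos Q_mono[of "t1 - D" t1] D t0
      by (intro add_nonneg_nonneg mult_nonneg_nonneg) (auto simp: t1_def tail_energy_def intro!: sum_nonneg)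
  qed
  ultimately have "exp (2 * \<delta> * t) * V N t \<le> exp (2 * \<delta> * t1) * V N t1 + c" by linarith
  then show ?thesis unfolding c_def e_def t1_def .
qed

text \<open>\<open>Y\<close> is recovered from \<open>Z\<close> by removing the predictor integral,
  in which \<open>u = K Z\<close> because the window does not reach below \<open>t\<^sub>0\<close>.
  Cauchy-Schwarz on a window of length \<open>D\<close> and the square of a two-term sum give the
  shape of \<open>C\<^sub>1\<close>.\<close>

lemma norm_Y_power2_le:
  assumes t: "t \<ge> D + t\<^sub>0"
  shows "(norm (Y t))\<^sup>2 \<le> C\<^sub>1 * ((norm (Z t))\<^sup>2 + integral {t - D..t} (\<lambda>s. (norm (Z s))\<^sup>2))"
proof -
  define J where "J = integral {t - D..t} (\<lambda>s. (norm (Z s))\<^sup>2)"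
  have sub: "{t - D..t} \<subseteq> {0..}" using t t0 by auto
  have t': "t \<ge> 0" "max (t - D) 0 = t - D" using t D t0 by auto
  have contZ: "continuous_on {t - D..t} (\<lambda>s. norm (Z s))"
    by (intro continuous_intros continuous_on_subset[OF Z_cont sub])
  have "norm (Z t - Y t) \<le> exp (D * mnorm A\<^sub>N) * integral {t - D..t} (\<lambda>s. norm (B\<^sub>N *v u s))"
    using norm_predictor_integral_le[OF D AN u_cont u_zero t'(1)]
    by (simp add: Z_def predictor_def t'(2))
  also have "\<dots> \<le> exp (D * mnorm A\<^sub>N) * (mnorm (B\<^sub>N ** K) * integral {t - D..t} (\<lambda>s. norm (Z s)))"
  proof (intro mult_left_mono)
    have "integral {t - D..t} (\<lambda>s. norm (B\<^sub>N *v u s)) \<le> integral {t - D..t} (\<lambda>s. mnorm (B\<^sub>N ** K) * norm (Z s))"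
    proof (rule integral_le)
      show "(\<lambda>s. norm (B\<^sub>N *v u s)) integrable_on {t - D..t}" using D t t0
        by (intro integrable_continuous_real continuous_intros continuous_on_subset[OF u_cont]
            bounded_linear.continuous_on[OF matrix_vector_mul_bounded_linear]) auto
      show "(\<lambda>s. mnorm (B\<^sub>N ** K) * norm (Z s)) integrable_on {t - D..t}"
        by (intro integrable_continuous_real continuous_intros contZ)
      show "norm (B\<^sub>N *v u s) \<le> mnorm (B\<^sub>N ** K) * norm (Z s)" if "s \<in> {t - D..t}" for s
        using norm_matrix_vector_mult_le[of "B\<^sub>N ** K" "Z s"] u_eq_K[of s] that t
        by (simp add: matrix_vector_mul_assoc)
    qed
    then show "integral {t - D..t} (\<lambda>s. norm (B\<^sub>N *v u s)) \<le> mnorm (B\<^sub>N ** K) * integral {t - D..t} (\<lambda>s. norm (Z s))"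
      by simp
  qed simp
  finally have "(norm (Z t - Y t))\<^sup>2
      \<le> (exp (D * mnorm A\<^sub>N) * (mnorm (B\<^sub>N ** K) * integral {t - D..t} (\<lambda>s. norm (Z s))))\<^sup>2"
    by (intro power_mono) auto
  also have "\<dots> = (exp (D * mnorm A\<^sub>N))\<^sup>2 * (mnorm (B\<^sub>N ** K))\<^sup>2 * (integral {t - D..t} (\<lambda>s. norm (Z s)))\<^sup>2"
    by (simp add: power_mult_distrib mult.assoc)
  also have "\<dots> \<le> (exp (D * mnorm A\<^sub>N))\<^sup>2 * (mnorm (B\<^sub>N ** K))\<^sup>2 * (D * J)"
    using integral_power2_le[OF _ contZ] D unfolding J_def by (intro mult_left_mono) auto
  also have "(exp (D * mnorm A\<^sub>N))\<^sup>2 = exp (2 * D * mnorm A\<^sub>N)"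
    unfolding power2_eq_square exp_add[symmetric] by simp
  finally have diff: "(norm (Z t - Y t))\<^sup>2 \<le> D * exp (2 * D * mnorm A\<^sub>N) * (mnorm (B\<^sub>N ** K))\<^sup>2 * J"
    by (simp add: mult_ac)
  have J: "J \<ge> 0" unfolding J_def
    by (intro integral_nonneg integrable_continuous_real continuous_intros contZ) auto
  have "norm (Y t) \<le> norm (Z t) + norm (Z t - Y t)"
    using norm_triangle_ineq4[of "Z t" "Z t - Y t"] by simp
  then have "(norm (Y t))\<^sup>2 \<le> (norm (Z t) + norm (Z t - Y t))\<^sup>2" by (intro power_mono) auto
  also have "\<dots> \<le> 2 * (norm (Z t))\<^sup>2 + 2 * (norm (Z t - Y t))\<^sup>2"
    by (rule power2_sum_le)
  also have "\<dots> \<le> C\<^sub>1 * (norm (Z t))\<^sup>2 + C\<^sub>1 * J"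
  proof (rule add_mono)
    show "2 * (norm (Z t))\<^sup>2 \<le> C\<^sub>1 * (norm (Z t))\<^sup>2" by (intro mult_right_mono C1_ge(1)) simp
    have "2 * (norm (Z t - Y t))\<^sup>2 \<le> 2 * (D * exp (2 * D * mnorm A\<^sub>N) * (mnorm (B\<^sub>N ** K))\<^sup>2) * J"
      using diff by simp
    also have "\<dots> \<le> C\<^sub>1 * J" by (intro mult_right_mono C1_ge(2) J)
    finally show "2 * (norm (Z t - Y t))\<^sup>2 \<le> C\<^sub>1 * J" .
  qed
  finally show ?thesis by (simp add: J_def distrib_left)
qed

text \<open>The functional does not contain the modes of \<open>W\<close> up to
  \<open>N\<^sub>0\<close>. They are recovered from \<open>W = X - B K Z (t - D)\<close>: the modes
  of \<open>X\<close> form \<open>Y\<close>, controlled by the bracket with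
  \<open>\<gamma>\<^sub>1\<close>, and those of the lifted input cost
  \<open>nBK^2 / m\<^sub>R\<close>, which leaves \<open>C\<^sub>3\<close> of the delayed
  term.\<close>

lemma V_lower_bound:
  assumes t: "t \<ge> D + t\<^sub>0" and N: "N \<ge> N\<^sub>0"
  shows "C\<^sub>3 * (norm (Z (t - D)))\<^sup>2 + (\<Sum>n=1..N. (norm (ip (W t) (\<psi> n)))\<^sup>2 / 2) \<le> V N t"
proof -
  let ?z = "Z (t - D)"
  have sub: "{t - D..t} \<subseteq> {0..}" using t t0 by auto
  define J where "J = integral {t - D..t} (\<lambda>s. (norm (Z s))\<^sup>2)"
  have contZ: "continuous_on {t - D..t} (\<lambda>s. (norm (Z s))\<^sup>2)"
    by (intro continuous_intros continuous_on_subset[OF Z_cont sub])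
  have "lambda_min P * J \<le> Q t - Q (t - D)"
  proof -
    have "lambda_min P * J = integral {t - D..t} (\<lambda>s. lambda_min P * (norm (Z s))\<^sup>2)"
      by (simp add: J_def)
    also have "\<dots> \<le> integral {t - D..t} (\<lambda>s. quad (Z s))"
      by (intro integral_le integrable_continuous_real continuous_intros contZ quad_ge
          continuous_on_subset[OF quad_Z_cont sub])
    also have "\<dots> = Q t - Q (t - D)" using t t0 D by (intro Q_diff[symmetric]) auto
    finally show ?thesis .
  qed
  then have "lambda_min P * ((norm (Z t))\<^sup>2 + J) \<le> quad (Z t) + (Q t - Q (t - D))"
    using quad_ge[of "Z t"] by (simp add: distrib_left)
  then have "\<gamma>\<^sub>1 * (lambda_min P * ((norm (Z t))\<^sup>2 + J)) \<le> \<gamma>\<^sub>1 * (quad (Z t) + (Q t - Q (t - D)))"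
    using \<gamma>1_pos by (intro mult_left_mono) auto
  moreover have "C\<^sub>1 * ((norm (Z t))\<^sup>2 + J) \<le> \<gamma>\<^sub>1 * (lambda_min P * ((norm (Z t))\<^sup>2 + J))"
    unfolding mult.assoc[symmetric] J_def
    by (intro mult_right_mono \<gamma>1_ge add_nonneg_nonneg integral_nonneg integrable_continuous_real contZ) auto
  ultimately have Yle: "(norm (Y t))\<^sup>2 \<le> \<gamma>\<^sub>1 * (quad (Z t) + (Q t - Q (t - D)))"
    using norm_Y_power2_le[OF t] by (simp add: J_def)
  have "(\<Sum>n=1..N\<^sub>0. (norm (ip (W t) (\<psi> n)))\<^sup>2 / 2)
      \<le> (\<Sum>n=1..N\<^sub>0. (norm (ip (X t) (\<psi> n)))\<^sup>2 + (norm (ip (B (K *v ?z)) (\<psi> n)))\<^sup>2)"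
  proof (rule sum_mono)
    fix n
    have "norm (ip (W t) (\<psi> n)) \<le> norm (ip (X t) (\<psi> n)) + norm (ip (B (K *v ?z)) (\<psi> n))"
      unfolding W_def ip_diff_left by (rule norm_triangle_ineq4)
    then have "(norm (ip (W t) (\<psi> n)))\<^sup>2 \<le> (norm (ip (X t) (\<psi> n)) + norm (ip (B (K *v ?z)) (\<psi> n)))\<^sup>2"
      by (intro power_mono) auto
    also have "\<dots> \<le> 2 * (norm (ip (X t) (\<psi> n)))\<^sup>2 + 2 * (norm (ip (B (K *v ?z)) (\<psi> n)))\<^sup>2"
      by (rule power2_sum_le)
    finally show "(norm (ip (W t) (\<psi> n)))\<^sup>2 / 2 \<le> (norm (ip (X t) (\<psi> n)))\<^sup>2 + (norm (ip (B (K *v ?z)) (\<psi> n)))\<^sup>2"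
      by simp
  qed
  also have "\<dots> = (norm (Y t))\<^sup>2 + (\<Sum>n=1..N\<^sub>0. (norm (ip (B (K *v ?z)) (\<psi> n)))\<^sup>2)"
    unfolding sum.distrib Y_def norm_mode_coords_power2 ..
  also have "(\<Sum>n=1..N\<^sub>0. (norm (ip (B (K *v ?z)) (\<psi> n)))\<^sup>2) \<le> (norm (B (K *v ?z)))\<^sup>2 / m\<^sub>R"
    by (rule bessel) auto
  also have "\<dots> \<le> nBK\<^sup>2 * (norm ?z)\<^sup>2 / m\<^sub>R"
    using m\<^sub>R_pos by (intro divide_right_mono norm_BK_power2_le) auto
  finally have head: "(\<Sum>n=1..N\<^sub>0. (norm (ip (W t) (\<psi> n)))\<^sup>2 / 2) \<le> (norm (Y t))\<^sup>2 + nBK\<^sup>2 * (norm ?z)\<^sup>2 / m\<^sub>R"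
    by simp
  have "{1..N} = {1..N\<^sub>0} \<union> {N\<^sub>0 + 1..N}" using N by auto
  then have split: "(\<Sum>n=1..N. (norm (ip (W t) (\<psi> n)))\<^sup>2 / 2)
      = (\<Sum>n=1..N\<^sub>0. (norm (ip (W t) (\<psi> n)))\<^sup>2 / 2) + tail_energy N t"
    unfolding tail_energy_def by (simp add: sum.union_disjoint)
  have "\<gamma>\<^sub>2 * (lambda_min P * (norm ?z)\<^sup>2) \<le> \<gamma>\<^sub>2 * quad ?z"
    using \<gamma>2_pos by (intro mult_left_mono quad_ge) auto
  then have "C\<^sub>3 * (norm ?z)\<^sup>2 + nBK\<^sup>2 * (norm ?z)\<^sup>2 / m\<^sub>R \<le> \<gamma>\<^sub>2 * quad ?z"
    unfolding C3 by (simp add: algebra_simps)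
  then show ?thesis unfolding split V_def using head Yle by linarith
qed

lemma V_ge_Z:
  assumes t: "t \<ge> D + t\<^sub>0"
  shows "\<gamma>\<^sub>1 * lambda_min P * (norm (Z t))\<^sup>2 \<le> V N t"
proof -
  have "\<gamma>\<^sub>1 * (lambda_min P * (norm (Z t))\<^sup>2) \<le> \<gamma>\<^sub>1 * (quad (Z t) + (Q t - Q (t - D)))"
    using \<gamma>1_pos quad_ge[of "Z t"] Q_mono[of "t - D" t] t t0 D by (intro mult_left_mono) auto
  moreover have "\<gamma>\<^sub>2 * quad (Z (t - D)) \<ge> 0" using \<gamma>2_pos quad_nonneg by simp
  moreover have "tail_energy N t \<ge> 0" unfolding tail_energy_def by (intro sum_nonneg) simp
  ultimately show ?thesis unfolding V_def by simp
qed

text \<open>The bound on partial sums holds for all \<open>N\<close>, so the upper Riesz bound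
  applies to \<open>W\<close> although the functional is truncated. The two summands of
  \<open>C\<^sub>4\<close> belong to \<open>W\<close> and to the lifted input; the 2 undoes the
  factor 1/2 in the mode energies.\<close>

lemma state_bounds:
  assumes t: "t \<ge> D + t\<^sub>0" and "S \<ge> 0" and V: "\<And>N. N \<ge> N\<^sub>0 \<Longrightarrow> V N t \<le> S\<^sup>2"
  shows "norm (X t) \<le> C\<^sub>4 * S" and "norm (Z t) \<le> S / sqrt (\<gamma>\<^sub>1 * lambda_min P)"
proof -
  let ?z = "Z (t - D)"
  have low: "C\<^sub>3 * (norm ?z)\<^sup>2 + (\<Sum>n=1..N. (norm (ip (W t) (\<psi> n)))\<^sup>2 / 2) \<le> S\<^sup>2" if "N \<ge> N\<^sub>0" for N
    using V_lower_bound[OF t that] V[OF that] by linarith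
  have "C\<^sub>3 * (norm ?z)\<^sup>2 \<le> S\<^sup>2"
    using low[of N\<^sub>0] by (smt (verit) order_refl sum_nonneg zero_le_divide_iff zero_le_power2)
  then have "sqrt (C\<^sub>3 * (norm ?z)\<^sup>2) \<le> sqrt (S\<^sup>2)" by (rule real_sqrt_le_mono)
  then have z: "norm ?z \<le> S / sqrt C\<^sub>3"
    using C3_pos \<open>S \<ge> 0\<close> by (simp add: real_sqrt_mult field_simps)
  have "(\<Sum>n=1..N. (norm (ip (W t) (\<psi> n)))\<^sup>2) \<le> 2 * S\<^sup>2" for N
  proof -
    have "(\<Sum>n=1..N. (norm (ip (W t) (\<psi> n)))\<^sup>2) \<le> (\<Sum>n=1..max N N\<^sub>0. (norm (ip (W t) (\<psi> n)))\<^sup>2)"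
      by (intro sum_mono2) auto
    also have "\<dots> = 2 * (\<Sum>n=1..max N N\<^sub>0. (norm (ip (W t) (\<psi> n)))\<^sup>2 / 2)"
      by (simp add: sum_distrib_left)
    also have "\<dots> \<le> 2 * S\<^sup>2"
      using low[of "max N N\<^sub>0"] C3_pos by (smt (verit) max.cobounded2 mult_nonneg_nonneg zero_le_power2)
    finally show ?thesis .
  qed
  then have "(norm (W t))\<^sup>2 \<le> M\<^sub>R * (2 * S\<^sup>2)" by (rule riesz_upper_bound[OF riesz biorth])
  then have "sqrt ((norm (W t))\<^sup>2) \<le> sqrt (2 * M\<^sub>R * S\<^sup>2)" by (intro real_sqrt_le_mono) (simp add: mult_ac)
  then have W: "norm (W t) \<le> sqrt (2 * M\<^sub>R) * S" using \<open>S \<ge> 0\<close> by (simp add: real_sqrt_mult)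
  have "norm (X t) \<le> norm (W t) + norm (B (K *v ?z))"
    using norm_triangle_ineq[of "W t" "B (K *v ?z)"] by (simp add: W_def)
  also have "norm (B (K *v ?z)) \<le> nBK * (S / sqrt C\<^sub>3)"
    using norm_BK_le[of ?z] z nBK_nonneg by (meson mult_left_mono order_trans)
  finally show "norm (X t) \<le> C\<^sub>4 * S" using W by (simp add: C4 distrib_right)
  have "\<gamma>\<^sub>1 * lambda_min P * (norm (Z t))\<^sup>2 \<le> S\<^sup>2" using V_ge_Z[OF t, of N\<^sub>0] V[of N\<^sub>0] by linarith
  then have "sqrt (\<gamma>\<^sub>1 * lambda_min P * (norm (Z t))\<^sup>2) \<le> sqrt (S\<^sup>2)" by (rule real_sqrt_le_mono)
  then show "norm (Z t) \<le> S / sqrt (\<gamma>\<^sub>1 * lambda_min P)"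
    using \<gamma>1_pos lambda_min_pos' \<open>S \<ge> 0\<close> by (simp add: real_sqrt_mult field_simps)
qed

text \<open>On this interval \<open>Z\<close> need not obey a closed equation, as
  \<open>\<theta>\<close> may be below 1. But \<open>\<theta> \<le> 1\<close> turns the implicit
  control law into an integral inequality for the norm of \<open>u\<close>; Gronwall bounds
  \<open>u\<close>, and then \<open>Z\<close>, by the supremum of the state.\<close>

lemma norm_Z_initial_le:
  assumes M: "\<And>s. s \<in> {0..D + t\<^sub>0} \<Longrightarrow> norm (X s) \<le> M" and t: "t \<in> {0..D + t\<^sub>0}"
  shows "norm (Z t) \<le> init_Z * M"
proof -
  define c where "c = exp (D * mnorm A\<^sub>N) * mnorm B\<^sub>N"
  define a where "a = M / sqrt m\<^sub>R"
  have c: "c \<ge> 0" unfolding c_def by simp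
  have "M \<ge> 0" using M[OF t] norm_ge_zero order_trans by blast
  then have a: "a \<ge> 0" unfolding a_def using m\<^sub>R_pos by simp
  have u_cont': "continuous_on {0..D + t\<^sub>0} (\<lambda>s. norm (u s))"
    using D by (intro continuous_intros continuous_on_subset[OF u_cont]) auto
  have Z: "norm (Z s) \<le> a + c * integral {0..s} (\<lambda>r. norm (u r))" if s: "0 \<le> s" "s \<le> D + t\<^sub>0" for s
  proof -
    have "(norm (Y s))\<^sup>2 \<le> (norm (X s))\<^sup>2 / m\<^sub>R" unfolding Y_def by (rule norm_mode_coords_power2_le)
    then have "sqrt ((norm (Y s))\<^sup>2) \<le> sqrt ((norm (X s))\<^sup>2 / m\<^sub>R)" by (rule real_sqrt_le_mono)
    then have "norm (Y s) \<le> norm (X s) / sqrt m\<^sub>R" by (simp add: real_sqrt_divide)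
    also have "\<dots> \<le> a" unfolding a_def using M[of s] s m\<^sub>R_pos by (intro divide_right_mono) auto
    finally have Y: "norm (Y s) \<le> a" .
    let ?S = "{max (s - D) 0..s}"
    have sub: "?S \<subseteq> {-D..}" "?S \<subseteq> {0..s}" "?S \<subseteq> {0..D + t\<^sub>0}" "{0..s} \<subseteq> {0..D + t\<^sub>0}" using D s by auto
    have "norm (Z s - Y s) \<le> exp (D * mnorm A\<^sub>N) * integral ?S (\<lambda>r. norm (B\<^sub>N *v u r))"
      using norm_predictor_integral_le[OF D AN u_cont u_zero s(1)] by (simp add: Z_def predictor_def)
    also have "\<dots> \<le> exp (D * mnorm A\<^sub>N) * integral ?S (\<lambda>r. mnorm B\<^sub>N * norm (u r))"
      by (intro mult_left_mono integral_le integrable_continuous_real continuous_intros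
          bounded_linear.continuous_on[OF matrix_vector_mul_bounded_linear] norm_matrix_vector_mult_le
          continuous_on_subset[OF u_cont sub(1)]) auto
    also have "\<dots> = c * integral ?S (\<lambda>r. norm (u r))" by (simp add: c_def)
    also have "\<dots> \<le> c * integral {0..s} (\<lambda>r. norm (u r))"
      by (intro mult_left_mono c integral_subset_le sub integrable_continuous_real continuous_on_subset[OF u_cont']) auto
    finally have "norm (Z s - Y s) \<le> c * integral {0..s} (\<lambda>r. norm (u r))" .
    then show ?thesis using Y norm_triangle_ineq[of "Y s" "Z s - Y s"] by simp
  qed
  have u_le: "norm (u s) \<le> mnorm K * a + mnorm K * c * integral {0..s} (\<lambda>r. norm (u r))"
    if s: "0 \<le> s" "s \<le> D + t\<^sub>0" for s
  proof -
    have "norm (u s) = \<theta> s * norm (K *v Z s)" using u_eq[OF s(1)] \<theta>_range s D by simp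
    also have "\<dots> \<le> 1 * norm (K *v Z s)" using \<theta>_range s D by (intro mult_right_mono) auto
    also have "\<dots> \<le> mnorm K * norm (Z s)" by (simp add: norm_matrix_vector_mult_le)
    also have "\<dots> \<le> mnorm K * (a + c * integral {0..s} (\<lambda>r. norm (u r)))"
      by (intro mult_left_mono Z s) auto
    finally show ?thesis by (simp add: algebra_simps)
  qed
  have u: "norm (u s) \<le> mnorm K * a * exp (mnorm K * c * (D + t\<^sub>0))" if "0 \<le> s" "s \<le> D + t\<^sub>0" for s
  proof -
    have "norm (u s) \<le> mnorm K * a * exp (mnorm K * c * s)"
      using gronwall[OF u_cont' that u_le] c by simp
    also have "\<dots> \<le> mnorm K * a * exp (mnorm K * c * (D + t\<^sub>0))"
      using that a c by (intro mult_left_mono) (auto intro!: mult_left_mono)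
    finally show ?thesis .
  qed
  have t': "0 \<le> t" "t \<le> D + t\<^sub>0" using t by auto
  have "integral {0..t} (\<lambda>r. norm (u r)) \<le> integral {0..t} (\<lambda>r. mnorm K * a * exp (mnorm K * c * (D + t\<^sub>0)))"
    using t' by (intro integral_le integrable_continuous_real continuous_on_subset[OF u_cont'] continuous_intros u) auto
  also have "\<dots> = t * (mnorm K * a * exp (mnorm K * c * (D + t\<^sub>0)))" using t' by simp
  also have "\<dots> \<le> (D + t\<^sub>0) * (mnorm K * a * exp (mnorm K * c * (D + t\<^sub>0)))"
    using t' a by (intro mult_right_mono) auto
  finally have "c * integral {0..t} (\<lambda>r. norm (u r)) \<le> c * ((D + t\<^sub>0) * (mnorm K * a * exp (mnorm K * c * (D + t\<^sub>0))))"
    using c by (intro mult_left_mono)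
  then have "norm (Z t) \<le> a + c * ((D + t\<^sub>0) * (mnorm K * a * exp (mnorm K * c * (D + t\<^sub>0))))"
    using Z[OF t'] by linarith
  also have "\<dots> = init_Z * M" unfolding init_Z_def c_def[symmetric] a_def by (simp add: algebra_simps add_divide_distrib)
  finally show ?thesis .
qed

lemma V_initial_le:
  assumes M: "\<And>s. s \<in> {0..D + t\<^sub>0} \<Longrightarrow> norm (X s) \<le> M"
  shows "V N (D + t\<^sub>0) \<le> init_V * M\<^sup>2"
proof -
  define c where "c = mnorm P * (init_Z * M)\<^sup>2"
  have Z: "norm (Z s) \<le> init_Z * M" if "s \<in> {0..D + t\<^sub>0}" for s
    by (rule norm_Z_initial_le[OF M that])
  have q: "quad (Z s) \<le> c" if "s \<in> {0..D + t\<^sub>0}" for s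
  proof -
    have "quad (Z s) \<le> mnorm P * (norm (Z s))\<^sup>2" by (rule quad_le_mnorm)
    also have "\<dots> \<le> c" unfolding c_def by (intro mult_left_mono power_mono Z that) auto
    finally show ?thesis .
  qed
  have "Q (D + t\<^sub>0) - Q t\<^sub>0 = integral {t\<^sub>0..D + t\<^sub>0} (\<lambda>s. quad (Z s))"
    using D t0 by (intro Q_diff) auto
  also have "\<dots> \<le> integral {t\<^sub>0..D + t\<^sub>0} (\<lambda>s. c)"
    using t0 by (intro integral_le integrable_continuous_real continuous_on_subset[OF quad_Z_cont] continuous_intros q) auto
  also have "\<dots> = D * c" using D by simp
  finally have Q: "Q (D + t\<^sub>0) - Q t\<^sub>0 \<le> D * c" .
  have "norm (W (D + t\<^sub>0)) \<le> M + nBK * (init_Z * M)"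
  proof -
    have "norm (W (D + t\<^sub>0)) \<le> norm (X (D + t\<^sub>0)) + norm (B (K *v Z t\<^sub>0))"
      unfolding W_def using norm_triangle_ineq4 by simp
    moreover have "norm (B (K *v Z t\<^sub>0)) \<le> nBK * (init_Z * M)"
      using norm_BK_le[of "Z t\<^sub>0"] Z[of t\<^sub>0] t0 D nBK_nonneg
      by (meson atLeastAtMost_iff less_imp_le mult_left_mono order_trans le_add_same_cancel2)
    ultimately show ?thesis using M[of "D + t\<^sub>0"] D t0 by simp
  qed
  then have "(norm (W (D + t\<^sub>0)))\<^sup>2 \<le> (M + nBK * (init_Z * M))\<^sup>2" by (intro power_mono) auto
  moreover have "tail_energy N (D + t\<^sub>0) \<le> (norm (W (D + t\<^sub>0)))\<^sup>2 / m\<^sub>R / 2"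
    using bessel[of "{N\<^sub>0 + 1..N}" "W (D + t\<^sub>0)"] unfolding tail_energy_def sum_divide_distrib[symmetric]
    by simp
  ultimately have tail: "tail_energy N (D + t\<^sub>0) \<le> (M + nBK * (init_Z * M))\<^sup>2 / m\<^sub>R / 2"
    using m\<^sub>R_pos by (smt (verit) divide_right_mono)
  have "V N (D + t\<^sub>0) \<le> \<gamma>\<^sub>1 * (c + D * c) + \<gamma>\<^sub>2 * c + (M + nBK * (init_Z * M))\<^sup>2 / m\<^sub>R / 2"
    unfolding V_def using \<gamma>1_pos \<gamma>2_pos Q q[of "D + t\<^sub>0"] q[of t\<^sub>0] D t0
    by (intro add_mono mult_left_mono tail) auto
  also have "(M + nBK * (init_Z * M))\<^sup>2 = (1 + nBK * init_Z)\<^sup>2 * M\<^sup>2"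
    unfolding power_mult_distrib[symmetric] by (simp add: algebra_simps)
  also have "\<gamma>\<^sub>1 * (c + D * c) + \<gamma>\<^sub>2 * c + (1 + nBK * init_Z)\<^sup>2 * M\<^sup>2 / m\<^sub>R / 2 = init_V * M\<^sup>2"
    unfolding init_V_def c_def power_mult_distrib by (simp add: algebra_simps)
  finally show ?thesis .
qed

text \<open>Passes from squares to norms: both summands of \<open>R\<close> are nonnegative, so
  \<open>R^2\<close> dominates the sum of their squares. Only bounds on \<open>[0, t]\<close> enter,
  so nothing is presumed about later times when the loop is closed.\<close>

lemma forced_estimate:
  assumes \<delta>: "0 < \<delta>" "\<delta> < \<kappa>\<^sub>0" and t: "t \<ge> D + t\<^sub>0"
    and M: "\<And>s. s \<in> {0..D + t\<^sub>0} \<Longrightarrow> norm (X s) \<le> M"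
    and \<Phi>: "\<And>s. s \<in> {0..t} \<Longrightarrow> exp (\<delta> * s) * norm (f s) \<le> \<Phi>"
  defines "R \<equiv> exp (\<delta> * (D + t\<^sub>0)) * sqrt init_V * M + sqrt (C\<^sub>6 / (2 * (\<kappa>\<^sub>0 - \<delta>))) * exp (\<delta> * D) * \<Phi>"
  shows "exp (\<delta> * t) * norm (X t) \<le> C\<^sub>4 * R"
    and "exp (\<delta> * t) * norm (u t) \<le> mnorm K / sqrt (\<gamma>\<^sub>1 * lambda_min P) * R"
proof -
  have M0: "M \<ge> 0" using M[of 0] D t0 norm_ge_zero[of "X 0"] by (smt (verit) atLeastAtMost_iff)
  have "exp (\<delta> * 0) * norm (f 0) \<le> \<Phi>" using t D t0 by (intro \<Phi>) auto
  then have \<Phi>0: "\<Phi> \<ge> 0" by (simp add: order_trans[OF norm_ge_zero])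
  have R1: "exp (\<delta> * (D + t\<^sub>0)) * sqrt init_V * M \<ge> 0" using M0 init_V_nonneg by simp
  have R2: "sqrt (C\<^sub>6 / (2 * (\<kappa>\<^sub>0 - \<delta>))) * exp (\<delta> * D) * \<Phi> \<ge> 0" using \<Phi>0 C6_nonneg \<delta> by simp
  have R: "R \<ge> 0" unfolding R_def using R1 R2 by simp
  have sq: "(exp (a * b))\<^sup>2 = exp (2 * a * b)" for a b :: real
    unfolding power2_eq_square exp_add[symmetric] by simp
  have "V N t \<le> (exp (- \<delta> * t) * R)\<^sup>2" for N
  proof -
    have "exp (2 * \<delta> * t) * V N t
        \<le> exp (2 * \<delta> * (D + t\<^sub>0)) * (init_V * M\<^sup>2) + C\<^sub>6 * exp (2 * \<delta> * D) * \<Phi>\<^sup>2 / (2 * (\<kappa>\<^sub>0 - \<delta>))"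
      using V_decay[OF \<delta> t \<Phi>, of N] V_initial_le[OF M, of N]
      by (smt (verit) exp_ge_zero mult_left_mono)
    also have "exp (2 * \<delta> * (D + t\<^sub>0)) * (init_V * M\<^sup>2) = (exp (\<delta> * (D + t\<^sub>0)) * sqrt init_V * M)\<^sup>2"
      using init_V_nonneg by (simp add: power_mult_distrib sq)
    also have "C\<^sub>6 * exp (2 * \<delta> * D) * \<Phi>\<^sup>2 / (2 * (\<kappa>\<^sub>0 - \<delta>))
        = (sqrt (C\<^sub>6 / (2 * (\<kappa>\<^sub>0 - \<delta>))) * exp (\<delta> * D) * \<Phi>)\<^sup>2"
      using C6_nonneg \<delta> by (simp add: power_mult_distrib sq)
    also have "(exp (\<delta> * (D + t\<^sub>0)) * sqrt init_V * M)\<^sup>2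
        + (sqrt (C\<^sub>6 / (2 * (\<kappa>\<^sub>0 - \<delta>))) * exp (\<delta> * D) * \<Phi>)\<^sup>2 \<le> R\<^sup>2"
      unfolding R_def power2_sum using R1 R2 by simp
    finally have "exp (- (2 * \<delta> * t)) * (exp (2 * \<delta> * t) * V N t) \<le> exp (- (2 * \<delta> * t)) * R\<^sup>2"
      by (intro mult_left_mono) auto
    then show ?thesis
      using sq[of "- \<delta>" t] by (simp add: power_mult_distrib flip: mult.assoc exp_add)
  qed
  from state_bounds[OF t _ this] R
  have X: "norm (X t) \<le> C\<^sub>4 * (exp (- \<delta> * t) * R)"
    and Z: "norm (Z t) \<le> exp (- \<delta> * t) * R / sqrt (\<gamma>\<^sub>1 * lambda_min P)"
    by simp_all
  have cancel: "exp (\<delta> * t) * (c * (exp (- \<delta> * t) * R)) = c * R" for c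
    by (simp add: mult.left_commute flip: mult.assoc exp_add)
  show "exp (\<delta> * t) * norm (X t) \<le> C\<^sub>4 * R"
    using mult_left_mono[OF X, of "exp (\<delta> * t)"] by (simp only: cancel exp_ge_zero)
  have "norm (u t) \<le> mnorm K * norm (Z t)"
    using u_eq_K[of t] t D norm_matrix_vector_mult_le[of K "Z t"] by simp
  also have "\<dots> \<le> mnorm K * (exp (- \<delta> * t) * R / sqrt (\<gamma>\<^sub>1 * lambda_min P))"
    by (intro mult_left_mono Z) simp
  finally have "norm (u t) \<le> mnorm K / sqrt (\<gamma>\<^sub>1 * lambda_min P) * (exp (- \<delta> * t) * R)" by simp
  from mult_left_mono[OF this, of "exp (\<delta> * t)"]
  show "exp (\<delta> * t) * norm (u t) \<le> mnorm K / sqrt (\<gamma>\<^sub>1 * lambda_min P) * R"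
    by (simp only: cancel exp_ge_zero)
qed

end

end

section \<open>Small gain\<close>

text \<open>The estimate is only assumed on windows starting at time 0. As the vector field is autonomous, it
  holds on every window of length \<open>T\<close>, and choosing \<open>T\<close> large makes the contribution of the initial state
  of the window a small fraction \<open>q\<close>, at the price of a factor tending to \<open>1\<close> in the gains.\<close>

lemma ode_iss_fading_memory:
  fixes f :: "'x::real_normed_vector \<Rightarrow> 'h::real_normed_vector \<Rightarrow> 'v::real_normed_vector \<Rightarrow> 'x"
  assumes iss: "ode_iss f \<kappa> C0 C1 C2" and C: "C0 \<ge> 0" "C1 \<ge> 0" "C2 \<ge> 0" and \<kappa>: "\<kappa> > 0"
    and T: "T > 0" and \<delta>: "\<delta> > 0" and q: "q < 1" "C0\<^sup>2 * exp (- 2 * (\<kappa> - \<delta>) * T) \<le> q"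
    and X: "continuous_on {0..} X" and v: "continuous_on {0..} v"
    and x: "\<And>t. t \<ge> 0 \<Longrightarrow> (x has_vector_derivative f (x t) (X t) (v t)) (at t within {0..})"
    and t: "t \<ge> 0"
    and E: "\<And>s. s \<in> {0..t} \<Longrightarrow> exp (\<delta> * s) * norm (X s) \<le> E"
    and W: "\<And>s. s \<in> {0..t} \<Longrightarrow> exp (\<delta> * s) * norm (v s) \<le> W"
  shows "exp (\<delta> * t) * norm (x t) \<le> exp (\<delta> * T) / sqrt (1 - q) * (C0 * norm (x 0) + C1 * E + C2 * W)"
proof -
  define S where "S = C1\<^sup>2 * E\<^sup>2 + C2\<^sup>2 * W\<^sup>2"
  have sq: "(exp (a * b))\<^sup>2 = exp (2 * a * b)" for a b :: real
    unfolding power2_eq_square exp_add[symmetric] by simp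
  have EW: "0 \<le> E" "0 \<le> W"
    using order_trans[OF _ E[of 0]] order_trans[OF _ W[of 0]] t by simp_all
  \<comment> \<open>The hypothesis is applied to the trajectory restarted at \<open>r\<close>. Since
    \<open>exp (\<delta> (r + s)) \<ge> exp (\<delta> r)\<close>, the squared inputs on the window
    are at most \<open>exp (- 2 \<delta> r)\<close> times \<open>E^2\<close> and
    \<open>W^2\<close>.\<close>
  have window: "exp (2 * \<delta> * (r + h)) * (norm (x (r + h)))\<^sup>2
      \<le> C0\<^sup>2 * exp (- 2 * (\<kappa> - \<delta>) * h) * (exp (\<delta> * r) * norm (x r))\<^sup>2 + exp (2 * \<delta> * T) * S"
    if r: "r \<ge> 0" "h \<ge> 0" "r + h \<le> t" "h \<le> T" for r h
  proof -
    have cont: "continuous_on {0..} (\<lambda>s. X (r + s))" "continuous_on {0..} (\<lambda>s. v (r + s))"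
      using r by (intro continuous_on_compose2[OF X] continuous_on_compose2[OF v] continuous_intros; force)+
    have deriv: "((\<lambda>s. x (r + s)) has_vector_derivative f (x (r + s)) (X (r + s)) (v (r + s))) (at s within {0..})"
      if "s \<ge> 0" for s
    proof -
      have "(x has_vector_derivative f (x (r + s)) (X (r + s)) (v (r + s))) (at (r + s) within (+) r ` {0..})"
        using x[of "r + s"] r that by (auto intro: has_vector_derivative_within_subset)
      moreover have "((+) r has_vector_derivative 1) (at s within {0..})"
        by (auto intro!: derivative_eq_intros)
      ultimately show ?thesis
        using vector_diff_chain_within[of "(+) r" 1 s "{0..}" x] by (simp add: o_def)
    qed
    let ?g = "\<lambda>s. C1\<^sup>2 * (norm (X (r + s)))\<^sup>2 + C2\<^sup>2 * (norm (v (r + s)))\<^sup>2"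
    have "?g s \<le> exp (- 2 * \<delta> * r) * S" if s: "s \<in> {0..h}" for s
    proof -
      have le: "a\<^sup>2 \<le> exp (- 2 * \<delta> * r) * b\<^sup>2" if "exp (\<delta> * (r + s)) * a \<le> b" "0 \<le> a" for a b :: real
      proof -
        have "exp (2 * \<delta> * r) * a\<^sup>2 \<le> exp (2 * \<delta> * (r + s)) * a\<^sup>2"
          using s \<delta> by (intro mult_right_mono) auto
        also have "\<dots> = (exp (\<delta> * (r + s)) * a)\<^sup>2" by (simp add: power_mult_distrib sq)
        also have "\<dots> \<le> b\<^sup>2" using that by (intro power_mono) auto
        finally have "exp (- 2 * \<delta> * r) * (exp (2 * \<delta> * r) * a\<^sup>2) \<le> exp (- 2 * \<delta> * r) * b\<^sup>2"
          by (intro mult_left_mono) auto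
        then show ?thesis by (simp flip: mult.assoc exp_add)
      qed
      have "?g s \<le> C1\<^sup>2 * (exp (- 2 * \<delta> * r) * E\<^sup>2) + C2\<^sup>2 * (exp (- 2 * \<delta> * r) * W\<^sup>2)"
        using s r by (intro add_mono mult_left_mono le E W) auto
      then show ?thesis by (simp add: S_def algebra_simps)
    qed
    then have "(SUP s\<in>{0..h}. ?g s) \<le> exp (- 2 * \<delta> * r) * S"
      using r by (intro cSUP_least) auto
    moreover have "(norm (x (r + h)))\<^sup>2 \<le> C0\<^sup>2 * exp (- 2 * \<kappa> * h) * (norm (x r))\<^sup>2 + (SUP s\<in>{0..h}. ?g s)"
      using iss[unfolded ode_iss_def, rule_format, OF cont, of "\<lambda>s. x (r + s)"] deriv r by simp
    ultimately have "(norm (x (r + h)))\<^sup>2 \<le> C0\<^sup>2 * exp (- 2 * \<kappa> * h) * (norm (x r))\<^sup>2 + exp (- 2 * \<delta> * r) * S"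
      by linarith
    then have "exp (2 * \<delta> * (r + h)) * (norm (x (r + h)))\<^sup>2
        \<le> exp (2 * \<delta> * (r + h)) * (C0\<^sup>2 * exp (- 2 * \<kappa> * h) * (norm (x r))\<^sup>2 + exp (- 2 * \<delta> * r) * S)"
      by (intro mult_left_mono) auto
    also have "\<dots> = C0\<^sup>2 * ((exp (2 * \<delta> * (r + h)) * exp (- 2 * \<kappa> * h)) * (norm (x r))\<^sup>2)
        + (exp (2 * \<delta> * (r + h)) * exp (- 2 * \<delta> * r)) * S"
      by (simp add: algebra_simps)
    also have "exp (2 * \<delta> * (r + h)) * exp (- 2 * \<kappa> * h) = exp (- 2 * (\<kappa> - \<delta>) * h) * exp (2 * \<delta> * r)"
      unfolding exp_add[symmetric] by (simp add: algebra_simps)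
    also have "exp (2 * \<delta> * (r + h)) * exp (- 2 * \<delta> * r) = exp (2 * \<delta> * h)"
      unfolding exp_add[symmetric] by (simp add: algebra_simps)
    also have "C0\<^sup>2 * (exp (- 2 * (\<kappa> - \<delta>) * h) * exp (2 * \<delta> * r) * (norm (x r))\<^sup>2) + exp (2 * \<delta> * h) * S
        = C0\<^sup>2 * exp (- 2 * (\<kappa> - \<delta>) * h) * (exp (\<delta> * r) * norm (x r))\<^sup>2 + exp (2 * \<delta> * h) * S"
      by (simp add: power_mult_distrib sq mult_ac)
    also have "exp (2 * \<delta> * h) * S \<le> exp (2 * \<delta> * T) * S"
      using r \<delta> by (intro mult_right_mono) (auto simp: S_def)
    finally show ?thesis by simp
  qed
  have x_cont: "continuous_on {0..t} x"
    using x by (intro continuous_on_subset[OF continuous_on_vector_derivative[of "{0..}"]]) auto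
  \<comment> \<open>At a maximum point of the weighted norm, the weighted state one window length
    \<open>T\<close> earlier is bounded by the same value \<open>m\<close>.\<close>
  have "\<exists>s\<in>{0..t}. \<forall>r\<in>{0..t}. exp (\<delta> * r) * norm (x r) \<le> exp (\<delta> * s) * norm (x s)"
    using t by (intro continuous_attains_sup continuous_intros x_cont) auto
  then obtain s where s: "0 \<le> s" "s \<le> t"
    and smax: "\<And>r. r \<in> {0..t} \<Longrightarrow> exp (\<delta> * r) * norm (x r) \<le> exp (\<delta> * s) * norm (x s)" by auto
  define m where "m = exp (\<delta> * s) * norm (x s)"
  define R where "R = C0 * norm (x 0) + C1 * E + C2 * W"
  have m2: "m\<^sup>2 = exp (2 * \<delta> * s) * (norm (x s))\<^sup>2" by (simp add: m_def power_mult_distrib sq)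
  have q0: "0 \<le> q" by (rule order_trans[OF _ q(2)]) simp
  have "m\<^sup>2 \<le> q * m\<^sup>2 + exp (2 * \<delta> * T) * (C0\<^sup>2 * (norm (x 0))\<^sup>2 + S)"
  \<comment> \<open>Late maximum: a full window ends at \<open>s\<close>, and its initial state
    contributes at most \<open>q m^2\<close>. Early maximum: the window starts at 0 and the true
    initial state appears.\<close>
  proof (cases "s \<ge> T")
    case True
    have "m\<^sup>2 \<le> C0\<^sup>2 * exp (- 2 * (\<kappa> - \<delta>) * T) * (exp (\<delta> * (s - T)) * norm (x (s - T)))\<^sup>2 + exp (2 * \<delta> * T) * S"
      using window[of "s - T" T] True s T by (simp add: m2)
    also have "C0\<^sup>2 * exp (- 2 * (\<kappa> - \<delta>) * T) * (exp (\<delta> * (s - T)) * norm (x (s - T)))\<^sup>2 \<le> q * m\<^sup>2"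
      unfolding m_def using True s T q0 by (intro mult_mono q power_mono smax) auto
    finally have "m\<^sup>2 \<le> q * m\<^sup>2 + exp (2 * \<delta> * T) * S" by simp
    moreover have "exp (2 * \<delta> * T) * S \<le> exp (2 * \<delta> * T) * (C0\<^sup>2 * (norm (x 0))\<^sup>2 + S)"
      by (intro mult_left_mono) auto
    ultimately show ?thesis by linarith
  next
    case False
    have "m\<^sup>2 \<le> C0\<^sup>2 * exp (- 2 * (\<kappa> - \<delta>) * s) * (norm (x 0))\<^sup>2 + exp (2 * \<delta> * T) * S"
      using window[of 0 s] False s by (simp add: m2)
    also have "C0\<^sup>2 * exp (- 2 * (\<kappa> - \<delta>) * s) * (norm (x 0))\<^sup>2 \<le> C0\<^sup>2 * exp (2 * \<delta> * T) * (norm (x 0))\<^sup>2"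
    proof (intro mult_left_mono mult_right_mono)
      have "\<delta> * s \<le> \<delta> * T" "\<kappa> * s \<ge> 0" using False \<delta> s \<kappa> by auto
      then show "exp (- 2 * (\<kappa> - \<delta>) * s) \<le> exp (2 * \<delta> * T)" by (simp add: algebra_simps)
    qed auto
    finally have "m\<^sup>2 \<le> exp (2 * \<delta> * T) * (C0\<^sup>2 * (norm (x 0))\<^sup>2 + S)" by (simp add: algebra_simps)
    then show ?thesis using q0 by (simp add: add_increasing)
  qed
  then have "(1 - q) * m\<^sup>2 \<le> exp (2 * \<delta> * T) * (C0\<^sup>2 * (norm (x 0))\<^sup>2 + S)" by (simp add: algebra_simps)
  also have "\<dots> \<le> exp (2 * \<delta> * T) * R\<^sup>2"
  proof (rule mult_left_mono)
    have "C0 * norm (x 0) \<ge> 0" "C1 * E \<ge> 0" "C2 * W \<ge> 0" using C EW by auto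
    then show "C0\<^sup>2 * (norm (x 0))\<^sup>2 + S \<le> R\<^sup>2"
      unfolding S_def R_def power_mult_distrib[symmetric] by (simp add: power2_sum distrib_right)
  qed simp
  also have "\<dots> = (exp (\<delta> * T) * R)\<^sup>2" by (simp add: power_mult_distrib sq)
  finally have "sqrt ((1 - q) * m\<^sup>2) \<le> sqrt ((exp (\<delta> * T) * R)\<^sup>2)" by (rule real_sqrt_le_mono)
  moreover have "0 \<le> m" "0 \<le> R" using C EW by (simp_all add: m_def R_def)
  ultimately have "sqrt (1 - q) * m \<le> exp (\<delta> * T) * R" by (simp add: real_sqrt_mult)
  then have "m \<le> exp (\<delta> * T) / sqrt (1 - q) * R" using q(1) by (simp add: field_simps)
  moreover have "exp (\<delta> * t) * norm (x t) \<le> m" unfolding m_def using t by (intro smax) auto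
  ultimately show ?thesis unfolding R_def by linarith
qed

text \<open>Three choices in a fixed order: a small \<open>q\<close> uses up part of the strict
  margin through \<open>1 / sqrt (1 - q)\<close>, then \<open>T\<close> is made large enough for
  this \<open>q\<close>, and \<open>\<delta>\<close> comes last because the factor
  \<open>exp (\<delta> T)\<close> depends on \<open>T\<close>.\<close>

lemma small_gain_margin:
  fixes a b c d C0 \<kappa> \<kappa>\<^sub>0 D :: real
  assumes \<kappa>: "\<kappa> > 0" and \<kappa>\<^sub>0: "\<kappa>\<^sub>0 > 0"
    and gain: "(a + b) * c * sqrt (d / (2 * \<kappa>\<^sub>0)) < 1"
  obtains q T \<delta> where "q < 1" "T > 0" "0 < \<delta>" "\<delta> < \<kappa>\<^sub>0" "C0\<^sup>2 * exp (- 2 * (\<kappa> - \<delta>) * T) \<le> q"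
    "(a * (exp (\<delta> * T) / sqrt (1 - q)) + b) * c * (sqrt (d / (2 * (\<kappa>\<^sub>0 - \<delta>))) * exp (\<delta> * D)) < 1"
proof -
  have "((\<lambda>q. (a * (1 / sqrt (1 - q)) + b) * c * sqrt (d / (2 * \<kappa>\<^sub>0))) \<longlongrightarrow>
      (a * (1 / sqrt (1 - 0)) + b) * c * sqrt (d / (2 * \<kappa>\<^sub>0))) (at_right 0)"
    by (intro tendsto_intros) auto
  then have "\<forall>\<^sub>F q in at_right 0. (a * (1 / sqrt (1 - q)) + b) * c * sqrt (d / (2 * \<kappa>\<^sub>0)) < 1"
    by (rule order_tendstoD(2)) (use gain in simp)
  moreover have "\<forall>\<^sub>F q in at_right (0::real). q \<in> {0<..<1}"
    by (rule eventually_at_right_real) simp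
  ultimately have ev_q: "\<forall>\<^sub>F q in at_right 0. q \<in> {0<..<1} \<and> (a * (1 / sqrt (1 - q)) + b) * c * sqrt (d / (2 * \<kappa>\<^sub>0)) < 1"
    by eventually_elim simp
  then obtain q where q: "0 < q" "q < 1" "(a * (1 / sqrt (1 - q)) + b) * c * sqrt (d / (2 * \<kappa>\<^sub>0)) < 1"
    using eventually_happens'[OF trivial_limit_at_right_real ev_q] by auto
  \<comment> \<open>Chosen so that \<open>2 \<kappa> T q = C0^2 + 1\<close>, which exceeds
    \<open>C0^2\<close>; the addend 1 also keeps \<open>T\<close> positive when \<open>C0\<close> is
    0. The strict inequality survives the later perturbation by a small
    \<open>\<delta>\<close>.\<close>
  define T where "T = (C0\<^sup>2 + 1) / (2 * \<kappa> * q)"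
  have T: "T > 0" unfolding T_def using \<kappa> q by (simp add: add_nonneg_pos)
  have "C0\<^sup>2 < 2 * \<kappa> * T * q" unfolding T_def using \<kappa> q by simp
  also have "\<dots> \<le> exp (2 * \<kappa> * T) * q"
  proof (rule mult_right_mono)
    show "2 * \<kappa> * T \<le> exp (2 * \<kappa> * T)" using exp_ge_add_one_self[of "2 * \<kappa> * T"] by linarith
  qed (use q in simp)
  finally have "exp (- (2 * \<kappa> * T)) * C0\<^sup>2 < exp (- (2 * \<kappa> * T)) * (exp (2 * \<kappa> * T) * q)"
    by (intro mult_strict_left_mono) auto
  then have T': "C0\<^sup>2 * exp (- 2 * (\<kappa> - 0) * T) < q" 
    by (simp add: exp_minus field_simps)
  have "((\<lambda>\<delta>. C0\<^sup>2 * exp (- 2 * (\<kappa> - \<delta>) * T)) \<longlongrightarrow> C0\<^sup>2 * exp (- 2 * (\<kappa> - 0) * T)) (at_right 0)"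
    by (intro tendsto_intros)
  then have "\<forall>\<^sub>F \<delta> in at_right 0. C0\<^sup>2 * exp (- 2 * (\<kappa> - \<delta>) * T) < q"
    by (rule order_tendstoD(2)) (rule T')
  moreover have "((\<lambda>\<delta>. (a * (exp (\<delta> * T) / sqrt (1 - q)) + b) * c * (sqrt (d / (2 * (\<kappa>\<^sub>0 - \<delta>))) * exp (\<delta> * D)))
      \<longlongrightarrow> (a * (exp (0 * T) / sqrt (1 - q)) + b) * c * (sqrt (d / (2 * (\<kappa>\<^sub>0 - 0))) * exp (0 * D))) (at_right 0)"
    using \<kappa>\<^sub>0 q by (intro tendsto_intros) auto
  then have "\<forall>\<^sub>F \<delta> in at_right 0.
      (a * (exp (\<delta> * T) / sqrt (1 - q)) + b) * c * (sqrt (d / (2 * (\<kappa>\<^sub>0 - \<delta>))) * exp (\<delta> * D)) < 1"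
    by (rule order_tendstoD(2)) (use q(3) in simp)
  moreover have "\<forall>\<^sub>F \<delta> in at_right 0. \<delta> \<in> {0<..<\<kappa>\<^sub>0}"
    by (rule eventually_at_right_real) (rule \<kappa>\<^sub>0)
  ultimately have ev_\<delta>: "\<forall>\<^sub>F \<delta> in at_right 0. \<delta> \<in> {0<..<\<kappa>\<^sub>0} \<and> C0\<^sup>2 * exp (- 2 * (\<kappa> - \<delta>) * T) < q \<and>
      (a * (exp (\<delta> * T) / sqrt (1 - q)) + b) * c * (sqrt (d / (2 * (\<kappa>\<^sub>0 - \<delta>))) * exp (\<delta> * D)) < 1"
    by eventually_elim simp
  then obtain \<delta> where "\<delta> \<in> {0<..<\<kappa>\<^sub>0}" "C0\<^sup>2 * exp (- 2 * (\<kappa> - \<delta>) * T) < q"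
      "(a * (exp (\<delta> * T) / sqrt (1 - q)) + b) * c * (sqrt (d / (2 * (\<kappa>\<^sub>0 - \<delta>))) * exp (\<delta> * D)) < 1"
    using eventually_happens'[OF trivial_limit_at_right_real ev_\<delta>] by blast
  with that[of q T \<delta>] q T show ?thesis by auto
qed

section \<open>Closing the loop between the two subsystems\<close>

theorem theoremV4:
  fixes sc :: "'k::real_or_complex \<Rightarrow> 'h::banach \<Rightarrow> 'h"
    and ip :: "'h \<Rightarrow> 'h \<Rightarrow> 'k"
    and DA DB :: "'h set"
    and \<A> :: "'h \<Rightarrow> 'h"
    and \<B> :: "'h \<Rightarrow> 'k^'m"
    and B :: "'k^'m \<Rightarrow> 'h"
    and lam :: "nat \<Rightarrow> 'k"
    and \<phi> \<psi> :: "nat \<Rightarrow> 'h"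
    and m\<^sub>R M\<^sub>R \<alpha> :: real
    and N\<^sub>0 :: nat
    and \<iota> :: "'p::finite \<Rightarrow> nat"
    and A\<^sub>N :: "'k^'p^'p"
    and B\<^sub>N :: "'k^'m^'p"
    and f\<^sub>1 :: "'k^'n \<Rightarrow> 'h \<Rightarrow> 'k^'v \<Rightarrow> 'k^'n"
    and f\<^sub>2 :: "'k^'n \<Rightarrow> 'h \<Rightarrow> 'k^'v \<Rightarrow> 'h"
    and D\<^sub>1 D\<^sub>2 D\<^sub>3 \<kappa>' C0' C1' C2' :: real
    and D t\<^sub>0 :: real
    and \<theta> :: "real \<Rightarrow> real"
    and K :: "'k^'p^'m"
    and A\<^sub>c\<^sub>l P :: "'k^'p^'p"
    and \<beta> \<gamma>\<^sub>1 \<gamma>\<^sub>2 :: real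
    and nBK C\<^sub>1 C\<^sub>3 C\<^sub>4 C\<^sub>5 C\<^sub>6 \<kappa>\<^sub>0 :: real
  assumes hilbert: "separable_hilbert_space sc ip"
    and bcs: "abstract_boundary_control_system sc DA \<A> DB \<B>"
    and lifting: "lifting_operator sc DA \<A> \<B> B"
    and A1: "riesz_spectral_operator sc (dom0 DA \<B>) \<A> lam \<phi> m\<^sub>R M\<^sub>R"
    and biorth: "biorthogonal ip \<phi> \<psi>"
    and N0: "N\<^sub>0 \<ge> 1"
    and \<alpha>: "\<alpha> > 0"
    and A2: "\<forall>n\<ge>N\<^sub>0 + 1. ReK (lam n) \<le> - \<alpha>"
    and \<iota>: "bij_betw \<iota> (UNIV :: 'p set) {1..N\<^sub>0}"
    and AN: "A\<^sub>N = modes_matrix \<iota> lam"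
    and BN: "B\<^sub>N = input_matrix \<iota> ip \<A> B lam \<psi>"
    and A3: "kalman_condition \<iota> A\<^sub>N B\<^sub>N"
    and f1_C1: "C1_map (\<lambda>(x, X, v). f\<^sub>1 x X v)"
    and f2_C1: "C1_map (\<lambda>(x, X, v). f\<^sub>2 x X v)"
    and A4_1: "uniformly_lipschitz f\<^sub>1" "uniformly_lipschitz f\<^sub>2"
    and D123: "D\<^sub>1 \<ge> 0" "D\<^sub>2 \<ge> 0" "D\<^sub>3 \<ge> 0"
    and A4_2: "\<forall>x X v. norm (f\<^sub>2 x X v) \<le> D\<^sub>1 * norm x + D\<^sub>2 * norm X + D\<^sub>3 * norm v"
    and C012: "\<kappa>' > 0" "C0' \<ge> 0" "C1' \<ge> 0" "C2' \<ge> 0"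
    and A4_3: "ode_iss f\<^sub>1 \<kappa>' C0' C1' C2'"
    and D: "D > 0"
    and t0: "t\<^sub>0 > 0"
    and \<theta>_C2: "C2_on {-D..} \<theta>"
    and \<theta>_range: "\<forall>t\<ge>-D. 0 \<le> \<theta> t \<and> \<theta> t \<le> 1"
    and \<theta>_zero: "\<forall>t\<in>{-D..0}. \<theta> t = 0"
    and \<theta>_one: "\<forall>t\<ge>t\<^sub>0. \<theta> t = 1"
    and Acl: "A\<^sub>c\<^sub>l = A\<^sub>N + mexp ((- D) *\<^sub>R A\<^sub>N) ** B\<^sub>N ** K"
    and Acl_hurwitz: "hurwitz A\<^sub>c\<^sub>l"
    and P_pos_def: "hermitian_pos_def P"
    and P_lyapunov: "adjointK A\<^sub>c\<^sub>l ** P + P ** A\<^sub>c\<^sub>l = - mat 1"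
    and nBK: "nBK = onorm (\<lambda>y. B (K *v y))"
    and C1: "C\<^sub>1 = 2 * max 1 (D * exp (2 * D * mnorm A\<^sub>N) * (mnorm (B\<^sub>N ** K))\<^sup>2)"
    and C5: "C\<^sub>5 = 2 * real CARD('m) / (\<alpha> * m\<^sub>R) *
               (\<Sum>i\<in>UNIV. (norm (\<A> (B (axis i 1))))\<^sup>2 * (norm (K $ i))\<^sup>2
                         + (norm (B (axis i 1)))\<^sup>2 * (norm (K $ i v* A\<^sub>c\<^sub>l))\<^sup>2)"
    and \<beta>: "0 < \<beta>" "\<beta> < 1"
    and \<gamma>1: "\<gamma>\<^sub>1 > C\<^sub>1 / lambda_min P"
    and \<gamma>2: "\<gamma>\<^sub>2 > max (nBK\<^sup>2 / (m\<^sub>R * lambda_min P)) (C\<^sub>5 / (1 - \<beta>))"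
    and C3: "C\<^sub>3 = \<gamma>\<^sub>2 * lambda_min P - nBK\<^sup>2 / m\<^sub>R"
    and C4: "C\<^sub>4 = sqrt (2 * M\<^sub>R) + nBK / sqrt C\<^sub>3"
    and \<kappa>0: "\<kappa>\<^sub>0 = 1 / 2 * Min {(1 - \<beta>) / lambda_max P,
                              (1 - \<beta> - C\<^sub>5 / \<gamma>\<^sub>2) / lambda_max P,
                              \<alpha> / 2}"
    and C6: "C\<^sub>6 = 1 / m\<^sub>R * (2 * (m\<^sub>R + nBK\<^sup>2) / (\<alpha> * m\<^sub>R)
                           + (\<gamma>\<^sub>1 * (1 + D) + \<gamma>\<^sub>2) * (mnorm P)\<^sup>2 / \<beta>)"
    and small_gain: "(D\<^sub>1 * C1' + D\<^sub>2) * C\<^sub>4 * sqrt (C\<^sub>6 / (2 * \<kappa>\<^sub>0)) < 1"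
  shows "\<exists>\<delta> G\<^sub>0 G\<^sub>1 G\<^sub>2 G\<^sub>3 H\<^sub>0 H\<^sub>1 H\<^sub>2 H\<^sub>3 :: real.
    0 < \<delta> \<and> \<delta> < \<kappa>\<^sub>0 \<and>
    0 \<le> G\<^sub>0 \<and> 0 \<le> G\<^sub>1 \<and> 0 \<le> G\<^sub>2 \<and> 0 \<le> G\<^sub>3 \<and>
    0 \<le> H\<^sub>0 \<and> 0 \<le> H\<^sub>1 \<and> 0 \<le> H\<^sub>2 \<and> 0 \<le> H\<^sub>3 \<and>
    (\<forall>x\<^sub>0 X\<^sub>0 v x X u.
       X\<^sub>0 \<in> dom0 DA \<B> \<longrightarrow> C1_on {0..} v \<longrightarrow>
       classical_solution DA \<A> \<B> f\<^sub>1 f\<^sub>2 \<iota> ip \<psi> D \<theta> A\<^sub>N B\<^sub>N K x\<^sub>0 X\<^sub>0 v x X u \<longrightarrow>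
       (\<forall>t\<ge>D + t\<^sub>0.
          norm (x t) + norm (X t) \<le>
            G\<^sub>0 * exp (- \<delta> * t) * (norm x\<^sub>0 + norm X\<^sub>0)
            + G\<^sub>1 * exp (- \<delta> * t) * (SUP \<tau>\<in>{0..D + t\<^sub>0}. norm (x \<tau>))
            + G\<^sub>2 * exp (- \<delta> * t) * (SUP \<tau>\<in>{0..D + t\<^sub>0}. norm (X \<tau>))
            + G\<^sub>3 * (SUP \<tau>\<in>{0..t}. exp (- \<delta> * (t - \<tau>)) * norm (v \<tau>))) \<and>
       (\<forall>t\<ge>D + t\<^sub>0.
          norm (u t) \<le>
            H\<^sub>0 * exp (- \<delta> * t) * (norm x\<^sub>0 + norm X\<^sub>0)
            + H\<^sub>1 * exp (- \<delta> * t) * (SUP \<tau>\<in>{0..D + t\<^sub>0}. norm (x \<tau>))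
            + H\<^sub>2 * exp (- \<delta> * t) * (SUP \<tau>\<in>{0..D + t\<^sub>0}. norm (X \<tau>))
            + H\<^sub>3 * (SUP \<tau>\<in>{0..t}. exp (- \<delta> * (t - \<tau>)) * norm (v \<tau>))))"
proof -
  interpret predictor_feedback_loop sc ip DA DB \<A> \<B> B lam \<phi> \<psi> m\<^sub>R M\<^sub>R \<alpha> N\<^sub>0 \<iota> A\<^sub>N B\<^sub>N D t\<^sub>0 \<theta> K A\<^sub>c\<^sub>l P
    \<beta> \<gamma>\<^sub>1 \<gamma>\<^sub>2 nBK C\<^sub>1 C\<^sub>3 C\<^sub>4 C\<^sub>5 C\<^sub>6 \<kappa>\<^sub>0
    by (intro predictor_feedback_loop.intro hilbert predictor_feedback_loop_axioms.intro) fact+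
  have gain: "(D\<^sub>1 * C1' + D\<^sub>2) * C\<^sub>4 * sqrt (C\<^sub>6 / (2 * \<kappa>\<^sub>0)) < 1" by (rule small_gain)
  obtain q T \<delta> where q: "q < 1" and T: "T > 0" and \<delta>: "0 < \<delta>" "\<delta> < \<kappa>\<^sub>0"
    and qT: "C0'\<^sup>2 * exp (- 2 * (\<kappa>' - \<delta>) * T) \<le> q"
    and margin: "(D\<^sub>1 * C1' * (exp (\<delta> * T) / sqrt (1 - q)) + D\<^sub>2) * C\<^sub>4
        * (sqrt (C\<^sub>6 / (2 * (\<kappa>\<^sub>0 - \<delta>))) * exp (\<delta> * D)) < 1"
    using small_gain_margin[OF C012(1) \<kappa>0_pos gain] by metis
  define t1 where "t1 = D + t\<^sub>0"
  \<comment> \<open>Gains in the norm weighted by \<open>exp (\<delta> t)\<close>: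
    \<open>\<rho>\<close> inflates those assumed for \<open>f\<^sub>1\<close>, \<open>g\<close>
    leads from the forcing to the root of the functional, \<open>i\<close> from the initial interval
    to it, and \<open>k\<close> from it to the control.\<close>
  define \<rho> where "\<rho> = exp (\<delta> * T) / sqrt (1 - q)"
  define g where "g = sqrt (C\<^sub>6 / (2 * (\<kappa>\<^sub>0 - \<delta>))) * exp (\<delta> * D)"
  define i where "i = exp (\<delta> * t1) * sqrt init_V"
  define k where "k = mnorm K / sqrt (\<gamma>\<^sub>1 * lambda_min P)"
  \<comment> \<open>Total gain from the state to the forcing, through \<open>x\<close> and directly.
    The loop gain is \<open>C\<^sub>4 g p\<close>, and \<open>\<eta>\<close> sums the geometric
    series of passes through the loop.\<close>
  define p where "p = D\<^sub>1 * \<rho> * C1' + D\<^sub>2"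
  define \<eta> where "\<eta> = 1 / (1 - C\<^sub>4 * g * p)"
  define e0 where "e0 = \<eta> * (C\<^sub>4 * g * (D\<^sub>1 * \<rho> * C0'))"
  define e2 where "e2 = \<eta> * (exp (\<delta> * t1) + C\<^sub>4 * i)"
  define e3 where "e3 = \<eta> * (C\<^sub>4 * g * (D\<^sub>1 * \<rho> * C2' + D\<^sub>3))"
  define G0 where "G0 = \<rho> * C0' + (\<rho> * C1' + 1) * e0"
  define G2 where "G2 = (\<rho> * C1' + 1) * e2"
  define G3 where "G3 = (\<rho> * C1' + 1) * e3 + \<rho> * C2'"
  define H0 where "H0 = k * g * (p * e0 + D\<^sub>1 * \<rho> * C0')"
  define H2 where "H2 = k * (i + g * (p * e2))"
  define H3 where "H3 = k * g * (p * e3 + (D\<^sub>1 * \<rho> * C2' + D\<^sub>3))"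
  have t1: "t1 > 0" using D t0 by (simp add: t1_def)
  have \<rho>: "\<rho> \<ge> 0" unfolding \<rho>_def using q by simp
  have g: "g \<ge> 0" unfolding g_def using C6_nonneg \<delta> by simp
  have i: "i \<ge> 0" unfolding i_def using init_V_nonneg by simp
  have k: "k \<ge> 0" unfolding k_def using \<gamma>1_pos lambda_min_pos' by simp
  have p: "p \<ge> 0" unfolding p_def using D123 \<rho> C012 by simp
  have small: "C\<^sub>4 * g * p < 1"
    using margin by (simp add: p_def \<rho>_def g_def mult_ac)
  then have \<eta>: "\<eta> > 0" by (simp add: \<eta>_def)
  have e: "e0 \<ge> 0" "e2 \<ge> 0" "e3 \<ge> 0"
    unfolding e0_def e2_def e3_def using \<eta> C4_nonneg g D123 \<rho> C012 i by simp_all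
  have GH: "0 \<le> G0" "0 \<le> G2" "0 \<le> G3" "0 \<le> H0" "0 \<le> H2" "0 \<le> H3"
    unfolding G0_def G2_def G3_def H0_def H2_def H3_def
    using e \<rho> g i k p D123 C012 by simp_all
  \<comment> \<open>Stated for arbitrary bounds \<open>M\<close> and \<open>W\<close>; the suprema
    of the claim are inserted for them at the end.\<close>
  have main: "exp (\<delta> * t) * (norm (x t) + norm (X t)) \<le> G0 * norm x\<^sub>0 + G2 * M + G3 * W \<and>
      exp (\<delta> * t) * norm (u t) \<le> H0 * norm x\<^sub>0 + H2 * M + H3 * W"
    if v: "continuous_on {0..} v"
      and sol: "classical_solution DA \<A> \<B> f\<^sub>1 f\<^sub>2 \<iota> ip \<psi> D \<theta> A\<^sub>N B\<^sub>N K x\<^sub>0 X\<^sub>0 v x X u"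
      and t: "t \<ge> t1"
      and M: "\<And>s. s \<in> {0..t1} \<Longrightarrow> norm (X s) \<le> M"
      and W: "\<And>s. s \<in> {0..t} \<Longrightarrow> exp (\<delta> * s) * norm (v s) \<le> W"
    for x\<^sub>0 X\<^sub>0 v x X u t M W
  proof -
    have X_cont: "continuous_on {0..} X" and x_init: "x 0 = x\<^sub>0"
      and x_deriv: "\<And>s. s \<ge> 0 \<Longrightarrow> (x has_vector_derivative f\<^sub>1 (x s) (X s) (v s)) (at s within {0..})"
      and X_dom: "\<And>s. s \<ge> 0 \<Longrightarrow> X s \<in> DA"
      and X_deriv: "\<And>s. s \<ge> 0 \<Longrightarrow> (X has_vector_derivative \<A> (X s) + f\<^sub>2 (x s) (X s) (v s)) (at s within {0..})"
      and bdry: "\<And>s. s \<ge> 0 \<Longrightarrow> \<B> (X s) = u (s - D)"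
      and fb: "predictor_feedback D \<theta> A\<^sub>N B\<^sub>N K (\<lambda>t. mode_coords \<iota> ip \<psi> (X t)) u"
      using sol unfolding classical_solution_def by blast+
    \<comment> \<open>The weighted supremum over \<open>[0, t]\<close> is attained, hence finite
      without any stability, so the loop inequality can be solved for it.\<close>
    have "\<exists>s\<in>{0..t}. \<forall>r\<in>{0..t}. exp (\<delta> * r) * norm (X r) \<le> exp (\<delta> * s) * norm (X s)"
      using t t1 by (intro continuous_attains_sup continuous_intros continuous_on_subset[OF X_cont]) auto
    then obtain s where s: "s \<in> {0..t}"
      and smax: "\<And>r. r \<in> {0..t} \<Longrightarrow> exp (\<delta> * r) * norm (X r) \<le> exp (\<delta> * s) * norm (X s)" by blast
    define E where "E = exp (\<delta> * s) * norm (X s)"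
    have E: "exp (\<delta> * r) * norm (X r) \<le> E" if "r \<in> {0..t}" for r
      unfolding E_def by (rule smax[OF that])
    define \<xi> where "\<xi> = \<rho> * (C0' * norm x\<^sub>0 + C1' * E + C2' * W)"
    define \<Phi> where "\<Phi> = D\<^sub>1 * \<xi> + D\<^sub>2 * E + D\<^sub>3 * W"
    have \<xi>: "exp (\<delta> * r) * norm (x r) \<le> \<xi>" if r: "r \<in> {0..t}" for r
      unfolding \<xi>_def \<rho>_def x_init[symmetric]
      by (rule ode_iss_fading_memory[OF A4_3 C012(2-4,1) T \<delta>(1) q qT X_cont v x_deriv])
        (use r E W in auto)
    have \<Phi>: "exp (\<delta> * r) * norm (f\<^sub>2 (x r) (X r) (v r)) \<le> \<Phi>" if r: "r \<in> {0..t}" for r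
    proof -
      have "exp (\<delta> * r) * norm (f\<^sub>2 (x r) (X r) (v r))
          \<le> exp (\<delta> * r) * (D\<^sub>1 * norm (x r) + D\<^sub>2 * norm (X r) + D\<^sub>3 * norm (v r))"
        using A4_2 by (intro mult_left_mono) auto
      also have "\<dots> = D\<^sub>1 * (exp (\<delta> * r) * norm (x r)) + D\<^sub>2 * (exp (\<delta> * r) * norm (X r))
          + D\<^sub>3 * (exp (\<delta> * r) * norm (v r))"
        by (simp add: algebra_simps)
      also have "\<dots> \<le> \<Phi>"
        unfolding \<Phi>_def using D123 by (intro add_mono mult_left_mono \<xi> E W r) auto
      finally show ?thesis .
    qed
    have est: "exp (\<delta> * r) * norm (X r) \<le> C\<^sub>4 * (i * M + g * \<Phi>)"
        "exp (\<delta> * r) * norm (u r) \<le> k * (i * M + g * \<Phi>)" if r: "t1 \<le> r" "r \<le> t" for r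
    proof -
      have "exp (\<delta> * s) * norm (f\<^sub>2 (x s) (X s) (v s)) \<le> \<Phi>" if "s \<in> {0..r}" for s
        using \<Phi>[of s] that r by simp
      note forced_estimate[OF X_dom X_cont X_deriv bdry fb \<delta> r(1)[unfolded t1_def] M[unfolded t1_def] this]
      then show "exp (\<delta> * r) * norm (X r) \<le> C\<^sub>4 * (i * M + g * \<Phi>)"
          "exp (\<delta> * r) * norm (u r) \<le> k * (i * M + g * \<Phi>)"
        by (simp_all add: i_def g_def k_def t1_def)
    qed
    have M0: "M \<ge> 0" using order_trans[OF norm_ge_zero M[of 0]] t1 by simp
    have \<Phi>0: "\<Phi> \<ge> 0" using order_trans[OF _ \<Phi>[of 0]] t t1 by simp
    \<comment> \<open>The maximum lies either in the initial interval, where the state is bounded by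
      \<open>M\<close>, or beyond it, where the forced estimate applies at time
      \<open>s\<close>.\<close>
    have "E \<le> exp (\<delta> * t1) * M + C\<^sub>4 * (i * M + g * \<Phi>)"
    proof (cases "s \<le> t1")
      case True
      have "E \<le> exp (\<delta> * t1) * M"
        unfolding E_def using True s \<delta> M by (intro mult_mono) auto
      moreover have "C\<^sub>4 * (i * M + g * \<Phi>) \<ge> 0" using C4_nonneg i g M0 \<Phi>0 by simp
      ultimately show ?thesis by linarith
    next
      case False
      then have "E \<le> C\<^sub>4 * (i * M + g * \<Phi>)" unfolding E_def using s by (intro est) auto
      then show ?thesis using M0 by (simp add: add_increasing)
    qed
    also have "\<dots> = (exp (\<delta> * t1) + C\<^sub>4 * i) * M + C\<^sub>4 * g * \<Phi>" by (simp add: algebra_simps)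
    finally have "E \<le> (exp (\<delta> * t1) + C\<^sub>4 * i) * M + C\<^sub>4 * g * \<Phi>" .
    moreover have \<Phi>_eq: "\<Phi> = p * E + D\<^sub>1 * \<rho> * C0' * norm x\<^sub>0 + (D\<^sub>1 * \<rho> * C2' + D\<^sub>3) * W"
      unfolding \<Phi>_def \<xi>_def p_def by (simp add: algebra_simps)
    ultimately have "(1 - C\<^sub>4 * g * p) * E \<le> (exp (\<delta> * t1) + C\<^sub>4 * i) * M
        + C\<^sub>4 * g * (D\<^sub>1 * \<rho> * C0') * norm x\<^sub>0 + C\<^sub>4 * g * (D\<^sub>1 * \<rho> * C2' + D\<^sub>3) * W"
      by (simp add: algebra_simps)
    \<comment> \<open>\<open>\<eta>\<close> is the inverse of the factor in front of
      \<open>E\<close>, which the small gain condition makes positive.\<close>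
    then have "\<eta> * ((1 - C\<^sub>4 * g * p) * E) \<le> \<eta> * ((exp (\<delta> * t1) + C\<^sub>4 * i) * M
        + C\<^sub>4 * g * (D\<^sub>1 * \<rho> * C0') * norm x\<^sub>0 + C\<^sub>4 * g * (D\<^sub>1 * \<rho> * C2' + D\<^sub>3) * W)"
      using \<eta> by (intro mult_left_mono) auto
    moreover have "\<eta> * ((1 - C\<^sub>4 * g * p) * E) = E" using small by (simp add: \<eta>_def)
    ultimately have E_le: "E \<le> e0 * norm x\<^sub>0 + e2 * M + e3 * W"
      by (simp add: e0_def e2_def e3_def algebra_simps)
    have "exp (\<delta> * t) * (norm (x t) + norm (X t)) \<le> \<xi> + E"
      using \<xi>[of t] E[of t] t t1 by (simp add: distrib_left)
    also have "\<dots> = \<rho> * C0' * norm x\<^sub>0 + (\<rho> * C1' + 1) * E + \<rho> * C2' * W"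
      by (simp add: \<xi>_def algebra_simps)
    also have "\<dots> \<le> \<rho> * C0' * norm x\<^sub>0 + (\<rho> * C1' + 1) * (e0 * norm x\<^sub>0 + e2 * M + e3 * W) + \<rho> * C2' * W"
      using \<rho> C012 by (intro add_mono mult_left_mono E_le) auto
    also have "\<dots> = G0 * norm x\<^sub>0 + G2 * M + G3 * W"
      by (simp add: G0_def G2_def G3_def algebra_simps)
    finally have G: "exp (\<delta> * t) * (norm (x t) + norm (X t)) \<le> G0 * norm x\<^sub>0 + G2 * M + G3 * W" .
    have "exp (\<delta> * t) * norm (u t) \<le> k * (i * M + g * \<Phi>)" by (rule est(2)) (use t in auto)
    also have "\<dots> \<le> k * (i * M + g * (p * (e0 * norm x\<^sub>0 + e2 * M + e3 * W)
        + D\<^sub>1 * \<rho> * C0' * norm x\<^sub>0 + (D\<^sub>1 * \<rho> * C2' + D\<^sub>3) * W))"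
      unfolding \<Phi>_eq using k g p by (intro mult_left_mono add_mono E_le order_refl) auto
    also have "\<dots> = H0 * norm x\<^sub>0 + H2 * M + H3 * W"
      by (simp add: H0_def H2_def H3_def algebra_simps)
    finally show ?thesis using G by blast
  qed
  \<comment> \<open>Division by \<open>exp (\<delta> t)\<close>; the zero term and
    \<open>norm X\<^sub>0\<close> are added to match the form of the claim.\<close>
  have bound: "n \<le> c0 * exp (- \<delta> * t) * (norm x\<^sub>0 + norm X\<^sub>0) + 0 * exp (- \<delta> * t) * (SUP \<tau>\<in>{0..D + t\<^sub>0}. norm (x \<tau>))
      + c2 * exp (- \<delta> * t) * M + c3 * N"
    if "exp (\<delta> * t) * n \<le> c0 * norm x\<^sub>0 + c2 * M + c3 * (exp (\<delta> * t) * N)" "c0 \<ge> 0"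
    for n c0 c2 c3 M N t and x\<^sub>0 :: "'k^'n" and X\<^sub>0 :: 'h and x :: "real \<Rightarrow> 'k^'n"
  proof -
    have "exp (- \<delta> * t) * (exp (\<delta> * t) * n) \<le> exp (- \<delta> * t) * (c0 * norm x\<^sub>0 + c2 * M + c3 * (exp (\<delta> * t) * N))"
      using that(1) by (intro mult_left_mono) auto
    then have "n \<le> exp (- \<delta> * t) * (c0 * norm x\<^sub>0) + c2 * exp (- \<delta> * t) * M + c3 * N"
      by (simp add: distrib_left mult.left_commute flip: mult.assoc exp_add)
    moreover have "exp (- \<delta> * t) * (c0 * norm x\<^sub>0) \<le> exp (- \<delta> * t) * (c0 * (norm x\<^sub>0 + norm X\<^sub>0))"
      using that(2) by (intro mult_left_mono) auto
    ultimately show ?thesis by (simp add: mult_ac)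
  qed
  show ?thesis
  \<comment> \<open>The coefficients of the supremum of \<open>x\<close> are chosen to be 0:
    \<open>ode_iss_fading_memory\<close> already bounds \<open>x\<close> by
    \<open>x\<^sub>0\<close>, the state and the disturbance.\<close>
  proof (rule exI[of _ \<delta>], rule exI[of _ G0], rule exI[of _ 0], rule exI[of _ G2], rule exI[of _ G3],
      rule exI[of _ H0], rule exI[of _ 0], rule exI[of _ H2], rule exI[of _ H3],
      intro conjI allI impI)
    fix x\<^sub>0 X\<^sub>0 v x X u t
    assume v: "C1_on {0..} v"
      and sol: "classical_solution DA \<A> \<B> f\<^sub>1 f\<^sub>2 \<iota> ip \<psi> D \<theta> A\<^sub>N B\<^sub>N K x\<^sub>0 X\<^sub>0 v x X u"
      and t: "D + t\<^sub>0 \<le> t"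
    have v_cont: "continuous_on {0..} v"
      using v unfolding C1_on_def by (auto intro: continuous_on_vector_derivative)
    have X_cont: "continuous_on {0..} X" using sol by (simp add: classical_solution_def)
    let ?M = "SUP \<tau>\<in>{0..D + t\<^sub>0}. norm (X \<tau>)"
    let ?N = "SUP \<tau>\<in>{0..t}. exp (- \<delta> * (t - \<tau>)) * norm (v \<tau>)"
    have bdd: "bdd_above ((\<lambda>\<tau>. norm (X \<tau>)) ` {0..D + t\<^sub>0})"
        "bdd_above ((\<lambda>\<tau>. exp (- \<delta> * (t - \<tau>)) * norm (v \<tau>)) ` {0..t})"
      by (intro bounded_imp_bdd_above compact_imp_bounded compact_continuous_image continuous_intros
          continuous_on_subset[OF X_cont] continuous_on_subset[OF v_cont]; force)+
    have M: "norm (X s) \<le> ?M" if "s \<in> {0..t1}" for s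
      using that unfolding t1_def by (intro cSUP_upper bdd)
    \<comment> \<open>\<open>?N\<close> carries the weight relative to the final time
      \<open>t\<close>, the estimates that relative to time 0; they differ by the factor
      \<open>exp (\<delta> t)\<close>.\<close>
    have W: "exp (\<delta> * s) * norm (v s) \<le> exp (\<delta> * t) * ?N" if "s \<in> {0..t}" for s
    proof -
      have "exp (\<delta> * s) * norm (v s) = exp (\<delta> * t) * (exp (- \<delta> * (t - s)) * norm (v s))"
        by (simp add: right_diff_distrib flip: mult.assoc exp_add)
      also have "\<dots> \<le> exp (\<delta> * t) * ?N"
        by (intro mult_left_mono cSUP_upper bdd that) auto
      finally show ?thesis .
    qed
    note est = main[OF v_cont sol t[folded t1_def] M W]
    show "norm (x t) + norm (X t) \<le> G0 * exp (- \<delta> * t) * (norm x\<^sub>0 + norm X\<^sub>0)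
        + 0 * exp (- \<delta> * t) * (SUP \<tau>\<in>{0..D + t\<^sub>0}. norm (x \<tau>))
        + G2 * exp (- \<delta> * t) * ?M + G3 * ?N"
      by (rule bound) (use est GH in auto)
    show "norm (u t) \<le> H0 * exp (- \<delta> * t) * (norm x\<^sub>0 + norm X\<^sub>0)
        + 0 * exp (- \<delta> * t) * (SUP \<tau>\<in>{0..D + t\<^sub>0}. norm (x \<tau>))
        + H2 * exp (- \<delta> * t) * ?M + H3 * ?N"
      by (rule bound) (use est GH in auto)
  qed (use \<delta> GH in auto)
qed

end
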